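(* Let $\Lambda(n)$ denote the von Mangoldt function. For every $\varepsilon>0$, as $x\to\infty$, \[ S_{\Lambda}(x)=\sum_{1\leq n\leq x}\Lambda\left(\left[\frac{x}{n}\right]\right)=\left(\sum_{n=1}^{\infty}\frac{\Lambda(n)}{n(n+1)}\right)x+O\left(x^{7/15+1/195+\varepsilon}\right), \] where the implied constant may depend on $\varepsilon$.
   Context: $[t]$ denotes the integer part of the real number $t$. $\Lambda(n)=\log p$ if $n=p^k$ for a prime $p$ and integer $k\geq 1$, and $\Lambda(n)=0$ otherwise. *)

theory Defs
  imports
    "HOL-Analysis.Analysis"
    "HOL-Library.Landau_Symbols"
    "HOL-Number_Theory.Prime_Powers"
begin

definition S_Lambda :: "real \<Rightarrow> real" where
  "S_Lambda x = (\<Sum>n | 1 \<le> n \<and> real n \<le> x. mangoldt (nat \<lfloor>x / real n\<rfloor>))"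

(* The index is shifted by one, so that the series starts at n = 1. *)
definition mangoldt_series_term :: "nat \<Rightarrow> real" where
  "mangoldt_series_term k =
     (let n = Suc k in mangoldt n / (real n * (real n + 1)))"

end

theory Submission
  imports Defs "HOL-Computational_Algebra.Squarefree" "HOL-Real_Asymp.Real_Asymp"
begin

text \<open>Let $\psi(u) = \{u\} - 1/2$. Collecting the $n$ with $[x/n] = d$ turns $S_\Lambda(x)$ into the sum of
  $\Lambda(d) ([x/d] - [x/(d+1)])$, where the difference is $x/(d(d+1)) + \psi(x/(d+1)) - \psi(x/d)$.
  Put $y = x^{1/195}$, so that $y^{92} = x^{7/15+1/195}$. The $d > y^{103}$ and the $d \le y^{92}$ are
  harmless, and what remains is to bound the sums of $\Lambda(d) (\psi(x/(d+1)) - \psi(x/d))$ over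
  dyadic blocks $D < d \le 2D$ in between. Truncating the Fourier series of $\psi$, with an error
  controlled by a Fejer kernel, leads to the sums over $h \sim H$ of
  $|\sum_d \Lambda(d) e(hx/(d+t))|$ with $0 \le t \le 1$, which Vaughan's identity splits into bilinear sums.

  In the type I sums the smooth variable is summed by van der Corput's second derivative test. In the type II
  sums the variable $m$ is cut into cells so short that the summation condition on $mn$ and the shift $t$
  can be dropped. Cauchy's inequality over the cells leaves the phases $(h/n)(x/m - x/m')$, to
  which the double large sieve of Bombieri and Iwaniec applies. Both spacing problems are
  elementary: $|hn' - h'n| \le R$ by the divisor bound, and the one for $1/m - 1/m'$ by sorting the
  pairs of integers according to their greatest common divisors. Working with all $h \sim H$ at once makes this
  strong enough for $x^{92/195}$.\<close>

section \<open>Exponential sums over integers\<close>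

text \<open>For D = y^92 r with 1 \<le> r \<le> y^11 the trivial bound of a block is D up to a
  logarithm and the target is y^92: a saving r is needed, with frequencies h up to about r. The
  obstacle is that a type II estimate saves only the square root of the cell length. Cauchy's
  inequality leaves a diagonal of size H D, so cells of length about s^2 must stay short enough for
  the off-diagonal spacing counts not to exceed it. This imposes inequalities between powers of x,
  H, D, s and the cutting point U. Once U is taken as large as the type II sums demand, the worst
  block is r = y^11, that is D = y^103; the two narrowest conditions there, x s^10 against D^3 and
  U^3 against D, hold with y^4 to spare, up to numerical constants. Since 7/15 + 1/195 = 92/195,
  writing x = y^195 turns each condition into a comparison of integer exponents. Logarithms,
  harmonic sums and divisor functions are all dominated by one \<Gamma>, which becomes a constant
  times a small power of x only at the very end and may enter with any fixed exponent until
  then.\<close>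

definition ee :: "real \<Rightarrow> complex" where "ee t = cis (2 * pi * t)"

lemma norm_ee [simp]: "norm (ee t) = 1" by (simp add: ee_def)
lemma ee_add: "ee (a + b) = ee a * ee b" by (simp add: ee_def cis_mult distrib_left)
lemma ee_0 [simp]: "ee 0 = 1" by (simp add: ee_def)
lemma cnj_ee [simp]: "cnj (ee t) = ee (- t)" by (simp add: ee_def cis_cnj)
lemma ee_diff: "ee (a - b) = ee a * ee (- b)" using ee_add[of a "-b"] by simp
lemma ee_of_nat_mult: "ee (real n * t) = ee t ^ n"
proof -
  have "2 * pi * (real n * t) = real n * (2 * pi * t)" by simp
  thus ?thesis unfolding ee_def by (metis Complex.DeMoivre)
qed
lemma ee_int_add [simp]: "ee (t + of_int k) = ee t"
proof -
  have "cis (2 * pi * real_of_int k) = 1" by (intro cis_multiple_2pi) auto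
  thus ?thesis by (simp add: ee_add) (simp add: ee_def)
qed

lemma norm_ee_diff_1: "norm (1 - ee t) = 2 * \<bar>sin (pi * t)\<bar>"
proof -
  have "norm (ee t - 1) = 2 * \<bar>sin (pi * t)\<bar>"
    using dist_exp_i_1[of "2*pi*t"] by (simp add: ee_def cis_conv_exp)
  thus ?thesis by (simp add: norm_minus_commute)
qed

lemma norm_ee_diff_le: "norm (ee a - ee b) \<le> 2 * pi * \<bar>a - b\<bar>"
proof -
  have "ee a - ee b = ee b * (ee (a - b) - 1)" by (simp add: algebra_simps flip: ee_add)
  hence "norm (ee a - ee b) = norm (1 - ee (a - b))" by (simp add: norm_mult norm_minus_commute)
  also have "\<dots> \<le> 2 * \<bar>pi * (a - b)\<bar>" unfolding norm_ee_diff_1 by (intro mult_left_mono abs_sin_x_le_abs_x) auto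
  also have "\<dots> = 2 * pi * \<bar>a - b\<bar>" by (simp add: abs_mult)
  finally show ?thesis .
qed

text \<open>Jordan's inequality: the concave function sin(pi t) lies above its chord on
  [0, 1/2].\<close>

lemma sin_pi_ge:
  assumes "0 \<le> t" "t \<le> 1 / 2"
  shows "sin (pi * t) \<ge> 2 * t"
proof -
  have c: "concave_on {0..1/2} (\<lambda>t. sin (pi * t))"
  proof (rule f''_le0_imp_concave)
    fix x :: real assume x: "x \<in> {0..1/2}"
    show "((\<lambda>t. sin (pi * t)) has_real_derivative pi * cos (pi * x)) (at x)"
      by (auto intro!: derivative_eq_intros)
    show "((\<lambda>t. pi * cos (pi * t)) has_real_derivative - (pi * pi) * sin (pi * x)) (at x)"
      by (auto intro!: derivative_eq_intros)
    have "sin (pi * x) \<ge> 0" using x by (intro sin_ge_zero) (auto simp: field_simps)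
    thus "- (pi * pi) * sin (pi * x) \<le> 0" by (simp add: mult_nonneg_nonneg)
  qed auto
  have "sin (pi * ((1 - 2*t) *\<^sub>R 0 + (2*t) *\<^sub>R (1/2))) \<ge> (1 - 2*t) * sin (pi * 0) + (2*t) * sin (pi * (1/2))"
    using assms by (intro concave_onD[OF c]) auto
  thus ?thesis by simp
qed

lemma norm_ee_diff_1_ge:
  assumes "\<bar>t\<bar> \<le> 1 / 2"
  shows "norm (1 - ee t) \<ge> 4 * \<bar>t\<bar>"
proof -
  have "\<bar>sin (pi * t)\<bar> \<ge> sin (pi * \<bar>t\<bar>)"
    by (cases "t \<ge> 0") auto
  with sin_pi_ge[of "\<bar>t\<bar>"] assms show ?thesis unfolding norm_ee_diff_1 by auto
qed

lemma norm_sum_ee_geometric_le: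
  assumes "\<bar>t\<bar> \<le> 1 / 2" "t \<noteq> 0"
  shows "norm (\<Sum>k<K. ee (real k * t)) \<le> 1 / (2 * \<bar>t\<bar>)"
proof -
  have ne: "ee t \<noteq> 1" using norm_ee_diff_1_ge[OF assms(1)] assms(2) by auto
  have "(\<Sum>k<K. ee (real k * t)) = (ee t ^ K - 1) / (ee t - 1)"
    unfolding ee_of_nat_mult by (rule geometric_sum[OF ne])
  hence "norm (\<Sum>k<K. ee (real k * t)) = norm (ee t ^ K - 1) / norm (1 - ee t)"
    by (simp add: norm_divide norm_minus_commute)
  also have "\<dots> \<le> 2 / (4 * \<bar>t\<bar>)"
  proof (rule frac_le)
    show "norm (ee t ^ K - 1) \<le> 2" using norm_triangle_ineq4[of "ee t ^ K" 1] by (simp add: norm_power)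
  qed (use assms norm_ee_diff_1_ge in auto)
  finally show ?thesis by simp
qed

text \<open>The real part is constant, so 1/(1 - e(t)) varies only through a cotangent, and for
  monotone t its total variation telescopes.\<close>

lemma inverse_one_minus_ee:
  assumes "sin (pi * t) \<noteq> 0"
  shows "1 / (1 - ee t) = Complex (1/2) (cos (pi * t) / (2 * sin (pi * t)))"
proof -
  define s c where "s = sin (pi * t)" and "c = cos (pi * t)"
  have sc: "s * s + c * c = 1" using sin_cos_squared_add[of "pi*t"] by (simp add: s_def c_def power2_eq_square)
  have "ee t = Complex (1 - 2 * s * s) (2 * s * c)"
    using cos_double_sin[of "pi*t"] sin_double[of "pi*t"]
    by (simp add: ee_def s_def c_def complex_eq_iff power2_eq_square mult_ac)
  hence "(1 - ee t) * Complex (1/2) (c / (2 * s)) = 1"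
    using assms sc by (simp add: complex_eq_iff field_simps flip: s_def) (simp add: algebra_simps flip: distrib_left)
  moreover have "1 - ee t \<noteq> 0" using calculation by auto
  ultimately show ?thesis unfolding s_def c_def by (simp add: field_simps)
qed

text \<open>Abel summation is applied to
  $e(f(n)) = (e(f(n)) - e(f(n+1))) / (1 - e(f(n+1) - f(n)))$.\<close>

lemma kusmin_landau_0:
  fixes f :: "nat \<Rightarrow> real"
  assumes d: "0 < d" "d \<le> 1/2"
    and g: "\<And>n. a \<le> n \<Longrightarrow> n < b \<Longrightarrow> d \<le> f (Suc n) - f n \<and> f (Suc n) - f n \<le> 1 - d"
    and mono: "\<And>n. a \<le> n \<Longrightarrow> Suc n < b \<Longrightarrow> f (Suc n) - f n \<le> f (Suc (Suc n)) - f (Suc n)"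
  shows "norm (\<Sum>n\<in>{a..<b}. ee (f n)) \<le> 1 / d"
proof (cases "a < b")
  case False
  thus ?thesis using d by simp
next
  case True
  define g where "g n = f (Suc n) - f n" for n
  define G where "G n = 1 / (1 - ee (g n))" for n
  define c where "c n = cos (pi * g n) / sin (pi * g n)" for n
  have sin_ge: "sin (pi * g n) \<ge> 2 * d" if "a \<le> n" "n < b" for n
  proof (cases "g n \<le> 1/2")
    case True
    thus ?thesis using sin_pi_ge[of "g n"] g[OF that] d by (auto simp: g_def)
  next
    case False
    have "sin (pi * g n) = sin (pi * (1 - g n))" by (simp add: algebra_simps)
    thus ?thesis using sin_pi_ge[of "1 - g n"] g[OF that] d False by (auto simp: g_def)
  qed
  have sin_pos: "sin (pi * g n) > 0" if "a \<le> n" "n < b" for n using sin_ge[OF that] d by simp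
  have G: "G n = Complex (1/2) (c n / 2)" if "a \<le> n" "n < b" for n
    unfolding G_def c_def using inverse_one_minus_ee[of "g n"] sin_pos[OF that] by simp
  have c_le: "\<bar>c n\<bar> \<le> 1 / (2 * d)" if "a \<le> n" "n < b" for n
    unfolding c_def abs_divide using sin_ge[OF that] d by (intro frac_le) auto
  have G_le: "norm (G n) \<le> 1 / (4 * d)" if "a \<le> n" "n < b" for n
  proof -
    have "norm (1 - ee (g n)) \<ge> 4 * d" using sin_ge[OF that] d unfolding norm_ee_diff_1 by linarith
    thus ?thesis unfolding G_def norm_divide using d by (intro frac_le) auto
  qed
  \<comment> \<open>A difference of cotangents is the sine of the difference over the product of the
    sines; that sine is nonnegative because consecutive increments differ by at most 1.\<close>
  have c_mono: "c (Suc n) \<le> c n" if "a \<le> n" "Suc n < b" for n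
  proof -
    have "c n - c (Suc n) = sin (pi * (g (Suc n) - g n)) / (sin (pi * g n) * sin (pi * g (Suc n)))"
      using sin_pos[of n] sin_pos[of "Suc n"] that
      by (simp add: c_def field_simps right_diff_distrib sin_diff)
    also have "sin (pi * (g (Suc n) - g n)) \<ge> 0"
    proof (rule sin_ge_zero)
      show "0 \<le> pi * (g (Suc n) - g n)" using mono[OF that] by (simp add: g_def)
      have "g (Suc n) - g n \<le> 1" using g[of n] g[of "Suc n"] that d by (auto simp: g_def)
      thus "pi * (g (Suc n) - g n) \<le> pi" by (simp add: mult_left_le)
    qed
    hence "sin (pi * (g (Suc n) - g n)) / (sin (pi * g n) * sin (pi * g (Suc n))) \<ge> 0"
      using sin_pos[of n] sin_pos[of "Suc n"] that by simp
    finally show ?thesis by simp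
  qed
  have step: "ee (f n) = (ee (f n) - ee (f (Suc n))) * G n" if "a \<le> n" "n < b" for n
  proof -
    have "ee (f (Suc n)) = ee (f n) * ee (g n)" by (simp add: g_def flip: ee_add)
    moreover have "1 - ee (g n) \<noteq> 0"
      using sin_pos[OF that] norm_ee_diff_1[of "g n"] by auto
    ultimately show ?thesis by (simp add: G_def field_simps)
  qed
  \<comment> \<open>Summation by parts and the bound for its variation go through one induction:
    each new term has norm half a decrement of \<open>c\<close>, so the bound telescopes.\<close>
  have main: "(\<Sum>n\<in>{a..<m}. ee (f n)) = G a * ee (f a) - G (m - 1) * ee (f m)
      + (\<Sum>n\<in>{Suc a..<m}. ee (f n) * (G n - G (n - 1)))
      \<and> norm (\<Sum>n\<in>{Suc a..<m}. ee (f n) * (G n - G (n - 1))) \<le> (c a - c (m - 1)) / 2"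
    if "Suc a \<le> m" "m \<le> b" for m
    using that
  proof (induction m rule: dec_induct)
    case base
    thus ?case using step[of a] by (simp add: algebra_simps)
  next
    case (step m)
    have m: "a < m" "m < b" using step by auto
    have IH: "(\<Sum>n\<in>{a..<m}. ee (f n)) = G a * ee (f a) - G (m - 1) * ee (f m)
      + (\<Sum>n\<in>{Suc a..<m}. ee (f n) * (G n - G (n - 1)))"
      "norm (\<Sum>n\<in>{Suc a..<m}. ee (f n) * (G n - G (n - 1))) \<le> (c a - c (m - 1)) / 2"
      using step by auto
    have "a \<le> m - 1" "m - 1 < b" using m by auto
    from G[OF this] G[of m] m have "G m - G (m - 1) = Complex 0 ((c m - c (m - 1)) / 2)"
      by (simp add: complex_eq_iff field_simps)
    hence n: "norm (ee (f m) * (G m - G (m - 1))) = (c (m - 1) - c m) / 2"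
      using c_mono[of "m - 1"] m by (simp add: norm_mult complex_norm)
    have e: "(\<Sum>n\<in>{Suc a..<Suc m}. ee (f n) * (G n - G (n - 1))) =
        (\<Sum>n\<in>{Suc a..<m}. ee (f n) * (G n - G (n - 1))) + ee (f m) * (G m - G (m - 1))"
      using m by (simp add: sum.atLeastLessThan_Suc)
    have e2: "(\<Sum>n\<in>{a..<Suc m}. ee (f n)) = (\<Sum>n\<in>{a..<m}. ee (f n)) + (ee (f m) - ee (f (Suc m))) * G m"
      using m \<open>\<And>n. a \<le> n \<Longrightarrow> n < b \<Longrightarrow> ee (f n) = (ee (f n) - ee (f (Suc n))) * G n\<close>[of m]
      by (simp add: sum.atLeastLessThan_Suc)
    show ?case
      unfolding e e2 IH(1) using norm_triangle_ineq[of "(\<Sum>n\<in>{Suc a..<m}. ee (f n) * (G n - G (n - 1)))" "ee (f m) * (G m - G (m - 1))"] IH(2) n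
      by (simp add: algebra_simps)
  qed
  have "norm (\<Sum>n\<in>{a..<b}. ee (f n)) \<le> norm (G a) + norm (G (b - 1)) + (c a - c (b - 1)) / 2"
  proof -
    have "norm (\<Sum>n\<in>{a..<b}. ee (f n)) \<le> norm (G a * ee (f a) - G (b - 1) * ee (f b)) + (c a - c (b - 1)) / 2"
    proof -
      have "Suc a \<le> b" "b \<le> b" using True by auto
      note mn = main[OF this]
      show ?thesis
        using arg_cong[OF conjunct1[OF mn], of norm] conjunct2[OF mn] norm_triangle_ineq[of "G a * ee (f a) - G (b - 1) * ee (f b)" "\<Sum>n\<in>{Suc a..<b}. ee (f n) * (G n - G (n - 1))"]
        by linarith
    qed
    also have "norm (G a * ee (f a) - G (b - 1) * ee (f b)) \<le> norm (G a) + norm (G (b - 1))"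
      by (rule order_trans[OF norm_triangle_ineq4]) (simp add: norm_mult)
    finally show ?thesis by simp
  qed
  also have "\<dots> \<le> 1 / (4 * d) + 1 / (4 * d) + (1 / (2 * d) + 1 / (2 * d)) / 2"
  proof -
    have "a \<le> b - 1" "b - 1 < b" using True by auto
    from G_le[OF this] G_le[of a] c_le[OF this] c_le[of a] True show ?thesis
      unfolding abs_le_iff by (intro add_mono divide_right_mono) auto
  qed
  also have "\<dots> = 1 / d" using d by (simp add: field_simps)
  finally show ?thesis .
qed

lemma kusmin_landau:
  fixes f :: "nat \<Rightarrow> real" and k :: int and d :: real
  assumes d: "0 < d" "d \<le> 1/2"
    and g: "\<And>n. a \<le> n \<Longrightarrow> n < b \<Longrightarrow> k + d \<le> f (Suc n) - f n \<and> f (Suc n) - f n \<le> k + 1 - d"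
    and mono: "\<And>n. a \<le> n \<Longrightarrow> Suc n < b \<Longrightarrow> f (Suc n) - f n \<le> f (Suc (Suc n)) - f (Suc n)"
  shows "norm (\<Sum>n\<in>{a..<b}. ee (f n)) \<le> 1 / d"
proof -
  \<comment> \<open>Subtracting an integer multiple of n from the phase changes no term and moves
    the increments into [d, 1 - d].\<close>
  have "norm (\<Sum>n\<in>{a..<b}. ee (f n - of_int k * real n)) \<le> 1 / d"
  proof (rule kusmin_landau_0[OF d])
    fix n assume n: "a \<le> n" "n < b"
    show "d \<le> f (Suc n) - of_int k * real (Suc n) - (f n - of_int k * real n) \<and>
      f (Suc n) - of_int k * real (Suc n) - (f n - of_int k * real n) \<le> 1 - d"
      using g[OF n] by (simp add: algebra_simps)
  next
    fix n assume n: "a \<le> n" "Suc n < b"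
    show "f (Suc n) - of_int k * real (Suc n) - (f n - of_int k * real n)
         \<le> f (Suc (Suc n)) - of_int k * real (Suc (Suc n)) - (f (Suc n) - of_int k * real (Suc n))"
      using mono[OF n] by (simp add: algebra_simps)
  qed
  moreover have "ee (f n - of_int k * real n) = ee (f n)" for n
    using ee_int_add[of "f n" "- k * int n"] by simp
  ultimately show ?thesis by simp
qed

text \<open>Turns level sets of a monotone difference function into index intervals, the form that
  Kusmin-Landau requires.\<close>

lemma convex_finite_nat_set_interval:
  fixes S :: "nat set"
  assumes "finite S" "\<And>x y z. x \<in> S \<Longrightarrow> z \<in> S \<Longrightarrow> x \<le> y \<Longrightarrow> y \<le> z \<Longrightarrow> y \<in> S"
  obtains p q where "S = {p..<q}"
proof (cases "S = {}")
  case True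
  thus ?thesis using that[of 0 0] by simp
next
  case False
  have "S = {Min S..<Suc (Max S)}"
  proof (intro equalityI subsetI)
    fix x assume "x \<in> {Min S..<Suc (Max S)}"
    thus "x \<in> S" using assms(2)[of "Min S" "Max S" x] Min_in[OF assms(1) False] Max_in[OF assms(1) False] by auto
  qed (use assms(1) False in \<open>auto simp: less_Suc_eq_le\<close>)
  thus ?thesis by (rule that)
qed

lemma card_le_of_spread:
  fixes g :: "nat \<Rightarrow> real"
  assumes S: "finite S" and l: "l > 0" and d: "d \<ge> 0"
    and g: "\<And>m n. m \<in> S \<Longrightarrow> n \<in> S \<Longrightarrow> m \<le> n \<Longrightarrow> l * real (n - m) \<le> d"
  shows "real (card S) \<le> d / l + 1"
proof (cases "S = {}")
  case True
  thus ?thesis using l d by simp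
next
  case False
  have "S \<subseteq> {Min S..Max S}" using S by auto
  hence "card S \<le> card {Min S..Max S}" by (intro card_mono) auto
  moreover have le: "Min S \<le> Max S" using S False by simp
  ultimately have "real (card S) \<le> real (Max S - Min S) + 1" by auto
  also have "l * real (Max S - Min S) \<le> d"
    using g[OF Min_in[OF S False] Max_in[OF S False] le] .
  hence "real (Max S - Min S) \<le> d / l" using l by (simp add: field_simps)
  finally show ?thesis by simp
qed

text \<open>The first differences grow by l to C l at each step. Sorted by their integer part they
  fall into at most C l (b - a) + 2 classes. In a class, the n whose difference is within sqrt l of
  an integer are counted trivially, and the others form an interval for Kusmin-Landau.\<close>

lemma van_der_corput_second_derivative:
  fixes f :: "nat \<Rightarrow> real" and l C :: real
  assumes l: "0 < l" "l \<le> 1/4" and C: "C \<ge> 1"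
    and f: "\<And>n. a \<le> n \<Longrightarrow> Suc n < b \<Longrightarrow>
       l \<le> f (Suc (Suc n)) - 2 * f (Suc n) + f n \<and> f (Suc (Suc n)) - 2 * f (Suc n) + f n \<le> C * l"
  shows "norm (\<Sum>n\<in>{a..<b}. ee (f n)) \<le> (C * l * real (b - a) + 2) * (5 / sqrt l)"
proof (cases "a < b")
  case False
  thus ?thesis using l by simp
next
  case True
  define g where "g n = f (Suc n) - f n" for n
  \<comment> \<open>The choice sqrt l balances the count d/l near the integers against the bound 1/d
    away from them.\<close>
  define d where "d = sqrt l"
  have d: "0 < d" "d \<le> 1/2" "d * d = l"
  proof -
    have "sqrt l \<le> sqrt (1/4)" using l by (intro real_sqrt_le_mono) auto
    also have "sqrt (1/4) = (1/2::real)" by (simp add: real_sqrt_divide)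
    finally show "d \<le> 1/2" by (simp add: d_def)
  qed (use l in \<open>auto simp: d_def\<close>)
  have gl: "l * real (n - m) \<le> g n - g m \<and> g n - g m \<le> C * l * real (n - m)" if "a \<le> m" "m \<le> n" "n < b" for m n
    using that(2,3)
  proof (induction n rule: dec_induct)
    case (step n)
    have "a \<le> n" "Suc n < b" using step that by auto
    hence "l \<le> g (Suc n) - g n \<and> g (Suc n) - g n \<le> C * l" using f[of n] by (simp add: g_def)
    thus ?case using step by (simp add: Suc_diff_le algebra_simps)
  qed auto
  have g_mono: "g m \<le> g n" if "a \<le> m" "m \<le> n" "n < b" for m n
  proof -
    have "0 \<le> l * real (n - m)" using l by simp
    with gl[OF that] show ?thesis by linarith
  qed
  define I where "I = {a..<b}"
  define K where "K = (\<lambda>n. \<lfloor>g n\<rfloor>) ` I"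
  have fin: "finite I" "finite K" by (auto simp: I_def K_def)
  have cardK: "real (card K) \<le> C * l * real (b - a) + 2"
  proof -
    have "K \<subseteq> {\<lfloor>g a\<rfloor>..\<lfloor>g (b - 1)\<rfloor>}"
    proof
      fix k assume "k \<in> K"
      then obtain n where n: "a \<le> n" "n < b" "k = \<lfloor>g n\<rfloor>" by (auto simp: K_def I_def)
      thus "k \<in> {\<lfloor>g a\<rfloor>..\<lfloor>g (b - 1)\<rfloor>}"
        using g_mono[of a n] g_mono[of n "b - 1"] by (auto intro!: floor_mono)
    qed
    hence "card K \<le> card {\<lfloor>g a\<rfloor>..\<lfloor>g (b - 1)\<rfloor>}" by (intro card_mono) auto
    moreover have "\<lfloor>g a\<rfloor> \<le> \<lfloor>g (b - 1)\<rfloor>" using g_mono[of a "b - 1"] True by (intro floor_mono) auto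
    ultimately have "real (card K) \<le> of_int (\<lfloor>g (b - 1)\<rfloor> - \<lfloor>g a\<rfloor> + 1)" by simp
    also have "\<dots> \<le> g (b - 1) - g a + 2" by linarith
    also have "g (b - 1) - g a \<le> C * l * real (b - 1 - a)" using gl[of a "b - 1"] True by auto
    also have "\<dots> \<le> C * l * real (b - a)" using C l by (intro mult_left_mono) auto
    finally show ?thesis by simp
  qed
  have part: "norm (\<Sum>n | n \<in> I \<and> \<lfloor>g n\<rfloor> = k. ee (f n)) \<le> 5 / sqrt l" for k
  proof -
    define A where "A = {n\<in>I. k \<le> g n \<and> g n < k + d}"
    define B where "B = {n\<in>I. k + d \<le> g n \<and> g n \<le> k + 1 - d}"
    define E where "E = {n\<in>I. k + 1 - d < g n \<and> g n < k + 1}"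
    have eq: "{n. n \<in> I \<and> \<lfloor>g n\<rfloor> = k} = A \<union> B \<union> E"
      unfolding A_def B_def E_def using d by (auto simp: floor_eq_iff)
    have fins: "finite A" "finite B" "finite E" unfolding A_def B_def E_def using fin by auto
    have "(\<Sum>n | n \<in> I \<and> \<lfloor>g n\<rfloor> = k. ee (f n)) = (\<Sum>n\<in>A \<union> B. ee (f n)) + (\<Sum>n\<in>E. ee (f n))"
      unfolding eq using fins d by (intro sum.union_disjoint) (auto simp: A_def B_def E_def)
    also have "(\<Sum>n\<in>A \<union> B. ee (f n)) = (\<Sum>n\<in>A. ee (f n)) + (\<Sum>n\<in>B. ee (f n))"
      using fins d by (intro sum.union_disjoint) (auto simp: A_def B_def E_def)
    finally have "norm (\<Sum>n | n \<in> I \<and> \<lfloor>g n\<rfloor> = k. ee (f n)) \<le>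
        norm (\<Sum>n\<in>A. ee (f n)) + norm (\<Sum>n\<in>B. ee (f n)) + norm (\<Sum>n\<in>E. ee (f n))"
      using norm_triangle_ineq[of "\<Sum>n\<in>A. ee (f n)" "\<Sum>n\<in>B. ee (f n)"]
        norm_triangle_ineq[of "(\<Sum>n\<in>A. ee (f n)) + (\<Sum>n\<in>B. ee (f n))" "\<Sum>n\<in>E. ee (f n)"] by simp
    also have "norm (\<Sum>n\<in>A. ee (f n)) \<le> d / l + 1"
    proof -
      have "norm (\<Sum>n\<in>A. ee (f n)) \<le> real (card A)" by (rule order_trans[OF norm_sum]) simp
      also have "\<dots> \<le> d / l + 1"
      proof (rule card_le_of_spread)
        fix m n assume "m \<in> A" "n \<in> A" "m \<le> n"
        thus "l * real (n - m) \<le> d" using gl[of m n] by (auto simp: A_def I_def)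
      qed (use fins l d in auto)
      finally show ?thesis .
    qed
    also have "norm (\<Sum>n\<in>E. ee (f n)) \<le> d / l + 1"
    proof -
      have "norm (\<Sum>n\<in>E. ee (f n)) \<le> real (card E)" by (rule order_trans[OF norm_sum]) simp
      also have "\<dots> \<le> d / l + 1"
      proof (rule card_le_of_spread)
        fix m n assume "m \<in> E" "n \<in> E" "m \<le> n"
        thus "l * real (n - m) \<le> d" using gl[of m n] by (auto simp: E_def I_def)
      qed (use fins l d in auto)
      finally show ?thesis .
    qed
    also have "norm (\<Sum>n\<in>B. ee (f n)) \<le> 1 / d"
    proof -
      obtain p q where B: "B = {p..<q}"
      proof (rule convex_finite_nat_set_interval[OF fins(2)])
        fix x y z assume "x \<in> B" "z \<in> B" "x \<le> y" "y \<le> z"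
        thus "y \<in> B" using g_mono[of x y] g_mono[of y z] by (auto simp: B_def I_def)
      qed
      show ?thesis unfolding B
      proof (rule kusmin_landau[OF d(1,2), where k = k])
        fix n assume "p \<le> n" "n < q"
        hence "n \<in> B" by (simp add: B)
        thus "k + d \<le> f (Suc n) - f n \<and> f (Suc n) - f n \<le> k + 1 - d" by (simp add: B_def g_def)
      next
        fix n assume "p \<le> n" "Suc n < q"
        hence "n \<in> B" "Suc n \<in> B" by (simp_all add: B)
        thus "f (Suc n) - f n \<le> f (Suc (Suc n)) - f (Suc n)"
          using g_mono[of n "Suc n"] by (auto simp: B_def I_def g_def)
      qed
    qed
    also have "d / l + 1 + 1 / d + (d / l + 1) \<le> 5 / sqrt l"
    proof -
      have "d / l = 1 / d" using d by (simp add: field_simps flip: d(3))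
      moreover have "1 \<le> (1/2) / d" using d by (simp add: field_simps)
      ultimately show ?thesis using d by (simp add: d_def[symmetric] field_simps)
    qed
    finally show ?thesis by simp
  qed
  have "(\<Sum>n\<in>I. ee (f n)) = (\<Sum>k\<in>K. \<Sum>n | n \<in> I \<and> \<lfloor>g n\<rfloor> = k. ee (f n))"
    unfolding K_def using fin(1) by (rule sum.image_gen)
  hence "norm (\<Sum>n\<in>I. ee (f n)) \<le> (\<Sum>k\<in>K. norm (\<Sum>n | n \<in> I \<and> \<lfloor>g n\<rfloor> = k. ee (f n)))"
    by (simp only:) (rule norm_sum)
  also have "\<dots> \<le> (\<Sum>k\<in>K. 5 / sqrt l)" by (rule sum_mono) (rule part)
  also have "\<dots> = real (card K) * (5 / sqrt l)" by (simp only: sum_constant)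
  also have "\<dots> \<le> (C * l * real (b - a) + 2) * (5 / sqrt l)"
    using cardK l by (intro mult_right_mono) auto
  finally show ?thesis by (simp add: I_def)
qed

section \<open>The divisor bound\<close>

lemma card_divisors_prime_power_mult_le:
  fixes p m a :: nat
  assumes p: "prime p" and m: "m > 0" "\<not> p dvd m"
  shows "card {d. d dvd p ^ a * m} \<le> (a + 1) * card {d. d dvd m}"
proof -
  have "{d. d dvd p ^ a * m} \<subseteq> (\<lambda>(i, d). p ^ i * d) ` ({..a} \<times> {d. d dvd m})"
  proof
    fix d assume "d \<in> {d. d dvd p ^ a * m}"
    hence "d dvd p ^ a * m" by simp
    then obtain u v where uv: "d = u * v" "u dvd p ^ a" "v dvd m"
      using division_decomp by blast
    from uv(2) p obtain i where "i \<le> a" "u = p ^ i"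
      using divides_primepow_nat by blast
    with uv show "d \<in> (\<lambda>(i, d). p ^ i * d) ` ({..a} \<times> {d. d dvd m})" by auto
  qed
  hence "card {d. d dvd p ^ a * m} \<le> card ((\<lambda>(i, d). p ^ i * d) ` ({..a} \<times> {d. d dvd m}))"
    using m by (intro card_mono finite_imageI) auto
  also have "\<dots> \<le> card ({..a} \<times> {d. d dvd m})"
    using m by (intro card_image_le) auto
  also have "\<dots> = (a + 1) * card {d. d dvd m}" by (simp add: card_cartesian_product)
  finally show ?thesis .
qed

text \<open>Removing a prime power p^a from n costs the factor a + 1, which the power of p absorbs
  when p > K. Only the primes up to K cost an extra \<open>c0\<close> each, and the exponent of
  \<open>c0\<close> counts them.\<close>

lemma divisor_bound_aux:
  fixes \<epsilon> c0 :: real and K :: nat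
  assumes c0: "c0 \<ge> 1"
    and small: "\<And>p a. prime (p::nat) \<Longrightarrow> real (a + 1) \<le> c0 * real p powr (real a * \<epsilon>)"
    and large: "\<And>p a. prime (p::nat) \<Longrightarrow> p > K \<Longrightarrow> real (a + 1) \<le> real p powr (real a * \<epsilon>)"
    and n: "n > 0"
  shows "real (card {d. d dvd n}) \<le> c0 ^ card {p \<in> prime_factors n. p \<le> K} * real n powr \<epsilon>"
  using n
proof (induction n rule: less_induct)
  case (less n)
  show ?case
  proof (cases "n = 1")
    case False
    then obtain p where p: "prime p" "p dvd n" using less.prems prime_factor_nat by blast
    define a where "a = multiplicity p n"
    obtain m where m: "n = p ^ a * m" "\<not> p dvd m"
      using multiplicity_decompose'[of n p] p less.prems unfolding a_def by (metis not_prime_unit prime_nat_iff' gr_implies_not0)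
    have a: "a > 0" using p less.prems by (simp add: a_def prime_multiplicity_gt_zero_iff)
    have m0: "m > 0" using m less.prems by (auto intro: Nat.gr0I)
    have lt: "m < n"
    proof -
      have "p ^ a > 1" by (rule one_less_power[OF prime_gt_1_nat[OF p(1)] a])
      thus ?thesis using m m0 by simp
    qed
    have pf: "prime_factors n = insert p (prime_factors m)"
      using m(1) p(1) a m0
      by (auto simp: in_prime_factors_iff prime_dvd_mult_iff prime_dvd_power_iff primes_dvd_imp_eq)
    have np: "p \<notin> prime_factors m" using m by auto
    have pw: "real n powr \<epsilon> = real p powr (real a * \<epsilon>) * real m powr \<epsilon>"
      using p(1) prime_gt_0_nat[of p] m(1) by (simp add: powr_mult powr_powr flip: powr_realpow)
    define w where "w = (if p \<le> K then c0 else 1)"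
    have ca: "real (a + 1) \<le> w * real p powr (real a * \<epsilon>)"
      using small[OF p(1)] large[OF p(1)] by (auto simp: w_def)
    have cc: "c0 ^ card {q \<in> prime_factors n. q \<le> K} = w * c0 ^ card {q \<in> prime_factors m. q \<le> K}"
    proof (cases "p \<le> K")
      case True
      hence "{q \<in> prime_factors n. q \<le> K} = insert p {q \<in> prime_factors m. q \<le> K}" by (auto simp: pf)
      with np True show ?thesis by (simp add: w_def)
    next
      case False
      hence "{q \<in> prime_factors n. q \<le> K} = {q \<in> prime_factors m. q \<le> K}" by (auto simp: pf)
      with False show ?thesis by (simp add: w_def)
    qed
    have "real (card {d. d dvd n}) \<le> real ((a + 1) * card {d. d dvd m})"
      unfolding m(1) using card_divisors_prime_power_mult_le[OF p(1) m0 m(2)] of_nat_le_iff by blast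
    also have "\<dots> = real (a + 1) * real (card {d. d dvd m})" by (simp only: of_nat_mult)
    also have "\<dots> \<le> (w * real p powr (real a * \<epsilon>)) * (c0 ^ card {p \<in> prime_factors m. p \<le> K} * real m powr \<epsilon>)"
      using less.IH[OF lt m0] ca c0 by (intro mult_mono) (auto simp: w_def)
    also have "\<dots> = c0 ^ card {p \<in> prime_factors n. p \<le> K} * real n powr \<epsilon>"
      unfolding cc pw by (simp add: mult_ac)
    finally show ?thesis .
  qed auto
qed

lemma divisor_bound:
  fixes \<epsilon> :: real
  assumes e: "\<epsilon> > 0"
  obtains C where "C \<ge> 1" "\<And>n::nat. n > 0 \<Longrightarrow> real (card {d. d dvd n}) \<le> C * real n powr \<epsilon>"
proof -
  \<comment> \<open>\<open>c0\<close> comes from a + 1 \<le> c0 (1 + a \<epsilon> ln 2) \<le> c0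
    2^(a \<epsilon>). Beyond \<open>K\<close> one has p^\<epsilon> \<ge> 2, and a + 1 \<le> 2^a
    needs no constant.\<close>
  define c0 where "c0 = max 1 (1 / (\<epsilon> * ln 2))"
  define K where "K = nat \<lceil>2 powr (1 / \<epsilon>)\<rceil>"
  have c0: "c0 \<ge> 1" by (simp add: c0_def)
  have c0': "c0 * (\<epsilon> * ln 2) \<ge> 1"
  proof -
    have "1 / (\<epsilon> * ln 2) * (\<epsilon> * ln 2) \<le> c0 * (\<epsilon> * ln 2)"
      using e by (intro mult_right_mono) (auto simp: c0_def)
    thus ?thesis using e by simp
  qed
  have small: "real (a + 1) \<le> c0 * real p powr (real a * \<epsilon>)" if "prime p" for p a :: nat
  proof -
    have "real (a + 1) \<le> c0 + c0 * (\<epsilon> * ln 2) * real a"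
      using c0 mult_right_mono[OF c0', of "real a"] by simp
    also have "\<dots> = c0 * (1 + real a * \<epsilon> * ln 2)" by (simp add: algebra_simps)
    also have "1 + real a * \<epsilon> * ln 2 \<le> exp (real a * \<epsilon> * ln 2)" by (rule exp_ge_add_one_self)
    also have "exp (real a * \<epsilon> * ln 2) = 2 powr (real a * \<epsilon>)" by (simp add: powr_def)
    also have "\<dots> \<le> real p powr (real a * \<epsilon>)"
      using prime_ge_2_nat[OF that] e by (intro powr_mono2) auto
    finally show ?thesis using c0 by simp
  qed
  have large: "real (a + 1) \<le> real p powr (real a * \<epsilon>)" if "prime p" "p > K" for p a :: nat
  proof -
    have "2 powr (1 / \<epsilon>) \<le> real p" using that(2) unfolding K_def by linarith
    hence "(2 powr (1 / \<epsilon>)) powr (real a * \<epsilon>) \<le> real p powr (real a * \<epsilon>)"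
      using e by (intro powr_mono2) auto
    hence "2 ^ a \<le> real p powr (real a * \<epsilon>)" using e by (simp add: powr_powr powr_realpow)
    moreover have "a + 1 \<le> 2 ^ a" by (induction a) auto
    hence "real (a + 1) \<le> 2 ^ a" by (metis of_nat_le_iff of_nat_numeral of_nat_power)
    ultimately show ?thesis by simp
  qed
  show ?thesis
  proof (rule that[of "c0 ^ K"])
    show "c0 ^ K \<ge> 1" using c0 by simp
  next
    fix n :: nat assume n: "n > 0"
    have "{p \<in> prime_factors n. p \<le> K} \<subseteq> {1..K}" by (auto simp: Suc_le_eq in_prime_factors_iff intro!: prime_gt_0_nat)
    hence "card {p \<in> prime_factors n. p \<le> K} \<le> card {1..K}" by (intro card_mono) auto
    hence "c0 ^ card {p \<in> prime_factors n. p \<le> K} \<le> c0 ^ K" using c0 by (intro power_increasing) auto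
    thus "real (card {d. d dvd n}) \<le> c0 ^ K * real n powr \<epsilon>"
      using divisor_bound_aux[OF c0 small large n, of K] by (meson mult_right_mono order_trans powr_ge_zero)
  qed
qed

section \<open>Vaughan's identity\<close>

definition moebius :: "nat \<Rightarrow> real" where
  "moebius n = (if squarefree n then (-1) ^ card (prime_factors n) else 0)"

lemma moebius_1 [simp]: "moebius (Suc 0) = 1" by (simp add: moebius_def)

lemma abs_moebius_le: "\<bar>moebius n\<bar> \<le> 1"
  by (simp add: moebius_def power_abs)

lemma moebius_prime_mult:
  assumes p: "prime p" "\<not> p dvd d" and d: "d > 0"
  shows "moebius (p * d) = - moebius d"
proof -
  have cop: "coprime p d" using p by (simp add: prime_imp_coprime)
  have "prime_factors (p * d) = insert p (prime_factors d)"
    using p d by (simp add: prime_factors_product prime_gt_0_nat prime_prime_factors)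
  moreover have "p \<notin> prime_factors d" using p by auto
  moreover have "squarefree (p * d) \<longleftrightarrow> squarefree d"
    using cop p(1) by (auto simp: squarefree_mult_coprime squarefree_prime dest: squarefree_multD)
  ultimately show ?thesis by (simp add: moebius_def)
qed

text \<open>A prime p dividing n pairs each squarefree divisor d prime to p with p d, which has the
  opposite sign.\<close>

lemma sum_moebius_divisors:
  assumes n: "n > 0"
  shows "(\<Sum>d | d dvd n. moebius d) = (if n = 1 then 1 else 0)"
proof (cases "n = 1")
  case False
  then obtain p where p: "prime p" "p dvd n" using prime_factor_nat by blast
  define S where "S b = {d. d dvd n \<and> squarefree d \<and> (p dvd d) = b}" for b
  have fin: "finite (S b)" for b
    by (rule finite_subset[of _ "{d. d dvd n}"]) (use n in \<open>auto simp: S_def\<close>)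
  have "(\<Sum>d | d dvd n. moebius d) = (\<Sum>d\<in>S True \<union> S False. moebius d)"
    using n by (intro sum.mono_neutral_right) (auto simp: S_def moebius_def)
  also have "\<dots> = (\<Sum>d\<in>S True. moebius d) + (\<Sum>d\<in>S False. moebius d)"
    by (intro sum.union_disjoint fin) (auto simp: S_def)
  also have "(\<Sum>d\<in>S True. moebius d) = (\<Sum>d\<in>S False. - moebius d)"
  proof (rule sum.reindex_bij_witness[of _ "\<lambda>d. p * d" "\<lambda>d. d div p"])
    fix d assume d: "d \<in> S True"
    then obtain e where e: "d = p * e" by (auto simp: S_def dvd_def)
    have p0: "p > 0" using p prime_gt_0_nat by blast
    have npe: "\<not> p dvd e"
    proof
      assume "p dvd e"
      hence "p ^ 2 dvd d" unfolding e by (auto simp: power2_eq_square)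
      with d have "p dvd 1" by (auto simp: S_def squarefree_def)
      with p show False by auto
    qed
    have e0: "e > 0" using d n unfolding e S_def by (auto intro!: Nat.gr0I)
    show "p * (d div p) = d" using e p0 by simp
    show "d div p \<in> S False" using d npe p0 unfolding S_def
      by (auto simp: e dest: squarefree_multD dvd_mult_right)
    show "- moebius (d div p) = moebius d" using moebius_prime_mult[OF p(1) npe e0] e p0 by simp
  next
    fix d assume d: "d \<in> S False"
    have p0: "p > 0" using p prime_gt_0_nat by blast
    have cop: "coprime p d" using d p by (auto simp: S_def prime_imp_coprime)
    show "p * d div p = d" using p0 by simp
    show "p * d \<in> S True" using d p cop
      by (auto simp: S_def divides_mult squarefree_mult_coprime squarefree_prime)
  qed
  finally show ?thesis using False by (simp add: sum_negf)
qed auto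

text \<open>The pairs with b c | n are the factorizations of n into three factors. This lemma and
  the next two sort them by b, by c and by the product b c.\<close>

lemma sum_divisor_pairs1:
  fixes f :: "nat \<Rightarrow> nat \<Rightarrow> 'a :: comm_monoid_add"
  assumes n: "n > 0"
  shows "(\<Sum>(b, c) | b * c dvd n. f b c) = (\<Sum>b | b dvd n. \<Sum>c | c dvd n div b. f b c)"
proof -
  have "(\<Sum>b | b dvd n. \<Sum>c | c dvd n div b. f b c) = (\<Sum>(b, c)\<in>Sigma {b. b dvd n} (\<lambda>b. {c. c dvd n div b}). f b c)"
    using n by (intro sum.Sigma) (auto simp: dvd_div_eq_0_iff)
  also have "Sigma {b. b dvd n} (\<lambda>b. {c. c dvd n div b}) = {(b, c). b * c dvd n}"
    using n by (auto simp: dvd_div_iff_mult mult.commute dest: dvd_mult_left dvd_mult_right)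
  finally show ?thesis ..
qed

lemma sum_divisor_pairs2:
  fixes f :: "nat \<Rightarrow> nat \<Rightarrow> 'a :: comm_monoid_add"
  assumes n: "n > 0"
  shows "(\<Sum>(b, c) | b * c dvd n. f b c) = (\<Sum>c | c dvd n. \<Sum>b | b dvd n div c. f b c)"
proof -
  have "(\<Sum>(b, c) | b * c dvd n. f b c) = (\<Sum>(c, b) | c * b dvd n. f b c)"
    by (rule sum.reindex_bij_witness[of _ prod.swap prod.swap]) (auto simp: mult.commute)
  thus ?thesis using sum_divisor_pairs1[OF n, of "\<lambda>c b. f b c"] by simp
qed

lemma sum_divisor_pairs3:
  fixes f :: "nat \<Rightarrow> nat \<Rightarrow> 'a :: comm_monoid_add"
  assumes n: "n > 0"
  shows "(\<Sum>(b, c) | b * c dvd n. f b c) = (\<Sum>m | m dvd n. \<Sum>b | b dvd m. f b (m div b))"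
proof -
  have "(\<Sum>m | m dvd n. \<Sum>b | b dvd m. f b (m div b)) = (\<Sum>(m, b)\<in>Sigma {m. m dvd n} (\<lambda>m. {b. b dvd m}). f b (m div b))"
    using n by (intro sum.Sigma) (auto intro!: finite_divisors_nat dest: dvd_pos_nat)
  also have "\<dots> = (\<Sum>(b, c) | b * c dvd n. f b c)"
  proof (rule sum.reindex_bij_witness[of _ "\<lambda>(b, c). (b * c, b)" "\<lambda>(m, b). (b, m div b)"])
    fix x assume "x \<in> {(b, c). b * c dvd n}"
    then obtain b c where x: "x = (b, c)" "b * c dvd n" by auto
    hence "b > 0" using n by (auto intro!: Nat.gr0I)
    thus "(case case x of (b, c) \<Rightarrow> (b * c, b) of (m, b) \<Rightarrow> (b, m div b)) = x" by (simp add: x)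
  qed auto
  finally show ?thesis ..
qed

text \<open>Dirichlet convolution of the Moebius function and Lambda, both cut off above U; hence
  supported on m \<le> U^2.\<close>

definition vaughan_E :: "nat \<Rightarrow> nat \<Rightarrow> real" where
  "vaughan_E U m = (\<Sum>b | b dvd m. if b \<le> U \<and> m div b \<le> U then moebius b * mangoldt (m div b) else 0)"

text \<open>Convolution of the constant 1 with the Moebius function beyond U; hence zero for 0 < m
  \<le> U.\<close>

definition vaughan_B :: "nat \<Rightarrow> nat \<Rightarrow> real" where
  "vaughan_B U m = (\<Sum>b | b dvd m. if b > U then moebius b else 0)"

text \<open>In n = b c e the factor e is free: for fixed c the Moebius sum over b | n/c leaves only
  c = n.\<close>

lemma sum_moebius_mangoldt:
  assumes n: "n > 0"
  shows "(\<Sum>(b, c) | b * c dvd n. if P c then moebius b * mangoldt c else 0) = (if P n then mangoldt n else 0)"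
proof -
  have "(\<Sum>(b, c) | b * c dvd n. if P c then moebius b * mangoldt c else 0)
      = (\<Sum>c | c dvd n. \<Sum>b | b dvd n div c. if P c then moebius b * mangoldt c else 0)"
    by (rule sum_divisor_pairs2[OF n])
  also have "\<dots> = (\<Sum>c | c dvd n. if c = n then (if P n then mangoldt n else 0) else 0)"
  proof (rule sum.cong[OF refl])
    fix c assume c: "c \<in> {c. c dvd n}"
    hence c0: "n div c > 0" using n by (auto simp: dvd_div_eq_0_iff)
    have "(\<Sum>b | b dvd n div c. if P c then moebius b * mangoldt c else 0) =
       (if P c then mangoldt c else 0) * (\<Sum>b | b dvd n div c. moebius b)"
      by (simp add: sum_distrib_left mult.commute)
    also have "(\<Sum>b | b dvd n div c. moebius b) = (if n div c = 1 then 1 else 0)"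
      by (rule sum_moebius_divisors[OF c0])
    also have "n div c = 1 \<longleftrightarrow> c = n" using c n by (auto simp: dvd_def)
    finally show "(\<Sum>b | b dvd n div c. if P c then moebius b * mangoldt c else 0) =
      (if c = n then (if P n then mangoldt n else 0) else 0)" by simp
  qed
  also have "\<dots> = (if P n then mangoldt n else 0)" using n by (subst sum.delta) auto
  finally show ?thesis .
qed

text \<open>Split the sum of mu(b) Lambda(c) over b c | n according to whether b and c exceed U. The
  whole sum is Lambda(n), and the part c \<le> U vanishes because n > U; the latter trades the
  quadrant b > U, c \<le> U for minus the quadrant b, c \<le> U.\<close>

lemma vaughan_identity:
  assumes n: "n > U"
  shows "mangoldt n = (\<Sum>b | b dvd n. if b \<le> U then moebius b * ln (real (n div b)) else 0)
      - (\<Sum>m | m dvd n. vaughan_E U m)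
      + (\<Sum>m | m dvd n. vaughan_B U m * (if n div m > U then mangoldt (n div m) else 0))"
proof -
  have n0: "n > 0" using n by simp
  define X where "X P = (\<Sum>(b, c) | b * c dvd n. if P b c then moebius b * mangoldt c else (0::real))" for P :: "nat \<Rightarrow> nat \<Rightarrow> bool"
  have fin: "finite {(b, c). b * c dvd n}"
  proof (rule finite_subset)
    show "{(b, c). b * c dvd n} \<subseteq> {b. b dvd n} \<times> {c. c dvd n}" by (auto dest: dvd_mult_left dvd_mult_right)
  qed (use n0 in auto)
  have all: "X (\<lambda>b c. True) = mangoldt n"
    unfolding X_def using sum_moebius_mangoldt[OF n0, of "\<lambda>_. True"] by simp
  have le: "X (\<lambda>b c. c \<le> U) = 0"
    unfolding X_def using sum_moebius_mangoldt[OF n0, of "\<lambda>c. c \<le> U"] n by simp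
  have split1: "X (\<lambda>b c. True) = X (\<lambda>b c. b \<le> U) + X (\<lambda>b c. b > U \<and> c > U) + X (\<lambda>b c. b > U \<and> c \<le> U)"
    unfolding X_def sum.distrib[symmetric] by (intro sum.cong) auto
  have split2: "X (\<lambda>b c. c \<le> U) = X (\<lambda>b c. b > U \<and> c \<le> U) + X (\<lambda>b c. b \<le> U \<and> c \<le> U)"
    unfolding X_def sum.distrib[symmetric] by (intro sum.cong) auto
  have t1: "X (\<lambda>b c. b \<le> U) = (\<Sum>b | b dvd n. if b \<le> U then moebius b * ln (real (n div b)) else 0)"
    unfolding X_def sum_divisor_pairs1[OF n0]
  proof (rule sum.cong[OF refl])
    fix b assume "b \<in> {b. b dvd n}"
    hence "n div b \<noteq> 0" using n0 by (auto simp: dvd_div_eq_0_iff)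
    from mangoldt_sum[OF this, where ?'a = real]
    show "(\<Sum>c | c dvd n div b. if b \<le> U then moebius b * mangoldt c else 0) = (if b \<le> U then moebius b * ln (real (n div b)) else 0)"
      by (simp flip: sum_distrib_left)
  qed
  have t2: "X (\<lambda>b c. b \<le> U \<and> c \<le> U) = (\<Sum>m | m dvd n. vaughan_E U m)"
    unfolding X_def sum_divisor_pairs3[OF n0] vaughan_E_def ..
  have "X (\<lambda>b c. b > U \<and> c > U) = (\<Sum>c | c dvd n. \<Sum>b | b dvd n div c. if b > U \<and> c > U then moebius b * mangoldt c else 0)"
    unfolding X_def by (rule sum_divisor_pairs2[OF n0])
  also have "\<dots> = (\<Sum>c | c dvd n. vaughan_B U (n div c) * (if c > U then mangoldt c else 0))"
    by (intro sum.cong refl) (auto simp: vaughan_B_def sum_distrib_right intro!: sum.cong)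
  also have "\<dots> = (\<Sum>m | m dvd n. vaughan_B U m * (if n div m > U then mangoldt (n div m) else 0))"
    by (rule sum.reindex_bij_witness[of _ "\<lambda>d. n div d" "\<lambda>d. n div d"]) (use n0 in \<open>auto simp: div_div_eq_right\<close>)
  finally have t3: "X (\<lambda>b c. b > U \<and> c > U) = \<dots>" .
  show ?thesis using all le split1 split2 t1 t2 t3 by linarith
qed

definition prod_range :: "nat \<Rightarrow> nat \<Rightarrow> (nat \<times> nat) set" where
  "prod_range D D' = {(m, k). D < m * k \<and> m * k \<le> D'}"

lemma prod_range_subset: "prod_range D D' \<subseteq> {1..D'} \<times> {1..D'}"
proof -
  have "m \<le> D' \<and> k \<le> D' \<and> 1 \<le> m \<and> 1 \<le> k" if "D < m * k" "m * k \<le> D'" for m k :: nat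
  proof -
    have "m > 0" "k > 0" using that by (auto intro!: Nat.gr0I)
    moreover from this have "m \<le> m * k" "k \<le> m * k" by auto
    ultimately show ?thesis using that by linarith
  qed
  thus ?thesis by (auto simp: prod_range_def)
qed

lemma finite_prod_range [simp, intro]: "finite (prod_range D D')"
  by (rule finite_subset[OF prod_range_subset]) auto

lemma sum_prod_range:
  fixes g :: "nat \<Rightarrow> nat \<Rightarrow> 'a :: comm_monoid_add"
  shows "(\<Sum>d\<in>{D<..D'}. \<Sum>m | m dvd d. g m (d div m)) = (\<Sum>(m, k)\<in>prod_range D D'. g m k)"
proof -
  have "(\<Sum>d\<in>{D<..D'}. \<Sum>m | m dvd d. g m (d div m)) = (\<Sum>(d, m)\<in>Sigma {D<..D'} (\<lambda>d. {m. m dvd d}). g m (d div m))"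
    by (intro sum.Sigma) auto
  also have "\<dots> = (\<Sum>(m, k)\<in>prod_range D D'. g m k)"
  proof (rule sum.reindex_bij_witness[of _ "\<lambda>(m, k). (m * k, m)" "\<lambda>(d, m). (m, d div m)"])
    fix x assume "x \<in> prod_range D D'"
    moreover then obtain m k where x: "x = (m, k)" by (cases x)
    ultimately have "m > 0" by (auto simp: prod_range_def intro!: Nat.gr0I)
    thus "(case case x of (m, k) \<Rightarrow> (m * k, m) of (d, m) \<Rightarrow> (m, d div m)) = x" by (simp add: x)
  qed (auto simp: prod_range_def)
  finally show ?thesis .
qed

lemma vaughan_sum:
  fixes F :: "nat \<Rightarrow> complex"
  assumes "U \<le> D"
  shows "(\<Sum>d\<in>{D<..D'}. of_real (mangoldt d) * F d) =
     (\<Sum>(m, k)\<in>prod_range D D'. of_real ((if m \<le> U then moebius m else 0) * ln (real k)) * F (m * k))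
   - (\<Sum>(m, k)\<in>prod_range D D'. of_real (vaughan_E U m) * F (m * k))
   + (\<Sum>(m, k)\<in>prod_range D D'. of_real (vaughan_B U m * (if k > U then mangoldt k else 0)) * F (m * k))"
proof -
  have eq: "(\<Sum>(m, k)\<in>prod_range D D'. of_real (h m k) * F (m * k)) =
    (\<Sum>d\<in>{D<..D'}. of_real (\<Sum>m | m dvd d. h m (d div m)) * F d)" for h :: "nat \<Rightarrow> nat \<Rightarrow> real"
    unfolding sum_prod_range[symmetric] by (intro sum.cong refl) (auto simp: sum_distrib_right)
  show ?thesis
    unfolding eq sum_subtractf[symmetric] sum.distrib[symmetric]
  proof (intro sum.cong refl)
    fix d assume "d \<in> {D<..D'}"
    hence d: "U < d" using assms by auto
    have "(\<Sum>b | b dvd d. (if b \<le> U then moebius b else 0) * ln (real (d div b))) =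
      (\<Sum>b | b dvd d. if b \<le> U then moebius b * ln (real (d div b)) else 0)" by (intro sum.cong) auto
    thus "of_real (mangoldt d) * F d = of_real (\<Sum>m | m dvd d. (if m \<le> U then moebius m else 0) * ln (real (d div m))) * F d
       - of_real (\<Sum>m | m dvd d. vaughan_E U m) * F d
       + of_real (\<Sum>m | m dvd d. vaughan_B U m * (if d div m > U then mangoldt (d div m) else 0)) * F d"
      unfolding vaughan_identity[OF d] by (simp add: algebra_simps)
  qed
qed

text \<open>Dropping both cut-offs and the signs leaves the sum of Lambda over the divisors of
  m.\<close>

lemma abs_vaughan_E_le: "m > 0 \<Longrightarrow> \<bar>vaughan_E U m\<bar> \<le> ln (real m)"
proof -
  assume m: "m > 0"
  have "\<bar>vaughan_E U m\<bar> \<le> (\<Sum>b | b dvd m. mangoldt (m div b))"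
    unfolding vaughan_E_def
  proof (rule order_trans[OF sum_abs], rule sum_mono)
    fix b
    show "\<bar>if b \<le> U \<and> m div b \<le> U then moebius b * mangoldt (m div b) else 0\<bar> \<le> mangoldt (m div b)"
      using abs_moebius_le[of b] mangoldt_nonneg[of "m div b"]
      by (auto simp: abs_mult intro!: mult_left_le_one_le)
  qed
  also have "\<dots> = (\<Sum>b | b dvd m. mangoldt b)"
    by (rule sum.reindex_bij_witness[of _ "\<lambda>d. m div d" "\<lambda>d. m div d"]) (use m in \<open>auto simp: div_div_eq_right\<close>)
  also have "\<dots> = ln (real m)" using mangoldt_sum[of m, where ?'a = real] m by simp
  finally show ?thesis .
qed

lemma vaughan_E_eq_0: "m > U * U \<Longrightarrow> vaughan_E U m = 0"
  unfolding vaughan_E_def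
proof (rule sum.neutral, safe)
  fix b assume m: "m > U * U" "b dvd m"
  have "\<not> (b \<le> U \<and> m div b \<le> U)"
  proof
    assume "b \<le> U \<and> m div b \<le> U"
    hence "b * (m div b) \<le> U * U" by (intro mult_mono) auto
    with m show False by simp
  qed
  thus "(if b \<le> U \<and> m div b \<le> U then moebius b * mangoldt (m div b) else 0) = 0" by auto
qed

lemma abs_vaughan_B_le: "\<bar>vaughan_B U m\<bar> \<le> real (card {b. b dvd m})"
proof -
  have "\<bar>vaughan_B U m\<bar> \<le> (\<Sum>b | b dvd m. 1)"
    unfolding vaughan_B_def by (rule order_trans[OF sum_abs], rule sum_mono) (use abs_moebius_le in auto)
  thus ?thesis by simp
qed

lemma vaughan_B_eq_0: "0 < m \<Longrightarrow> m \<le> U \<Longrightarrow> vaughan_B U m = 0"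
  unfolding vaughan_B_def by (rule sum.neutral) (auto dest: dvd_imp_le)

section \<open>The double large sieve\<close>

text \<open>Bound for a geometric sum of K terms at frequency t. The value at t = 0 is set apart
  because division by zero yields 0, which would spoil the minimum.\<close>

definition kern :: "real \<Rightarrow> real \<Rightarrow> real" where
  "kern K t = (if t = 0 then K else min K (1 / (2 * \<bar>t\<bar>)))"

lemma kern_mono: "K \<le> K' \<Longrightarrow> kern K t \<le> kern K' t"
  by (auto simp: kern_def)

lemma norm_sum_ee_le_kern:
  assumes "\<bar>t\<bar> \<le> 1 / 2"
  shows "norm (\<Sum>k<K. ee (real k * t)) \<le> kern (real K) t"
proof -
  have "norm (\<Sum>k<K. ee (real k * t)) \<le> real K" by (rule order_trans[OF norm_sum]) simp
  with norm_sum_ee_geometric_le[OF assms] show ?thesis by (auto simp: kern_def)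
qed

text \<open>Expanding the square and summing over k first leaves geometric sums at the differences
  of the frequencies.\<close>

lemma large_sieve_grid:
  fixes \<gamma> :: "'j \<Rightarrow> complex" and w :: "'j \<Rightarrow> real"
  assumes w: "\<And>i j. i \<in> J \<Longrightarrow> j \<in> J \<Longrightarrow> \<bar>w i - w j\<bar> \<le> 1 / 2"
    and \<gamma>: "\<And>j. j \<in> J \<Longrightarrow> norm (\<gamma> j) \<le> 1"
  shows "(\<Sum>k<K. (norm (\<Sum>j\<in>J. \<gamma> j * ee (real k * w j)))\<^sup>2) \<le> (\<Sum>i\<in>J. \<Sum>j\<in>J. kern (real K) (w i - w j))"
proof -
  have "complex_of_real (\<Sum>k<K. (norm (\<Sum>j\<in>J. \<gamma> j * ee (real k * w j)))\<^sup>2) =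
     (\<Sum>k<K. \<Sum>i\<in>J. \<Sum>j\<in>J. \<gamma> i * cnj (\<gamma> j) * ee (real k * (w i - w j)))"
    unfolding of_real_sum
    by (intro sum.cong refl, simp only: complex_norm_square cnj_sum sum_product complex_cnj_mult cnj_ee,
        intro sum.cong refl, simp add: algebra_simps ee_diff)
  also have "\<dots> = (\<Sum>i\<in>J. \<Sum>k<K. \<Sum>j\<in>J. \<gamma> i * cnj (\<gamma> j) * ee (real k * (w i - w j)))"
    by (rule sum.swap)
  also have "\<dots> = (\<Sum>i\<in>J. \<Sum>j\<in>J. \<gamma> i * cnj (\<gamma> j) * (\<Sum>k<K. ee (real k * (w i - w j))))"
    unfolding sum_distrib_left by (intro sum.cong refl sum.swap)
  finally have eq: "complex_of_real (\<Sum>k<K. (norm (\<Sum>j\<in>J. \<gamma> j * ee (real k * w j)))\<^sup>2) = \<dots>" .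
  have "(\<Sum>k<K. (norm (\<Sum>j\<in>J. \<gamma> j * ee (real k * w j)))\<^sup>2) = norm (complex_of_real (\<Sum>k<K. (norm (\<Sum>j\<in>J. \<gamma> j * ee (real k * w j)))\<^sup>2))"
    unfolding norm_of_real by (simp add: sum_nonneg)
  also have "\<dots> \<le> (\<Sum>i\<in>J. \<Sum>j\<in>J. norm (\<gamma> i * cnj (\<gamma> j) * (\<Sum>k<K. ee (real k * (w i - w j)))))"
    unfolding eq by (intro order_trans[OF norm_sum] sum_mono order_refl)
  also have "\<dots> \<le> (\<Sum>i\<in>J. \<Sum>j\<in>J. kern (real K) (w i - w j))"
  proof (intro sum_mono)
    fix i j assume ij: "i \<in> J" "j \<in> J"
    have "norm (\<gamma> i * cnj (\<gamma> j)) \<le> 1 * 1"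
      unfolding norm_mult using \<gamma> ij by (intro mult_mono) auto
    hence "norm (\<gamma> i * cnj (\<gamma> j)) * norm (\<Sum>k<K. ee (real k * (w i - w j))) \<le> 1 * kern (real K) (w i - w j)"
      by (intro mult_mono norm_sum_ee_le_kern w ij) auto
    thus "norm (\<gamma> i * cnj (\<gamma> j) * (\<Sum>k<K. ee (real k * (w i - w j)))) \<le> kern (real K) (w i - w j)"
      by (simp add: norm_mult)
  qed
  finally show ?thesis .
qed

text \<open>The frequencies \<open>u i\<close> are rounded down to a grid of step \<open>1 / (2 * pi * V)\<close>; the remaining
  factor is expanded in a Taylor series, which separates the variables.\<close>

lemma double_large_sieve:
  fixes \<beta> :: "'j \<Rightarrow> complex" and u :: "'i \<Rightarrow> real" and v :: "'j \<Rightarrow> real"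
  assumes fin: "finite I" "finite J" and V: "V > 0" and Y: "Y \<ge> 0"
    and u: "\<And>i. i \<in> I \<Longrightarrow> 0 \<le> u i \<and> u i \<le> Y"
    and v: "\<And>j. j \<in> J \<Longrightarrow> \<bar>v j\<bar> \<le> V"
    and \<beta>: "\<And>j. j \<in> J \<Longrightarrow> norm (\<beta> j) \<le> 1"
  shows "(norm (\<Sum>i\<in>I. \<Sum>j\<in>J. \<beta> j * ee (u i * v j)))\<^sup>2 \<le> (exp 1)\<^sup>2 *
     (real (card {(i, i')\<in>I \<times> I. \<bar>u i - u i'\<bar> \<le> 1 / (2 * pi * V)}) *
      (\<Sum>i\<in>J. \<Sum>j\<in>J. kern (2 * pi * V * Y + 1) ((v i - v j) / (2 * pi * V))))"
proof -
  \<comment> \<open>With this grid step the phase that remains after rounding is r v / V with |r|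
    \<le> 1, hence at most 1 in absolute value, and so are all its powers in the Taylor
    series.\<close>
  define \<tau> where "\<tau> = 1 / (2 * pi * V)"
  have \<tau>: "\<tau> > 0" using V by (simp add: \<tau>_def)
  define k where "k i = nat \<lfloor>u i / \<tau>\<rfloor>" for i
  define r where "r i = u i / \<tau> - real (k i)" for i
  define \<eta> where "\<eta> j = v j / V" for j
  define K where "K = nat \<lfloor>Y / \<tau>\<rfloor> + 1"
  define n where "n q = card {i\<in>I. k i = q}" for q
  have k: "real (k i) = of_int \<lfloor>u i / \<tau>\<rfloor>" if "i \<in> I" for i
    using u[OF that] \<tau> by (simp add: k_def)
  have r: "0 \<le> r i" "r i \<le> 1" if "i \<in> I" for i unfolding r_def k[OF that] by linarith+
  have kK: "k i < K" if "i \<in> I" for i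
  proof -
    have "u i / \<tau> \<le> Y / \<tau>" using u[OF that] \<tau> by (intro divide_right_mono) auto
    thus ?thesis unfolding k_def K_def by (simp add: floor_mono nat_mono le_imp_less_Suc)
  qed
  have KY: "real K \<le> 2 * pi * V * Y + 1"
  proof -
    have "real K = of_int \<lfloor>Y / \<tau>\<rfloor> + 1" using Y \<tau> by (simp add: K_def)
    also have "\<dots> \<le> Y / \<tau> + 1" by linarith
    also have "Y / \<tau> = 2 * pi * V * Y" by (simp add: \<tau>_def)
    finally show ?thesis .
  qed
  have uk: "u i = \<tau> * (real (k i) + r i)" for i using \<tau> by (simp add: r_def)
  define B where "B = real (card {(i, i')\<in>I \<times> I. \<bar>u i - u i'\<bar> \<le> \<tau>}) *
      (\<Sum>i\<in>J. \<Sum>j\<in>J. kern (2 * pi * V * Y + 1) (\<tau> * v i - \<tau> * v j))"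
  \<comment> \<open>Frequencies rounded to the same grid point differ by at most
    \<open>\<tau>\<close>, so the squared multiplicities add up to at most the number of close
    pairs.\<close>
  have n2: "(\<Sum>q<K. (real (n q))\<^sup>2) \<le> real (card {(i, i')\<in>I \<times> I. \<bar>u i - u i'\<bar> \<le> \<tau>})"
  proof -
    have "(\<Sum>q<K. (real (n q))\<^sup>2) = real (\<Sum>q<K. card ({i\<in>I. k i = q} \<times> {i\<in>I. k i = q}))"
      by (simp add: n_def card_cartesian_product power2_eq_square)
    also have "(\<Sum>q<K. card ({i\<in>I. k i = q} \<times> {i\<in>I. k i = q})) = card (\<Union>q<K. {i\<in>I. k i = q} \<times> {i\<in>I. k i = q})"
      using fin by (intro card_UN_disjoint[symmetric]) auto
    also have "\<dots> \<le> card {(i, i')\<in>I \<times> I. \<bar>u i - u i'\<bar> \<le> \<tau>}"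
    proof (rule card_mono)
      show "finite {(i, i')\<in>I \<times> I. \<bar>u i - u i'\<bar> \<le> \<tau>}"
        by (rule finite_subset[of _ "I \<times> I"]) (use fin in auto)
      have "\<bar>u i - u i'\<bar> \<le> \<tau>" if "i \<in> I" "i' \<in> I" "k i = k i'" for i i'
      proof -
        have "u i - u i' = \<tau> * (r i - r i')" using that(3) unfolding uk[of i] uk[of i'] by (simp add: algebra_simps)
        moreover have "\<bar>r i - r i'\<bar> \<le> 1" using r[OF that(1)] r[OF that(2)] by linarith
        ultimately show ?thesis using \<tau> by (simp add: abs_mult mult_left_le)
      qed
      thus "(\<Union>q<K. {i\<in>I. k i = q} \<times> {i\<in>I. k i = q}) \<subseteq> {(i, i')\<in>I \<times> I. \<bar>u i - u i'\<bar> \<le> \<tau>}" by auto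
    qed
    finally show ?thesis by simp
  qed
  \<comment> \<open>\<open>T l\<close> is l! times the l-th Taylor term. The powers of
    \<open>r i\<close> and \<open>\<eta> j\<close> in it are separate bounded weights, so its bound
    does not depend on l, and summing 1/l! produces \<open>exp 1\<close>.\<close>
  define T where "T l = (\<Sum>i\<in>I. \<Sum>j\<in>J. \<beta> j * ee (real (k i) * (\<tau> * v j)) * (\<i> * of_real (r i * \<eta> j)) ^ l)" for l :: nat
  have T_le: "norm (T l) \<le> sqrt B" for l
  proof -
    define \<gamma> where "\<gamma> j = \<beta> j * (\<i> * of_real (\<eta> j)) ^ l" for j
    define S where "S q = (\<Sum>j\<in>J. \<gamma> j * ee (real q * (\<tau> * v j)))" for q
    have "T l = (\<Sum>i\<in>I. of_real (r i ^ l) * S (k i))"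
      unfolding T_def S_def \<gamma>_def sum_distrib_left
      by (intro sum.cong refl) (simp add: power_mult_distrib mult_ac)
    also have "norm \<dots> \<le> (\<Sum>i\<in>I. norm (S (k i)))"
    proof (rule order_trans[OF norm_sum], rule sum_mono)
      fix i assume i: "i \<in> I"
      have "\<bar>r i\<bar> ^ l \<le> 1" using r[OF i] by (intro power_le_one) auto
      thus "norm (of_real (r i ^ l) * S (k i)) \<le> norm (S (k i))"
        by (simp add: norm_mult norm_power power_abs mult_left_le_one_le)
    qed
    also have "\<dots> = (\<Sum>q<K. \<Sum>i | i \<in> I \<and> k i = q. norm (S (k i)))"
      using fin kK by (intro sum.group[symmetric]) auto
    also have "\<dots> = (\<Sum>q<K. real (n q) * norm (S q))" by (intro sum.cong refl) (simp add: n_def)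
    finally have "norm (T l) \<le> (\<Sum>q<K. real (n q) * norm (S q))" .
    hence "(norm (T l))\<^sup>2 \<le> (\<Sum>q<K. real (n q) * norm (S q))\<^sup>2" by (intro power_mono) auto
    also have "\<dots> \<le> (\<Sum>q<K. (real (n q))\<^sup>2) * (\<Sum>q<K. (norm (S q))\<^sup>2)" by (rule Cauchy_Schwarz_ineq_sum)
    also have "\<dots> \<le> B" unfolding B_def
    proof (intro mult_mono n2)
      have "(\<Sum>q<K. (norm (S q))\<^sup>2) \<le> (\<Sum>i\<in>J. \<Sum>j\<in>J. kern (real K) (\<tau> * v i - \<tau> * v j))"
        unfolding S_def
      proof (rule large_sieve_grid)
        fix i j assume ij: "i \<in> J" "j \<in> J"
        have "\<bar>\<tau> * v i - \<tau> * v j\<bar> = \<tau> * \<bar>v i - v j\<bar>" using \<tau> by (simp add: abs_mult flip: right_diff_distrib)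
        also have "\<dots> \<le> \<tau> * (2 * V)" using v[OF ij(1)] v[OF ij(2)] \<tau> by (intro mult_left_mono) linarith+
        also have "\<dots> = 1 / pi" using V by (simp add: \<tau>_def)
        also have "\<dots> \<le> 1 / 2" using pi_gt3 by (intro divide_left_mono) auto
        finally show "\<bar>\<tau> * v i - \<tau> * v j\<bar> \<le> 1 / 2" .
      next
        fix j assume j: "j \<in> J"
        have "\<bar>\<eta> j\<bar> ^ l \<le> 1" using v[OF j] V by (intro power_le_one) (auto simp: \<eta>_def)
        hence "norm (\<beta> j) * \<bar>\<eta> j\<bar> ^ l \<le> 1 * 1" using \<beta>[OF j] by (intro mult_mono) auto
        thus "norm (\<gamma> j) \<le> 1" by (simp add: \<gamma>_def norm_mult norm_power)
      qed
      also have "\<dots> \<le> (\<Sum>i\<in>J. \<Sum>j\<in>J. kern (2 * pi * V * Y + 1) (\<tau> * v i - \<tau> * v j))"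
        by (intro sum_mono kern_mono KY)
      finally show "(\<Sum>q<K. (norm (S q))\<^sup>2) \<le> \<dots>" .
    qed (auto intro: sum_nonneg)
    finally show ?thesis by (rule real_le_rsqrt)
  qed
  have "(\<lambda>l. \<Sum>i\<in>I. \<Sum>j\<in>J. \<beta> j * ee (real (k i) * (\<tau> * v j)) * ((\<i> * of_real (r i * \<eta> j)) ^ l /\<^sub>R fact l)) sums
     (\<Sum>i\<in>I. \<Sum>j\<in>J. \<beta> j * ee (real (k i) * (\<tau> * v j)) * exp (\<i> * of_real (r i * \<eta> j)))"
    by (intro sums_sum sums_mult exp_converges)
  also have "(\<lambda>l. \<Sum>i\<in>I. \<Sum>j\<in>J. \<beta> j * ee (real (k i) * (\<tau> * v j)) * ((\<i> * of_real (r i * \<eta> j)) ^ l /\<^sub>R fact l)) =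
     (\<lambda>l. T l /\<^sub>R fact l)"
    by (simp add: T_def scaleR_sum_right)
  also have "(\<Sum>i\<in>I. \<Sum>j\<in>J. \<beta> j * ee (real (k i) * (\<tau> * v j)) * exp (\<i> * of_real (r i * \<eta> j))) =
     (\<Sum>i\<in>I. \<Sum>j\<in>J. \<beta> j * ee (u i * v j))"
  proof (intro sum.cong refl)
    fix i j
    have "exp (\<i> * of_real (r i * \<eta> j)) = ee (\<tau> * r i * v j)"
      using V by (simp add: ee_def cis_conv_exp \<eta>_def \<tau>_def field_simps)
    moreover have "u i * v j = real (k i) * (\<tau> * v j) + \<tau> * r i * v j" unfolding uk[of i] by (simp add: algebra_simps)
    ultimately show "\<beta> j * ee (real (k i) * (\<tau> * v j)) * exp (\<i> * of_real (r i * \<eta> j)) = \<beta> j * ee (u i * v j)"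
      by (simp add: ee_add)
  qed
  finally have sums: "(\<lambda>l. T l /\<^sub>R fact l) sums (\<Sum>i\<in>I. \<Sum>j\<in>J. \<beta> j * ee (u i * v j))" .
  have e: "(\<lambda>l. sqrt B * (1 ^ l /\<^sub>R fact l)) sums (sqrt B * exp 1)" by (intro sums_mult exp_converges)
  have "norm (\<Sum>i\<in>I. \<Sum>j\<in>J. \<beta> j * ee (u i * v j)) \<le> sqrt B * exp 1"
    unfolding sums_unique[OF sums] sums_unique[OF e]
  proof (rule norm_suminf_le)
    fix l show "norm (T l /\<^sub>R fact l) \<le> sqrt B * (1 ^ l /\<^sub>R fact l)"
      using T_le[of l] by (simp add: field_simps)
  qed (rule sums_summable[OF e])
  hence "(norm (\<Sum>i\<in>I. \<Sum>j\<in>J. \<beta> j * ee (u i * v j)))\<^sup>2 \<le> (sqrt B * exp 1)\<^sup>2" by (intro power_mono) auto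
  also have "\<dots> = (exp 1)\<^sup>2 * B"
  proof -
    have "B \<ge> 0"
    proof -
      have "0 \<le> sqrt B" using T_le[of 0] norm_ge_zero order_trans by blast
      thus ?thesis by simp
    qed
    thus ?thesis by (simp add: power_mult_distrib)
  qed
  finally show ?thesis unfolding B_def by (simp add: \<tau>_def diff_divide_distrib)
qed

text \<open>Dyadic decomposition by the size of \<open>\<delta>\<close>: at scale 2^l/(2K) the
  kernel is at most 2K/2^l. The part \<open>W1 * \<omega>\<close> of the count therefore gives
  \<open>W1\<close> at every scale, and the part \<open>W0\<close> a geometric series.\<close>

lemma sum_kern_le:
  fixes \<delta> :: "'a \<Rightarrow> real"
  assumes fin: "finite P" and K: "K \<ge> 1" "K \<le> 2 ^ L" and W: "W0 \<ge> 0" "W1 \<ge> 0"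
    and d: "\<And>p. p \<in> P \<Longrightarrow> \<bar>\<delta> p\<bar> \<le> 1 / 2"
    and Z: "\<And>\<omega>. \<omega> \<ge> 0 \<Longrightarrow> real (card {p\<in>P. \<bar>\<delta> p\<bar> \<le> \<omega>}) \<le> W0 + W1 * \<omega>"
  shows "(\<Sum>p\<in>P. kern K (\<delta> p)) \<le> 4 * K * W0 + (real L + 1) * W1"
proof -
  define \<omega> where "\<omega> l = 2 ^ l / (2 * K)" for l :: nat
  have pt: "kern K (\<delta> p) \<le> (\<Sum>l\<le>L. if \<bar>\<delta> p\<bar> \<le> \<omega> l then 2 * K / 2 ^ l else 0)" if p: "p \<in> P" for p
  proof -
    define l where "l = (LEAST l. \<bar>\<delta> p\<bar> \<le> \<omega> l)"
    have "\<bar>\<delta> p\<bar> \<le> \<omega> L"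
    proof -
      have "1 / 2 \<le> \<omega> L" using K by (simp add: \<omega>_def field_simps)
      with d[OF p] show ?thesis by linarith
    qed
    hence l: "\<bar>\<delta> p\<bar> \<le> \<omega> l" "l \<le> L" unfolding l_def by (auto intro: LeastI Least_le)
    have "kern K (\<delta> p) \<le> 2 * K / 2 ^ l"
    proof (cases l)
      case 0
      have "kern K (\<delta> p) \<le> K" by (simp add: kern_def)
      thus ?thesis using 0 K by simp
    next
      case (Suc l')
      hence "\<not> \<bar>\<delta> p\<bar> \<le> \<omega> l'" using not_less_Least[of l' "\<lambda>l. \<bar>\<delta> p\<bar> \<le> \<omega> l"] by (simp add: l_def)
      hence gt: "\<bar>\<delta> p\<bar> > \<omega> l'" by simp
      have pos: "\<omega> l' > 0" using K by (simp add: \<omega>_def)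
      have "kern K (\<delta> p) \<le> 1 / (2 * \<bar>\<delta> p\<bar>)" using gt pos by (auto simp: kern_def)
      also have "\<dots> \<le> 1 / (2 * \<omega> l')" using gt pos by (intro divide_left_mono) auto
      also have "\<dots> = 2 * K / 2 ^ l" using K by (simp add: \<omega>_def Suc)
      finally show ?thesis .
    qed
    also have "\<dots> = (\<Sum>l'\<in>{l}. if \<bar>\<delta> p\<bar> \<le> \<omega> l' then 2 * K / 2 ^ l' else 0)" using l by simp
    also have "\<dots> \<le> (\<Sum>l\<le>L. if \<bar>\<delta> p\<bar> \<le> \<omega> l then 2 * K / 2 ^ l else 0)"
      using l K by (intro sum_mono2) auto
    finally show ?thesis .
  qed
  have "(\<Sum>p\<in>P. kern K (\<delta> p)) \<le> (\<Sum>p\<in>P. \<Sum>l\<le>L. if \<bar>\<delta> p\<bar> \<le> \<omega> l then 2 * K / 2 ^ l else 0)"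
    by (intro sum_mono pt)
  also have "\<dots> = (\<Sum>l\<le>L. \<Sum>p\<in>P. if \<bar>\<delta> p\<bar> \<le> \<omega> l then 2 * K / 2 ^ l else 0)" by (rule sum.swap)
  also have "\<dots> = (\<Sum>l\<le>L. real (card {p\<in>P. \<bar>\<delta> p\<bar> \<le> \<omega> l}) * (2 * K / 2 ^ l))"
    using fin by (intro sum.cong refl) (simp add: Int_def flip: sum.inter_filter)
  also have "\<dots> \<le> (\<Sum>l\<le>L. (W0 + W1 * \<omega> l) * (2 * K / 2 ^ l))"
    using K by (intro sum_mono mult_right_mono Z) (auto simp: \<omega>_def)
  also have "\<dots> = (\<Sum>l\<le>L. 2 * K * W0 * (1 / 2) ^ l + W1)"
    using K by (intro sum.cong refl) (simp add: \<omega>_def field_simps)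
  also have "\<dots> = 2 * K * W0 * (\<Sum>l\<le>L. (1 / 2) ^ l) + (real L + 1) * W1"
    by (simp add: sum.distrib sum_distrib_left)
  also have "(\<Sum>l\<le>L. (1 / 2 :: real) ^ l) = 2 - (1 / 2) ^ L"
    by (induction L) auto
  hence "(\<Sum>l\<le>L. (1 / 2 :: real) ^ l) \<le> 2" by simp
  hence "2 * K * W0 * (\<Sum>l\<le>L. (1 / 2) ^ l) \<le> 2 * K * W0 * 2" using K W by (intro mult_left_mono) auto
  finally show ?thesis by simp
qed

section \<open>Spacing problems\<close>

text \<open>The window of length 2k is cut into half-open cells of length g, each holding at most
  one value.\<close>

lemma card_gap_le:
  fixes f :: "'a \<Rightarrow> real"
  assumes fin: "finite S" and g: "g > 0" and k: "k \<ge> 0"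
    and gap: "\<And>s t. s \<in> S \<Longrightarrow> t \<in> S \<Longrightarrow> s \<noteq> t \<Longrightarrow> \<bar>f s - f t\<bar> \<ge> g"
  shows "real (card {s\<in>S. \<bar>f s - c\<bar> \<le> k}) \<le> 1 + 2 * k / g"
proof -
  define h where "h s = \<lfloor>(f s - c + k) / g\<rfloor>" for s
  have "card {s\<in>S. \<bar>f s - c\<bar> \<le> k} \<le> card {0..\<lfloor>2 * k / g\<rfloor>}"
  proof (rule card_inj_on_le)
    show "inj_on h {s\<in>S. \<bar>f s - c\<bar> \<le> k}"
    proof (rule inj_onI)
      fix s t assume st: "s \<in> {s\<in>S. \<bar>f s - c\<bar> \<le> k}" "t \<in> {s\<in>S. \<bar>f s - c\<bar> \<le> k}" "h s = h t"
      have "\<bar>(f s - c + k) / g - (f t - c + k) / g\<bar> < 1" using st(3) unfolding h_def by linarith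
      also have "(f s - c + k) / g - (f t - c + k) / g = (f s - f t) / g" by (simp add: diff_divide_distrib add_divide_distrib)
      finally have "\<bar>f s - f t\<bar> < g" using g by (simp add: abs_divide)
      thus "s = t" using gap[of s t] st by force
    qed
    show "h ` {s\<in>S. \<bar>f s - c\<bar> \<le> k} \<subseteq> {0..\<lfloor>2 * k / g\<rfloor>}"
    proof safe
      fix s assume "s \<in> S" "\<bar>f s - c\<bar> \<le> k"
      hence "0 \<le> (f s - c + k) / g" "(f s - c + k) / g \<le> 2 * k / g"
        using g by (auto intro!: divide_nonneg_pos divide_right_mono)
      thus "h s \<in> {0..\<lfloor>2 * k / g\<rfloor>}" unfolding h_def by (auto intro: floor_mono)
    qed
  qed auto
  also have "card {0..\<lfloor>2 * k / g\<rfloor>} = nat (\<lfloor>2 * k / g\<rfloor> + 1)" by simp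
  finally have "real (card {s\<in>S. \<bar>f s - c\<bar> \<le> k}) \<le> real (nat (\<lfloor>2 * k / g\<rfloor> + 1))" by simp
  also have "2 * k / g \<ge> 0" using k g by simp
  hence "real (nat (\<lfloor>2 * k / g\<rfloor> + 1)) \<le> 1 + 2 * k / g" by linarith
  finally show ?thesis .
qed

lemma card_multiples_le:
  assumes "g > 0"
  shows "real (card {a\<in>{A..<A + B}. g dvd a}) \<le> real B / real g + 1"
proof -
  have "real (card {a\<in>{a\<in>{A..<A + B}. g dvd a}. \<bar>real a - (real A + real B / 2)\<bar> \<le> real B / 2}) \<le> 1 + 2 * (real B / 2) / real g"
  proof (rule card_gap_le)
    fix s t assume st: "s \<in> {a\<in>{A..<A + B}. g dvd a}" "t \<in> {a\<in>{A..<A + B}. g dvd a}" "s \<noteq> t"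
    hence "int g dvd int s - int t" by auto
    hence "int g \<le> \<bar>int s - int t\<bar>" using st(3) by (intro zdvd_imp_le) auto
    thus "real g \<le> \<bar>real s - real t\<bar>" by linarith
  qed (use assms in auto)
  moreover have "{a\<in>{a\<in>{A..<A + B}. g dvd a}. \<bar>real a - (real A + real B / 2)\<bar> \<le> real B / 2} = {a\<in>{A..<A + B}. g dvd a}"
  proof -
    have "\<bar>real a - (real A + real B / 2)\<bar> \<le> real B / 2" if "A \<le> a" "a < A + B" for a
    proof -
      have "real A \<le> real a" "real a \<le> real A + real B" using that by linarith+
      thus ?thesis unfolding abs_le_iff by linarith
    qed
    thus ?thesis by auto
  qed
  ultimately show ?thesis by simp
qed

section \<open>Fractions formed from pairs with a given greatest common divisor\<close>

definition gcd_class :: "nat \<Rightarrow> nat \<Rightarrow> (nat \<times> nat) set" where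
  "gcd_class B g = {(a, b). a \<in> {B..<2 * B} \<and> b \<in> {B..<2 * B} \<and> gcd a b = g}"

lemma finite_gcd_class [simp]: "finite (gcd_class B g)"
  by (rule finite_subset[of _ "{B..<2 * B} \<times> {B..<2 * B}"]) (auto simp: gcd_class_def)

lemma card_gcd_class_le:
  assumes "0 < g" "g < 2 * B"
  shows "real (card (gcd_class B g)) \<le> 9 * (real B / real g)\<^sup>2"
proof -
  define M where "M = {a\<in>{B..<B + B}. g dvd a}"
  have "gcd_class B g \<subseteq> M \<times> M" by (auto simp: gcd_class_def M_def)
  hence "card (gcd_class B g) \<le> card (M \<times> M)" by (intro card_mono) (auto simp: M_def)
  hence "real (card (gcd_class B g)) \<le> (real (card M))\<^sup>2"
    by (simp add: card_cartesian_product power2_eq_square flip: of_nat_mult)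
  also have "\<dots> \<le> (3 * (real B / real g))\<^sup>2"
  proof (rule power_mono)
    have "real (card M) \<le> real B / real g + 1" unfolding M_def by (rule card_multiples_le[OF assms(1)])
    \<comment> \<open>Because g < 2B, the 1 lost by rounding is itself of the size of the main
      term.\<close>
    also have "1 \<le> 2 * real B / real g" using assms by (simp add: field_simps)
    finally show "real (card M) \<le> 3 * (real B / real g)" by simp
  qed auto
  finally show ?thesis by (simp add: power_mult_distrib power_divide)
qed

text \<open>Within a class equal quotients force equal pairs, because the cofactors of g are
  coprime. The cross difference a b' - a' b is a multiple of g^2, hence at least g^2 in absolute
  value when it is nonzero.\<close>

lemma gcd_class_gap:
  assumes st: "s \<in> gcd_class B g" "t \<in> gcd_class B g" "s \<noteq> t" and B: "B > 0"
  shows "\<bar>real (fst s) / real (snd s) - real (fst t) / real (snd t)\<bar> \<ge> (real g)\<^sup>2 / (4 * (real B)\<^sup>2)"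
proof -
  obtain a b a' b' where s: "s = (a, b)" and t: "t = (a', b')" by (cases s, cases t)
  have ab: "a < 2 * B" "b < 2 * B" "a' < 2 * B" "b' < 2 * B" "b > 0" "b' > 0" "gcd a b = g" "gcd a' b' = g"
    using st B by (auto simp: gcd_class_def s t)
  have g: "g > 0" using ab by auto
  have ne: "a * b' \<noteq> a' * b"
  proof
    assume eq: "a * b' = a' * b"
    have "a * gcd a' b' = gcd (a * a') (a * b')" by (simp add: gcd_mult_distrib_nat)
    also have "\<dots> = a' * gcd a b" unfolding eq by (simp add: gcd_mult_distrib_nat mult.commute)
    finally have 1: "a = a'" using ab g by simp
    have "b * gcd a' b' = gcd (a' * b) (b * b')" by (simp add: gcd_mult_distrib_nat mult.commute)
    also have "\<dots> = b' * gcd a b" unfolding eq[symmetric] by (simp add: gcd_mult_distrib_nat mult.commute)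
    finally have 2: "b = b'" using ab g by simp
    show False using 1 2 st(3) s t by simp
  qed
  have "g dvd a" "g dvd b" "g dvd a'" "g dvd b'"
    using gcd_dvd1[of a b] gcd_dvd2[of a b] gcd_dvd1[of a' b'] gcd_dvd2[of a' b'] unfolding ab(7,8) .
  hence "g * g dvd a * b'" "g * g dvd a' * b" by (auto intro: mult_dvd_mono)
  hence "int (g * g) dvd int (a * b') - int (a' * b)" by (intro dvd_diff) (simp_all only: of_nat_dvd_iff)
  moreover have "int (a * b') \<noteq> int (a' * b)" using ne by (simp only: of_nat_eq_iff) simp
  ultimately have "int (g * g) \<le> \<bar>int (a * b') - int (a' * b)\<bar>"
    by (intro zdvd_imp_le) (simp_all del: of_nat_mult)
  hence "int g * int g \<le> \<bar>int (a * b') - int (a' * b)\<bar>" by simp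
  hence "real_of_int (int g * int g) \<le> real_of_int \<bar>int (a * b') - int (a' * b)\<bar>" by linarith
  hence 1: "(real g)\<^sup>2 \<le> \<bar>real a * real b' - real a' * real b\<bar>" by (simp add: power2_eq_square)
  have 2: "real b * real b' \<le> 4 * (real B)\<^sup>2"
  proof -
    have "real b * real b' \<le> (2 * real B) * (2 * real B)" using ab by (intro mult_mono) auto
    thus ?thesis by (simp add: power2_eq_square)
  qed
  have "(real g)\<^sup>2 / (4 * (real B)\<^sup>2) \<le> \<bar>real a * real b' - real a' * real b\<bar> / (real b * real b')"
    using 1 2 ab by (intro frac_le) auto
  also have "\<dots> = \<bar>real a / real b - real a' / real b'\<bar>"
    using ab by (simp add: abs_mult diff_frac_eq abs_divide)
  finally show ?thesis by (simp add: s t)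
qed

text \<open>For a fixed fraction from the first class the squares of the fractions from the second
  are well spaced, and conversely. Counting in both orders gives \<open>P + k\<close> and
  \<open>Q + k\<close>, and the smaller of P and Q is at most their geometric mean.\<close>

lemma spacing_class_count:
  assumes A: "0 < A" "0 < M" and g: "0 < g" "g < 2 * A" and d: "0 < d" "d < 4 * M" and \<kappa>: "\<kappa> \<ge> 0"
  shows "real (card {(p, q) \<in> gcd_class A g \<times> gcd_class (2 * M) d.
      \<bar>real (fst p) / real (snd p) - (real (fst q) / real (snd q))\<^sup>2\<bar> \<le> \<kappa>})
     \<le> (18 * real A * real M + 288 * \<kappa> * (real A * real M)\<^sup>2) / (real g * real d)"
proof -
  define R T where "R = gcd_class A g" and "T = gcd_class (2 * M) d"
  define \<rho> where "\<rho> p = real (fst p) / real (snd p)" for p :: "nat \<times> nat"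
  define N where "N = card {(p, q) \<in> R \<times> T. \<bar>\<rho> p - (\<rho> q)\<^sup>2\<bar> \<le> \<kappa>}"
  have fin: "finite R" "finite T" by (simp_all add: R_def T_def)
  define P Q k where "P = 9 * (real A / real g)\<^sup>2" and "Q = 36 * (real M / real d)\<^sup>2"
    and "k = 288 * \<kappa> * ((real A * real M) / (real g * real d))\<^sup>2"
  have P0: "P > 0" "Q > 0" using A g d by (auto simp: P_def Q_def)
  have cR: "real (card R) \<le> P" unfolding R_def P_def using card_gcd_class_le[OF g] .
  have cT: "real (card T) \<le> Q" unfolding T_def Q_def using card_gcd_class_le[of d "2 * M"] d by (simp add: power_mult_distrib power_divide)
  have "N = card (Sigma R (\<lambda>p. {q\<in>T. \<bar>(\<rho> q)\<^sup>2 - \<rho> p\<bar> \<le> \<kappa>}))"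
    unfolding N_def by (rule arg_cong[of _ _ card]) (auto simp: abs_minus_commute)
  hence "real N = (\<Sum>p\<in>R. real (card {q\<in>T. \<bar>(\<rho> q)\<^sup>2 - \<rho> p\<bar> \<le> \<kappa>}))"
    using fin by (simp add: card_SigmaI)
  also have "\<dots> \<le> (\<Sum>p\<in>R. 1 + 2 * \<kappa> / ((real d)\<^sup>2 / (16 * (real M)\<^sup>2)))"
  proof (rule sum_mono, rule card_gap_le)
    fix s t assume st: "s \<in> T" "t \<in> T" "s \<noteq> t"
    \<comment> \<open>Two such fractions have sum at least 1, so squaring does not shrink the
      gaps.\<close>
    have half: "\<rho> q \<ge> 1 / 2" if "q \<in> T" for q using that A by (auto simp: T_def gcd_class_def \<rho>_def field_simps)
    have "(real d)\<^sup>2 / (16 * (real M)\<^sup>2) \<le> \<bar>\<rho> s - \<rho> t\<bar> * 1"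
      using gcd_class_gap[of s "2 * M" d t] st A unfolding \<rho>_def T_def by (simp add: power_mult_distrib)
    also have "\<dots> \<le> \<bar>\<rho> s - \<rho> t\<bar> * (\<rho> s + \<rho> t)"
      using half[OF st(1)] half[OF st(2)] by (intro mult_left_mono) auto
    also have "\<dots> = \<bar>\<rho> s - \<rho> t\<bar> * \<bar>\<rho> s + \<rho> t\<bar>" using half[OF st(1)] half[OF st(2)] by simp
    also have "\<dots> = \<bar>(\<rho> s)\<^sup>2 - (\<rho> t)\<^sup>2\<bar>"
      by (simp add: power2_eq_square algebra_simps flip: abs_mult)
    finally show "(real d)\<^sup>2 / (16 * (real M)\<^sup>2) \<le> \<bar>(\<rho> s)\<^sup>2 - (\<rho> t)\<^sup>2\<bar>" .
  qed (use fin d A \<kappa> in auto)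
  also have "\<dots> = real (card R) * (1 + 32 * \<kappa> * (real M / real d)\<^sup>2)" by (simp add: power_divide)
  also have "\<dots> \<le> P * (1 + 32 * \<kappa> * (real M / real d)\<^sup>2)" using \<kappa> by (intro mult_right_mono cR) auto
  also have "\<dots> = P + k" by (simp add: P_def k_def power_divide power_mult_distrib algebra_simps)
  finally have 1: "real N \<le> P + k" .
  have "N = card {(q, p) \<in> T \<times> R. \<bar>\<rho> p - (\<rho> q)\<^sup>2\<bar> \<le> \<kappa>}"
    unfolding N_def by (rule bij_betw_same_card[of prod.swap]) (auto simp: bij_betw_def inj_on_def image_iff)
  also have "{(q, p) \<in> T \<times> R. \<bar>\<rho> p - (\<rho> q)\<^sup>2\<bar> \<le> \<kappa>} = Sigma T (\<lambda>q. {p\<in>R. \<bar>\<rho> p - (\<rho> q)\<^sup>2\<bar> \<le> \<kappa>})"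
    by auto
  finally have "real N = (\<Sum>q\<in>T. real (card {p\<in>R. \<bar>\<rho> p - (\<rho> q)\<^sup>2\<bar> \<le> \<kappa>}))"
    using fin by (simp add: card_SigmaI)
  also have "\<dots> \<le> (\<Sum>q\<in>T. 1 + 2 * \<kappa> / ((real g)\<^sup>2 / (4 * (real A)\<^sup>2)))"
  proof (rule sum_mono, rule card_gap_le)
    fix s t assume "s \<in> R" "t \<in> R" "s \<noteq> t"
    thus "(real g)\<^sup>2 / (4 * (real A)\<^sup>2) \<le> \<bar>\<rho> s - \<rho> t\<bar>"
      unfolding \<rho>_def R_def using A by (intro gcd_class_gap) auto
  qed (use fin g A \<kappa> in auto)
  also have "\<dots> = real (card T) * (1 + 8 * \<kappa> * (real A / real g)\<^sup>2)" by (simp add: power_divide)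
  also have "\<dots> \<le> Q * (1 + 8 * \<kappa> * (real A / real g)\<^sup>2)" using \<kappa> by (intro mult_right_mono cT) auto
  also have "\<dots> = Q + k" by (simp add: Q_def k_def power_divide power_mult_distrib algebra_simps)
  finally have 2: "real N \<le> Q + k" .
  \<comment> \<open>The geometric mean is proportional to 1/(g d), so that summing over both gcds
    later costs only harmonic numbers.\<close>
  have "min P Q \<le> 18 * real A * real M / (real g * real d)"
  proof -
    have "(min P Q)\<^sup>2 \<le> P * Q" using P0 unfolding power2_eq_square by (intro mult_mono) auto
    also have "\<dots> = (18 * real A * real M / (real g * real d))\<^sup>2"
      by (simp add: P_def Q_def power_divide power_mult_distrib)
    finally show ?thesis by (rule power2_le_imp_le) auto
  qed
  moreover have "k \<le> 288 * \<kappa> * (real A * real M)\<^sup>2 / (real g * real d)"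
  proof -
    have gd: "1 \<le> real g * real d" using mult_mono[of 1 "real g" 1 "real d"] g d by auto
    have "k = 288 * \<kappa> * (real A * real M)\<^sup>2 / (real g * real d) / (real g * real d)"
      by (simp add: k_def power_divide power2_eq_square)
    also have "\<dots> \<le> 288 * \<kappa> * (real A * real M)\<^sup>2 / (real g * real d) / 1"
      using gd \<kappa> by (intro divide_left_mono) auto
    finally show ?thesis by simp
  qed
  ultimately have "real N \<le> 18 * real A * real M / (real g * real d) + 288 * \<kappa> * (real A * real M)\<^sup>2 / (real g * real d)"
    using 1 2 by linarith
  thus ?thesis unfolding N_def R_def T_def \<rho>_def by (simp add: add_divide_distrib)
qed

text \<open>If $a = m' - m$ and $y = m + m'$, then $1/m - 1/m' = 4a/(y^2 - a^2)$, so that the spacing of these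
  differences is governed by that of the quotients $a/y^2$.\<close>

definition spacing_set :: "nat \<Rightarrow> nat \<Rightarrow> real \<Rightarrow> ((nat \<times> nat) \<times> (nat \<times> nat)) set" where
  "spacing_set A M E = {((a, b), (y, z)). a \<in> {A..<2 * A} \<and> b \<in> {A..<2 * A} \<and> y \<in> {2 * M..<4 * M} \<and> z \<in> {2 * M..<4 * M} \<and>
     \<bar>real a * (real z)\<^sup>2 - real b * (real y)\<^sup>2\<bar> \<le> E}"

lemma finite_spacing_set [simp]: "finite (spacing_set A M E)"
  by (rule finite_subset[of _ "({A..<2 * A} \<times> {A..<2 * A}) \<times> ({2 * M..<4 * M} \<times> {2 * M..<4 * M})"])
     (auto simp: spacing_set_def)

text \<open>Dividing by b z^2 turns the condition into closeness of a/b to (y/z)^2. The pairs (a, b)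
  and (y, z) are sorted by their gcds, and the sums of the reciprocals of these give the squared
  harmonic number.\<close>

lemma spacing_count:
  assumes A: "0 < A" "A \<le> M" and E: "E \<ge> 0"
  shows "real (card (spacing_set A M E)) \<le> (harm (4 * M))\<^sup>2 * (18 * real A * real M + 72 * E * real A)"
proof -
  \<comment> \<open>The denominator A (2M)^2 is the least possible value of b z^2.\<close>
  define \<kappa> where "\<kappa> = E / (4 * real A * (real M)\<^sup>2)"
  define C where "C g d = {(p, q) \<in> gcd_class A g \<times> gcd_class (2 * M) d.
      \<bar>real (fst p) / real (snd p) - (real (fst q) / real (snd q))\<^sup>2\<bar> \<le> \<kappa>}" for g d
  define W where "W = 18 * real A * real M + 72 * E * real A"
  have W: "W \<ge> 0" using E by (simp add: W_def)
  have k0: "\<kappa> \<ge> 0" using E by (simp add: \<kappa>_def)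
  have Weq: "18 * real A * real M + 288 * \<kappa> * (real A * real M)\<^sup>2 = W"
    using A by (simp add: W_def \<kappa>_def power_mult_distrib field_simps power2_eq_square)
  have finC: "finite (C g d)" for g d
    by (rule finite_subset[of _ "gcd_class A g \<times> gcd_class (2 * M) d"]) (auto simp: C_def)
  have "spacing_set A M E \<subseteq> (\<Union>g\<in>{1..<2 * A}. \<Union>d\<in>{1..<4 * M}. C g d)"
  proof
    fix x assume "x \<in> spacing_set A M E"
    then obtain a b y z where x: "x = ((a, b), (y, z))"
      and ab: "a \<in> {A..<2 * A}" "b \<in> {A..<2 * A}" "y \<in> {2 * M..<4 * M}" "z \<in> {2 * M..<4 * M}"
      and le: "\<bar>real a * (real z)\<^sup>2 - real b * (real y)\<^sup>2\<bar> \<le> E"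
      by (auto simp: spacing_set_def)
    have pos: "a > 0" "b > 0" "y > 0" "z > 0" "M > 0" using ab A by auto
    have "real a / real b - (real y / real z)\<^sup>2 = (real a * (real z)\<^sup>2 - real b * (real y)\<^sup>2) / (real b * (real z)\<^sup>2)"
      using pos by (simp add: field_simps)
    hence "\<bar>real a / real b - (real y / real z)\<^sup>2\<bar> = \<bar>real a * (real z)\<^sup>2 - real b * (real y)\<^sup>2\<bar> / (real b * (real z)\<^sup>2)"
      by (simp add: abs_divide abs_mult)
    also have "\<dots> \<le> E / (real A * (2 * real M)\<^sup>2)"
    proof (intro frac_le le mult_mono power_mono)
      show "2 * real M \<le> real z" using ab(4) by simp
    qed (use ab A E in auto)
    also have "\<dots> = \<kappa>" by (simp add: \<kappa>_def power_mult_distrib mult_ac)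
    finally have k: "\<bar>real a / real b - (real y / real z)\<^sup>2\<bar> \<le> \<kappa>" .
    have "gcd a b < 2 * A" "gcd y z < 4 * M"
      using le_less_trans[OF gcd_le1_nat[of a b], of "2 * A"] le_less_trans[OF gcd_le1_nat[of y z], of "4 * M"] ab pos by auto
    hence "gcd a b \<in> {1..<2 * A}" "gcd y z \<in> {1..<4 * M}" using pos by (auto simp: Suc_le_eq)
    moreover have "x \<in> C (gcd a b) (gcd y z)" unfolding C_def using ab k by (auto simp: x gcd_class_def)
    ultimately show "x \<in> (\<Union>g\<in>{1..<2 * A}. \<Union>d\<in>{1..<4 * M}. C g d)" by blast
  qed
  hence "card (spacing_set A M E) \<le> card (\<Union>g\<in>{1..<2 * A}. \<Union>d\<in>{1..<4 * M}. C g d)"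
    by (intro card_mono) (auto intro: finC)
  also have "\<dots> \<le> (\<Sum>g\<in>{1..<2 * A}. \<Sum>d\<in>{1..<4 * M}. card (C g d))"
    by (rule order_trans[OF card_UN_le]) (auto intro!: sum_mono card_UN_le)
  finally have "real (card (spacing_set A M E)) \<le> (\<Sum>g\<in>{1..<2 * A}. \<Sum>d\<in>{1..<4 * M}. real (card (C g d)))"
    by (metis (mono_tags, lifting) of_nat_mono of_nat_sum sum.cong)
  also have "\<dots> \<le> (\<Sum>g\<in>{1..<2 * A}. \<Sum>d\<in>{1..<4 * M}. W / (real g * real d))"
    unfolding C_def Weq[symmetric] using A k0 by (intro sum_mono spacing_class_count) auto
  also have "\<dots> = W * ((\<Sum>g\<in>{1..<2 * A}. 1 / real g) * (\<Sum>d\<in>{1..<4 * M}. 1 / real d))"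
    by (subst sum_product, subst sum_distrib_left, intro sum.cong refl, subst sum_distrib_left, intro sum.cong refl) simp
  also have "\<dots> \<le> W * (harm (4 * M) * harm (4 * M))"
  proof (intro mult_left_mono mult_mono W)
    show "(\<Sum>g\<in>{1..<2 * A}. 1 / real g) \<le> harm (4 * M)" unfolding harm_def inverse_eq_divide
      using A by (intro sum_mono2) auto
    show "(\<Sum>g\<in>{1..<4 * M}. 1 / real g) \<le> harm (4 * M)" unfolding harm_def inverse_eq_divide
      by (intro sum_mono2) auto
  qed (auto intro!: sum_nonneg harm_nonneg)
  finally show ?thesis by (simp add: W_def power2_eq_square mult_ac)
qed

text \<open>Put r = h' n - h n'. Given h, n' and r, the number h' is a divisor of h n' + r, and then
  n is determined; so at most 2R + 1 values of r and one divisor bound suffice.\<close>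

lemma product_spacing_count:
  fixes R Dv :: real
  assumes I: "I \<subseteq> {H..<2 * H} \<times> {1..N}" and H: "0 < H" and R: "R \<ge> 0"
    and Dv: "\<And>k. 0 < k \<Longrightarrow> k \<le> 2 * H * N \<Longrightarrow> real (card {d. d dvd k}) \<le> Dv" and Dv0: "Dv \<ge> 0"
  shows "real (card {((h, n), (h', n')) \<in> I \<times> I. \<bar>real h * real n' - real h' * real n\<bar> \<le> R})
     \<le> real H * real N * (2 * R + 1) * Dv"
proof -
  define S where "S = {((h, n), (h', n')) \<in> I \<times> I. \<bar>real h * real n' - real h' * real n\<bar> \<le> R}"
  define J where "J = ({H..<2 * H} \<times> {1..N}) \<times> {-\<lfloor>R\<rfloor>..\<lfloor>R\<rfloor>}"
  define G where "G = (\<lambda>((h, n'), r). {d. d dvd nat (int (h * n') + r) \<and> 0 < int (h * n') + r \<and> nat (int (h * n') + r) \<le> 2 * H * N})"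
  have finJ: "finite J" by (auto simp: J_def)
  have finG: "finite (G j)" for j
    by (cases j, cases "fst j", cases "0 < int (fst (fst j) * snd (fst j)) + snd j") (auto simp: G_def)
  have "card S \<le> card (Sigma J G)"
  proof (rule card_inj_on_le[of "\<lambda>((h, n), (h', n')). (((h, n'), int (h' * n) - int (h * n')), h')"])
    show "inj_on (\<lambda>((h, n), (h', n')). (((h, n'), int (h' * n) - int (h * n')), h')) S"
      using I H by (auto simp: inj_on_def S_def)
    show "(\<lambda>((h, n), (h', n')). (((h, n'), int (h' * n) - int (h * n')), h')) ` S \<subseteq> Sigma J G"
    proof safe
      fix h n h' n' assume "((h, n), (h', n')) \<in> S"
      hence s: "(h, n) \<in> I" "(h', n') \<in> I" "\<bar>real h * real n' - real h' * real n\<bar> \<le> R" by (auto simp: S_def)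
      have b: "h \<in> {H..<2 * H}" "h' \<in> {H..<2 * H}" "n \<in> {1..N}" "n' \<in> {1..N}" using s I by auto
      have "real_of_int \<bar>int (h' * n) - int (h * n')\<bar> \<le> R" using s(3) by (simp add: abs_minus_commute)
      hence "\<bar>int (h' * n) - int (h * n')\<bar> \<le> \<lfloor>R\<rfloor>" by (simp add: le_floor_iff)
      thus "((h, n'), int (h' * n) - int (h * n')) \<in> J" using b by (auto simp: J_def)
      have "h' * n \<le> (2 * H) * N" using b by (intro mult_mono) auto
      moreover have e: "int (h * n') + (int (h' * n) - int (h * n')) = int (h' * n)" by simp
      ultimately show "h' \<in> G ((h, n'), int (h' * n) - int (h * n'))"
        using b H unfolding G_def prod.case e by (simp del: of_nat_mult)
    qed
    show "finite (Sigma J G)" using finJ finG by blast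
  qed
  also have "card (Sigma J G) = (\<Sum>j\<in>J. card (G j))" using finJ finG by (simp add: card_SigmaI)
  finally have "real (card S) \<le> (\<Sum>j\<in>J. real (card (G j)))" by (metis of_nat_mono of_nat_sum)
  also have "\<dots> \<le> (\<Sum>j\<in>J. Dv)"
  proof (rule sum_mono)
    fix j assume "j \<in> J"
    obtain h n r where j: "j = ((h, n), r)" by (metis prod.exhaust)
    show "real (card (G j)) \<le> Dv"
    proof (cases "0 < int (h * n) + r \<and> nat (int (h * n) + r) \<le> 2 * H * N")
      case True
      thus ?thesis using Dv[of "nat (int (h * n) + r)"] by (simp add: G_def j)
    next
      case False
      hence "G j = {}" by (auto simp: G_def j)
      thus ?thesis using Dv0 by simp
    qed
  qed
  also have "\<dots> = real (card J) * Dv" by simp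
  also have "\<dots> \<le> (real H * real N * (2 * R + 1)) * Dv"
  proof (intro mult_right_mono Dv0)
    have "real (card J) = real H * real N * real (nat (2 * \<lfloor>R\<rfloor> + 1))" by (simp add: J_def card_cartesian_product)
    also have "\<dots> \<le> real H * real N * (2 * R + 1)"
    proof (intro mult_left_mono)
      have "\<lfloor>R\<rfloor> \<ge> 0" using R by simp
      thus "real (nat (2 * \<lfloor>R\<rfloor> + 1)) \<le> 2 * R + 1" by linarith
    qed auto
    finally show "real (card J) \<le> \<dots>" .
  qed
  finally show ?thesis by (simp add: S_def)
qed

section \<open>Differences 1/m - 1/m' for m and m' in a common cell\<close>

definition diff_pairs :: "nat \<Rightarrow> nat \<Rightarrow> nat \<Rightarrow> (nat \<times> nat) set" where
  "diff_pairs M A i = {(m, m'). m \<in> {M..<2 * M} \<and> m' \<in> {M..<2 * M} \<and> m div A = m' div A \<and> m < m' \<and>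
     2 ^ i \<le> m' - m \<and> m' - m < 2 * 2 ^ i}"

lemma finite_diff_pairs [simp]: "finite (diff_pairs M A i)"
  by (rule finite_subset[of _ "{M..<2 * M} \<times> {M..<2 * M}"]) (auto simp: diff_pairs_def)

text \<open>All n that can satisfy D < m n \<le> 2D together with some m in [M, 2M), enlarged to a
  condition free of m.\<close>

definition len_set :: "nat \<Rightarrow> nat \<Rightarrow> nat set" where
  "len_set D M = {n. D < 2 * M * n \<and> M * n \<le> 2 * D}"

lemma len_set_subset: "M > 0 \<Longrightarrow> len_set D M \<subseteq> {1..2 * D div M}"
  by (auto simp: len_set_def less_eq_div_iff_mult_less_eq mult.commute intro!: Suc_leI Nat.gr0I)

lemma finite_len_set [simp]: "M > 0 \<Longrightarrow> finite (len_set D M)"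
  by (rule finite_subset[OF len_set_subset]) auto

lemma card_len_set: "M > 0 \<Longrightarrow> real (card (len_set D M)) \<le> 2 * real D / real M"
proof -
  assume M: "M > 0"
  have "card (len_set D M) \<le> card {1..2 * D div M}" by (rule card_mono[OF _ len_set_subset[OF M]]) auto
  hence "real (card (len_set D M)) \<le> real (2 * D div M)" by simp
  also have "\<dots> \<le> real (2 * D) / real M" by (rule of_nat_div_le_of_nat)
  finally show ?thesis by simp
qed

lemma diff_pairs_freq:
  assumes x: "x > 0" and M: "M > 0" and j: "(m, m') \<in> diff_pairs M A i"
  shows "0 < x / real m - x / real m'" "x / real m - x / real m' \<le> 2 * x * 2 ^ i / (real M)\<^sup>2"
proof -
  have m: "M \<le> m" "M \<le> m'" "m < m'" "m' - m < 2 * 2 ^ i" using j by (auto simp: diff_pairs_def)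
  have eq: "x / real m - x / real m' = x * real (m' - m) / (real m * real m')"
    using m M by (simp add: field_simps of_nat_diff)
  show "0 < x / real m - x / real m'" unfolding eq using m M x by simp
  have "real (m' - m) \<le> real (2 * 2 ^ i)" using m by (subst of_nat_le_iff) simp
  hence "real (m' - m) \<le> 2 * 2 ^ i" by simp
  moreover have "(real M)\<^sup>2 \<le> real m * real m'" unfolding power2_eq_square using m by (intro mult_mono) auto
  ultimately show "x / real m - x / real m' \<le> 2 * x * 2 ^ i / (real M)\<^sup>2"
    unfolding eq using x M by (intro frac_le) (auto simp: mult_left_mono)
qed

text \<open>A pair is recovered from its difference and its sum. With differences a, b and sums y, z
  of the two pairs, it remains to see that close values of x/m - x/m' make a z^2 and b y^2
  close.\<close>

lemma diff_pairs_spacing: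
  fixes \<Omega> :: real
  assumes x: "x > 0" and M: "M > 0" and \<Omega>: "\<Omega> \<ge> 0"
  shows "card {(p, q) \<in> diff_pairs M A i \<times> diff_pairs M A i.
      \<bar>(x / real (fst p) - x / real (snd p)) - (x / real (fst q) - x / real (snd q))\<bar> \<le> \<Omega>}
    \<le> card (spacing_set (2 ^ i) M (4 * (2 ^ i) ^ 3 + 64 * \<Omega> * real M ^ 4 / x))"
proof (rule card_inj_on_le)
  let ?S = "{(p, q) \<in> diff_pairs M A i \<times> diff_pairs M A i.
      \<bar>(x / real (fst p) - x / real (snd p)) - (x / real (fst q) - x / real (snd q))\<bar> \<le> \<Omega>}"
  let ?f = "\<lambda>((m1, m2), (m3, m4)). ((m2 - m1, m4 - m3), (m1 + m2, m3 + m4)) :: (nat \<times> nat) \<times> (nat \<times> nat)"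
  have inj: "m1 = n1 \<and> m2 = n2" if "m2 - m1 = n2 - n1" "m1 + m2 = n1 + n2" "m1 < m2" "n1 < n2" for m1 m2 n1 n2 :: nat
    using that by linarith
  show "inj_on ?f ?S"
  proof (rule inj_onI)
    fix s t assume s: "s \<in> ?S" and t: "t \<in> ?S" and eq: "?f s = ?f t"
    obtain m1 m2 m3 m4 where s': "s = ((m1, m2), (m3, m4))" by (metis prod.exhaust)
    obtain n1 n2 n3 n4 where t': "t = ((n1, n2), (n3, n4))" by (metis prod.exhaust)
    have "m1 < m2" "m3 < m4" using s by (auto simp: s' diff_pairs_def)
    moreover have "n1 < n2" "n3 < n4" using t by (auto simp: t' diff_pairs_def)
    moreover have "m2 - m1 = n2 - n1" "m1 + m2 = n1 + n2" "m4 - m3 = n4 - n3" "m3 + m4 = n3 + n4"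
      using eq by (simp_all add: s' t')
    ultimately show "s = t" using inj[of m2 m1 n2 n1] inj[of m4 m3 n4 n3] by (simp add: s' t')
  qed
  show "?f ` ?S \<subseteq> spacing_set (2 ^ i) M (4 * (2 ^ i) ^ 3 + 64 * \<Omega> * real M ^ 4 / x)"
  proof
    fix s assume "s \<in> ?f ` ?S"
    then obtain m1 m2 m3 m4 where s: "s = ((m2 - m1, m4 - m3), (m1 + m2, m3 + m4))"
      and p: "(m1, m2) \<in> diff_pairs M A i" and q: "(m3, m4) \<in> diff_pairs M A i"
      and le: "\<bar>(x / real m1 - x / real m2) - (x / real m3 - x / real m4)\<bar> \<le> \<Omega>"
    proof -
      from \<open>s \<in> ?f ` ?S\<close> obtain r where r: "r \<in> ?S" "s = ?f r" by blast
      obtain m1 m2 m3 m4 where r': "r = ((m1, m2), (m3, m4))" by (metis prod.exhaust)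
      show thesis using r by (intro that[of m2 m1 m4 m3]) (simp_all add: r')
    qed
    have m: "M \<le> m1" "M \<le> m2" "m1 < m2" "m2 < 2 * M" "2 ^ i \<le> m2 - m1" "m2 - m1 < 2 * 2 ^ i"
       "M \<le> m3" "M \<le> m4" "m3 < m4" "m4 < 2 * M" "2 ^ i \<le> m4 - m3" "m4 - m3 < 2 * 2 ^ i"
      using p q by (auto simp: diff_pairs_def)
    define a b where "a = real (m2 - m1)" and "b = real (m4 - m3)"
    define A0 :: real where "A0 = 2 ^ i"
    have ab: "a = real m2 - real m1" "b = real m4 - real m3" using m by (auto simp: a_def b_def of_nat_diff)
    have a: "A0 \<le> a" "a \<le> 2 * A0" "A0 \<le> b" "b \<le> 2 * A0"
    proof -
      have "real (2 ^ i) \<le> real (m2 - m1)" "real (m2 - m1) \<le> real (2 * 2 ^ i)"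
        "real (2 ^ i) \<le> real (m4 - m3)" "real (m4 - m3) \<le> real (2 * 2 ^ i)"
        using m unfolding of_nat_le_iff by auto
      thus "A0 \<le> a" "a \<le> 2 * A0" "A0 \<le> b" "b \<le> 2 * A0" by (auto simp: a_def b_def A0_def)
    qed
    have A0: "A0 > 0" by (simp add: A0_def)
    define P where "P = real m1 * real m2 * (real m3 * real m4)"
    have P: "P > 0" "P \<le> 16 * real M ^ 4"
    proof -
      have "P \<le> (2 * real M) * (2 * real M) * ((2 * real M) * (2 * real M))" unfolding P_def
        using m by (intro mult_mono) auto
      thus "P \<le> 16 * real M ^ 4" by (simp add: power4_eq_xxxx mult_ac)
      show "P > 0" using m M by (auto simp: P_def)
    qed
    have eq: "(x / real m1 - x / real m2) - (x / real m3 - x / real m4) = x * (a * (real m3 * real m4) - b * (real m1 * real m2)) / P"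
      using m M by (simp add: ab P_def field_simps)
    from le[unfolded eq] P x have "x * \<bar>a * (real m3 * real m4) - b * (real m1 * real m2)\<bar> \<le> \<Omega> * P"
      by (simp add: abs_mult abs_divide divide_le_eq)
    also have "\<dots> \<le> \<Omega> * (16 * real M ^ 4)" using \<Omega> P by (intro mult_left_mono)
    finally have "\<bar>a * (real m3 * real m4) - b * (real m1 * real m2)\<bar> \<le> 16 * \<Omega> * real M ^ 4 / x"
      using x by (simp add: le_divide_eq mult_ac)
    hence 1: "\<bar>4 * (a * (real m3 * real m4) - b * (real m1 * real m2))\<bar> \<le> 64 * \<Omega> * real M ^ 4 / x"
      unfolding abs_mult by simp
    have 2: "\<bar>a * b * (b - a)\<bar> \<le> 4 * A0 ^ 3"
    proof -
      have "\<bar>a * b * (b - a)\<bar> = (a * b) * \<bar>b - a\<bar>" using a A0 by (simp add: abs_mult)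
      also have "\<dots> \<le> ((2 * A0) * (2 * A0)) * A0"
      proof (intro mult_mono)
        show "\<bar>b - a\<bar> \<le> A0" using a by linarith
      qed (use a A0 in auto)
      finally show ?thesis by (simp add: power3_eq_cube)
    qed
    \<comment> \<open>This follows from y^2 = 4 m1 m2 + a^2 and its analogue for the second pair.
      The term a b (b - a) is the price of replacing the products by squares and is responsible for
      the summand 4 (2^i)^3.\<close>
    have "a * (real (m3 + m4))\<^sup>2 - b * (real (m1 + m2))\<^sup>2 =
       4 * (a * (real m3 * real m4) - b * (real m1 * real m2)) + a * b * (b - a)"
      by (simp add: ab power2_eq_square algebra_simps)
    hence "\<bar>a * (real (m3 + m4))\<^sup>2 - b * (real (m1 + m2))\<^sup>2\<bar> \<le> 4 * A0 ^ 3 + 64 * \<Omega> * real M ^ 4 / x"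
      using 1 2 by linarith
    thus "s \<in> spacing_set (2 ^ i) M (4 * (2 ^ i) ^ 3 + 64 * \<Omega> * real M ^ 4 / x)"
      using m unfolding s spacing_set_def A0_def a_def b_def by auto
  qed
qed auto

text \<open>The double large sieve with frequencies u = h/n and v = x/m - x/m'. \<open>K\<close> is
  the bound 2 pi V Y + 1 for its number of grid points, and \<open>R\<close> is what the distance
  1/(2 pi V) between fractions h/n becomes after multiplication by n n' \<le> (2D/M)^2.\<close>

lemma diff_pairs_sum_bound:
  fixes x \<Gamma> R K :: real and \<beta> :: "nat \<times> nat \<Rightarrow> complex"
  assumes x: "x > 0" and pos: "0 < H" "0 < D" "0 < M" "2 ^ i \<le> M"
    and \<beta>: "\<And>p. norm (\<beta> p) \<le> 1"
    and div: "\<And>k. 0 < k \<Longrightarrow> k \<le> 4 * H * D \<Longrightarrow> real (card {d. d dvd k}) \<le> \<Gamma>"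
    and harm: "harm (4 * M) \<le> \<Gamma>" and L: "real L + 1 \<le> \<Gamma>" "K \<le> 2 ^ L"
    and K: "K = 16 * pi * x * 2 ^ i * real H / (real M * real D) + 1"
    and R: "R = (real D)\<^sup>2 / (pi * x * 2 ^ i)"
  shows "(norm (\<Sum>(h, n)\<in>{H..<2 * H} \<times> len_set D M. \<Sum>p\<in>diff_pairs M A i.
      \<beta> p * ee (real h / real n * (x / real (fst p) - x / real (snd p)))))\<^sup>2 \<le>
     (exp 1)\<^sup>2 * ((2 * real H * real D / real M * (2 * R + 1) * \<Gamma>) *
      (4 * K * (\<Gamma>\<^sup>2 * (18 * 2 ^ i * real M + 288 * (2 ^ i) ^ 4)) + \<Gamma> * (\<Gamma>\<^sup>2 * 73728 * (2 ^ i)\<^sup>2 * (real M)\<^sup>2)))"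
proof -
  define A0 :: real where "A0 = 2 ^ i"
  have A0: "A0 > 0" by (simp add: A0_def)
  define I where "I = {H..<2 * H} \<times> len_set D M"
  define J where "J = diff_pairs M A i"
  define u where "u p = real (fst p) / real (snd p)" for p :: "nat \<times> nat"
  define v where "v p = x / real (fst p) - x / real (snd p)" for p :: "nat \<times> nat"
  define V where "V = 2 * x * A0 / (real M)\<^sup>2"
  define Y where "Y = 4 * real H * real M / real D"
  have V: "V > 0" using x pos A0 by (simp add: V_def)
  have fin: "finite I" "finite J" using pos by (auto simp: I_def J_def)
  have \<Gamma>: "\<Gamma> \<ge> 1" using L(1) by linarith
  have R0: "R \<ge> 0" using x by (simp add: R)
  have vV: "0 < v p" "v p \<le> V" if "p \<in> J" for p
    using that diff_pairs_freq[OF x pos(3), of "fst p" "snd p" A i] by (auto simp: v_def V_def J_def A0_def)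
  have uY: "0 \<le> u p \<and> u p \<le> Y" if "p \<in> I" for p
  proof -
    obtain h n where p: "p = (h, n)" by (cases p)
    have hn: "h < 2 * H" "D < 2 * M * n" using that by (auto simp: I_def p len_set_def)
    have "real D \<le> real (2 * M * n)" using hn(2) unfolding of_nat_le_iff by simp
    hence "real h * real D \<le> (2 * real H) * (2 * real M * real n)" using hn pos by (intro mult_mono) auto
    moreover have "n > 0" using hn by (auto intro!: Nat.gr0I)
    ultimately show ?thesis using pos by (simp add: u_def p Y_def field_simps)
  qed
  have KK: "2 * pi * V * Y + 1 = K" using pos by (simp add: K V_def Y_def A0_def field_simps power2_eq_square)
  have K1: "K \<ge> 1" unfolding K using x by simp
  have bu: "real (card {(p, p')\<in>I \<times> I. \<bar>u p - u p'\<bar> \<le> 1 / (2 * pi * V)}) \<le> 2 * real H * real D / real M * (2 * R + 1) * \<Gamma>"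
  proof -
    define N where "N = 2 * D div M"
    have sub: "I \<subseteq> {H..<2 * H} \<times> {1..N}" using len_set_subset[OF pos(3)] by (auto simp: I_def N_def)
    have NM: "real N \<le> 2 * real D / real M" unfolding N_def using of_nat_div_le_of_nat[of "2 * D" M, where ?'a = real] by simp
    have "{(p, p')\<in>I \<times> I. \<bar>u p - u p'\<bar> \<le> 1 / (2 * pi * V)} \<subseteq>
       {((h, n), (h', n')) \<in> I \<times> I. \<bar>real h * real n' - real h' * real n\<bar> \<le> R}"
    proof safe
      fix h n h' n' assume I: "(h, n) \<in> I" "(h', n') \<in> I" and le: "\<bar>u (h, n) - u (h', n')\<bar> \<le> 1 / (2 * pi * V)"
      have n: "1 \<le> n" "n \<le> N" "1 \<le> n'" "n' \<le> N" using I sub by auto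
      have "u (h, n) - u (h', n') = (real h * real n' - real h' * real n) / (real n * real n')"
        using n by (simp add: u_def field_simps)
      with le n have "\<bar>real h * real n' - real h' * real n\<bar> \<le> 1 / (2 * pi * V) * (real n * real n')"
        by (simp add: abs_divide abs_mult divide_le_eq)
      also have "\<dots> \<le> 1 / (2 * pi * V) * ((2 * real D / real M) * (2 * real D / real M))"
      proof (intro mult_left_mono mult_mono)
        show "real n \<le> 2 * real D / real M" "real n' \<le> 2 * real D / real M" using n NM by linarith+
      qed (use V in auto)
      also have "\<dots> = R" using pos x by (simp add: R V_def A0_def field_simps power2_eq_square)
      finally show "\<bar>real h * real n' - real h' * real n\<bar> \<le> R" .
    qed
    moreover have "finite {((h, n), (h', n')) \<in> I \<times> I. \<bar>real h * real n' - real h' * real n\<bar> \<le> R}"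
      by (rule finite_subset[of _ "I \<times> I"]) (use fin in auto)
    ultimately have "card {(p, p')\<in>I \<times> I. \<bar>u p - u p'\<bar> \<le> 1 / (2 * pi * V)} \<le>
       card {((h, n), (h', n')) \<in> I \<times> I. \<bar>real h * real n' - real h' * real n\<bar> \<le> R}"
      by (intro card_mono)
    also have "real \<dots> \<le> real H * real N * (2 * R + 1) * \<Gamma>"
    proof (rule product_spacing_count[OF sub pos(1) R0])
      fix k assume k: "0 < k" "k \<le> 2 * H * N"
      have "N * M \<le> 2 * D" by (simp add: N_def)
      hence "N \<le> 2 * D" using pos by (metis Suc_leI le_trans mult_le_mono2 nat_mult_1_right One_nat_def)
      hence "2 * H * N \<le> 2 * H * (2 * D)" by (intro mult_left_mono) auto
      also have "\<dots> = 4 * H * D" by simp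
      finally have "2 * H * N \<le> 4 * H * D" .
      from le_trans[OF k(2) this] show "real (card {d. d dvd k}) \<le> \<Gamma>" by (rule div[OF k(1)])
    qed (use \<Gamma> in auto)
    also have "\<dots> \<le> real H * (2 * real D / real M) * (2 * R + 1) * \<Gamma>"
      using NM R0 \<Gamma> by (intro mult_right_mono mult_left_mono) auto
    finally show ?thesis by (simp add: mult_ac)
  qed
  have kern: "(\<Sum>p\<in>J. \<Sum>q\<in>J. kern (2 * pi * V * Y + 1) ((v p - v q) / (2 * pi * V)))
     \<le> 4 * K * (\<Gamma>\<^sup>2 * (18 * A0 * real M + 288 * A0 ^ 4)) + \<Gamma> * (\<Gamma>\<^sup>2 * 73728 * A0\<^sup>2 * (real M)\<^sup>2)"
  proof -
    have "(\<Sum>p\<in>J. \<Sum>q\<in>J. kern (2 * pi * V * Y + 1) ((v p - v q) / (2 * pi * V))) =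
      (\<Sum>s\<in>J \<times> J. kern K ((\<lambda>s. (v (fst s) - v (snd s)) / (2 * pi * V)) s))"
      unfolding KK by (simp add: sum.cartesian_product case_prod_beta)
    also have "\<dots> \<le> 4 * K * (\<Gamma>\<^sup>2 * (18 * A0 * real M + 288 * A0 ^ 4)) + (real L + 1) * (\<Gamma>\<^sup>2 * 73728 * A0\<^sup>2 * (real M)\<^sup>2)"
    proof (rule sum_kern_le[OF _ K1 L(2)])
      fix s assume "s \<in> J \<times> J"
      hence "fst s \<in> J" "snd s \<in> J" by auto
      hence "\<bar>v (fst s) - v (snd s)\<bar> \<le> V" using vV[of "fst s"] vV[of "snd s"] by linarith
      hence "\<bar>v (fst s) - v (snd s)\<bar> / (2 * pi * V) \<le> V / (2 * pi * V)" using V by (intro divide_right_mono) auto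
      also have "\<dots> \<le> 1 / 2" using V pi_gt3 by (simp add: field_simps)
      finally show "\<bar>(v (fst s) - v (snd s)) / (2 * pi * V)\<bar> \<le> 1 / 2" using V by (simp add: abs_divide abs_mult)
    next
      fix \<omega> :: real assume \<omega>: "\<omega> \<ge> 0"
      define \<Omega> where "\<Omega> = 2 * pi * V * \<omega>"
      have \<Omega>: "\<Omega> \<ge> 0" using \<omega> V by (simp add: \<Omega>_def)
      define E where "E = 4 * (2 ^ i) ^ 3 + 64 * \<Omega> * real M ^ 4 / x"
      have E: "E \<ge> 0" unfolding E_def using \<Omega> x by auto
      have Eeq: "E = 4 * A0 ^ 3 + 256 * pi * A0 * (real M)\<^sup>2 * \<omega>"
        using x pos by (simp add: E_def \<Omega>_def V_def A0_def power2_eq_square power4_eq_xxxx field_simps)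
      have "{s \<in> J \<times> J. \<bar>(v (fst s) - v (snd s)) / (2 * pi * V)\<bar> \<le> \<omega>} =
         {(p, q) \<in> J \<times> J. \<bar>v p - v q\<bar> \<le> \<Omega>}"
        using V by (auto simp: \<Omega>_def abs_divide abs_mult field_simps)
      hence "card {s \<in> J \<times> J. \<bar>(v (fst s) - v (snd s)) / (2 * pi * V)\<bar> \<le> \<omega>} \<le> card (spacing_set (2 ^ i) M E)"
        using diff_pairs_spacing[OF x pos(3) \<Omega>, of A i] unfolding J_def v_def E_def by simp
      also have "real (card (spacing_set (2 ^ i) M E)) \<le> (harm (4 * M))\<^sup>2 * (18 * real (2 ^ i) * real M + 72 * E * real (2 ^ i))"
        by (rule spacing_count) (use pos E in auto)
      also have "\<dots> \<le> \<Gamma>\<^sup>2 * (18 * A0 * real M + 72 * E * A0)"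
        unfolding A0_def using E harm harm_nonneg[of "4 * M", where ?'a = real] by (intro mult_mono power_mono) auto
      also have "\<dots> = \<Gamma>\<^sup>2 * (18 * A0 * real M + 288 * A0 ^ 4) + \<Gamma>\<^sup>2 * ((18432 * pi) * (A0\<^sup>2 * (real M)\<^sup>2 * \<omega>))"
        unfolding Eeq by (simp add: algebra_simps power2_eq_square power3_eq_cube power4_eq_xxxx)
      also have "\<dots> \<le> \<Gamma>\<^sup>2 * (18 * A0 * real M + 288 * A0 ^ 4) + \<Gamma>\<^sup>2 * (73728 * (A0\<^sup>2 * (real M)\<^sup>2 * \<omega>))"
      proof (intro add_left_mono mult_left_mono mult_right_mono)
        show "18432 * pi \<le> 73728" using pi_less_4 by simp
      qed (use \<omega> in auto)
      finally show "real (card {s \<in> J \<times> J. \<bar>(v (fst s) - v (snd s)) / (2 * pi * V)\<bar> \<le> \<omega>}) \<le>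
        \<Gamma>\<^sup>2 * (18 * A0 * real M + 288 * A0 ^ 4) + \<Gamma>\<^sup>2 * 73728 * A0\<^sup>2 * (real M)\<^sup>2 * \<omega>" by (simp add: mult_ac)
    qed (use fin A0 in auto)
    also have "(real L + 1) * (\<Gamma>\<^sup>2 * 73728 * A0\<^sup>2 * (real M)\<^sup>2) \<le> \<Gamma> * (\<Gamma>\<^sup>2 * 73728 * A0\<^sup>2 * (real M)\<^sup>2)"
      using L(1) by (intro mult_right_mono) auto
    finally show ?thesis by simp
  qed
  have "(norm (\<Sum>p\<in>I. \<Sum>q\<in>J. \<beta> q * ee (u p * v q)))\<^sup>2 \<le> (exp 1)\<^sup>2 *
     (real (card {(i, i')\<in>I \<times> I. \<bar>u i - u i'\<bar> \<le> 1 / (2 * pi * V)}) *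
      (\<Sum>i\<in>J. \<Sum>j\<in>J. kern (2 * pi * V * Y + 1) ((v i - v j) / (2 * pi * V))))"
    using vV by (intro double_large_sieve fin V uY \<beta>) (auto simp: Y_def less_imp_le)
  also have "\<dots> \<le> (exp 1)\<^sup>2 * ((2 * real H * real D / real M * (2 * R + 1) * \<Gamma>) *
      (4 * K * (\<Gamma>\<^sup>2 * (18 * A0 * real M + 288 * A0 ^ 4)) + \<Gamma> * (\<Gamma>\<^sup>2 * 73728 * A0\<^sup>2 * (real M)\<^sup>2)))"
  proof (intro mult_left_mono mult_mono bu kern)
    show "0 \<le> (\<Sum>i\<in>J. \<Sum>j\<in>J. kern (2 * pi * V * Y + 1) ((v i - v j) / (2 * pi * V)))"
      unfolding KK using K1 by (intro sum_nonneg) (auto simp: kern_def)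
    show "0 \<le> 2 * real H * real D / real M * (2 * R + 1) * \<Gamma>" using R0 \<Gamma> by auto
  qed auto
  finally show ?thesis unfolding I_def J_def u_def v_def A0_def by (simp add: case_prod_beta)
qed


text \<open>Multiplying out the two spacing bounds gives six terms, each at most a constant times
  \<open>c0\<close> = H D M by the size conditions. With the factor H D / M in front this is (H
  D)^2, so an off-diagonal range is no larger than the diagonal up to \<Gamma>.\<close>

lemma pair_bound_arith:
  fixes x H D M A a K R \<Gamma> Z :: real
  assumes pos: "x > 0" "H \<ge> 1" "D \<ge> 1" "M \<ge> 1" "1 \<le> a" "a \<le> A" "\<Gamma> \<ge> 1"
    and AM: "A \<le> M" and MD: "M \<le> D" and Dx: "D \<le> x" and c1: "A\<^sup>2 \<le> 4 * M" and c2: "H * x * A\<^sup>2 \<le> D\<^sup>2 * M"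
    and c3: "x * A ^ 5 \<le> M\<^sup>2 * D\<^sup>2" and c5: "D * A ^ 3 \<le> x * M" and c6: "A\<^sup>2 * M \<le> 4 * H * D"
    and c7: "D * M * A \<le> 4 * H * x"
    and K: "K = 16 * pi * x * a * H / (M * D) + 1"
    and R: "R = D\<^sup>2 / (pi * x * a)"
    and Z: "Z\<^sup>2 \<le> (exp 1)\<^sup>2 * ((2 * H * D / M * (2 * R + 1) * \<Gamma>) *
      (4 * K * (\<Gamma>\<^sup>2 * (18 * a * M + 288 * a ^ 4)) + \<Gamma> * (\<Gamma>\<^sup>2 * 73728 * a\<^sup>2 * M\<^sup>2)))"
  shows "Z \<le> 6000 * \<Gamma>\<^sup>2 * (H * D)"
proof -
  define c0 where "c0 = H * D * M"
  define P where "P = 72 * a * M + 1152 * a ^ 4"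
  \<comment> \<open>Majorants of K - 1 and, in the next line, of 2R, with pi replaced by numerical
    bounds.\<close>
  define k where "k = 64 * x * a * H / (M * D)"
  define r where "r = D\<^sup>2 / (x * a)"
  have c0: "c0 > 0" using pos by (simp add: c0_def)
  have a4: "a ^ 4 \<le> 16 * M\<^sup>2"
  proof -
    have "a ^ 4 \<le> A ^ 4" using pos by (intro power_mono) auto
    also have "\<dots> = (A\<^sup>2)\<^sup>2" by simp
    also have "\<dots> \<le> (4 * M)\<^sup>2" using c1 by (intro power_mono) auto
    finally show ?thesis by (simp add: power_mult_distrib)
  qed
  have a2: "a\<^sup>2 \<le> A\<^sup>2" "a ^ 3 \<le> A ^ 3" "a ^ 5 \<le> A ^ 5" using pos by (auto intro!: power_mono)
  have M1: "M\<^sup>2 \<le> c0"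
  proof -
    have "M * M \<le> (H * D) * M" using mult_mono[of 1 H M D] pos MD by (intro mult_right_mono) auto
    thus ?thesis by (simp add: c0_def power2_eq_square)
  qed
  have aM: "a * M \<le> c0"
  proof -
    have "a * M \<le> (H * D) * M" using mult_mono[of 1 H a D] pos AM MD by (intro mult_right_mono) auto
    thus ?thesis by (simp add: c0_def)
  qed
  have P: "P \<le> 18504 * c0" "P \<ge> 0" using a4 M1 aM pos by (auto simp: P_def)
  have kP: "k * P \<le> 78336 * c0"
  proof -
    have "k * P = 4608 * ((H * x * a\<^sup>2) / D) + 73728 * (H * (x * a ^ 5) / (M * D))"
      using pos by (simp add: k_def P_def field_simps power2_eq_square eval_nat_numeral)
    also have "(H * x * a\<^sup>2) / D \<le> (D\<^sup>2 * M) / D"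
    proof (intro divide_right_mono)
      have "H * x * a\<^sup>2 \<le> H * x * A\<^sup>2" using a2 pos by (intro mult_left_mono) auto
      thus "H * x * a\<^sup>2 \<le> D\<^sup>2 * M" using c2 by linarith
    qed (use pos in auto)
    also have "(D\<^sup>2 * M) / D \<le> c0"
    proof -
      have "(D\<^sup>2 * M) / D = 1 * (D * M)" using pos by (simp add: power2_eq_square)
      also have "\<dots> \<le> H * (D * M)" using pos by (intro mult_right_mono) auto
      finally show ?thesis by (simp add: c0_def)
    qed
    also have "H * (x * a ^ 5) / (M * D) \<le> H * (M\<^sup>2 * D\<^sup>2) / (M * D)"
    proof (intro divide_right_mono mult_left_mono)
      have "x * a ^ 5 \<le> x * A ^ 5" using a2 pos by (intro mult_left_mono) auto
      thus "x * a ^ 5 \<le> M\<^sup>2 * D\<^sup>2" using c3 by linarith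
    qed (use pos in auto)
    also have "H * (M\<^sup>2 * D\<^sup>2) / (M * D) = c0" using pos by (simp add: c0_def power2_eq_square)
    finally show ?thesis by simp
  qed
  have aM2: "a\<^sup>2 * M\<^sup>2 \<le> 4 * c0"
  proof -
    have "a\<^sup>2 * M\<^sup>2 \<le> (A\<^sup>2 * M) * M" using a2 pos by (simp add: power2_eq_square)
    also have "\<dots> \<le> (4 * H * D) * M" using c6 pos by (intro mult_right_mono) auto
    finally show ?thesis by (simp add: c0_def)
  qed
  have rkP: "r * k * P \<le> 1184256 * c0"
  proof -
    have "r * k * P = 4608 * (H * D * a) + 73728 * (H * D / M * a ^ 4)"
      using pos by (simp add: r_def k_def P_def field_simps power2_eq_square eval_nat_numeral)
    also have "H * D * a \<le> c0" unfolding c0_def using pos AM by (intro mult_left_mono) auto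
    also have "H * D / M * a ^ 4 \<le> H * D / M * (16 * M\<^sup>2)" using a4 pos by (intro mult_left_mono) auto
    also have "\<dots> = 16 * c0" using pos by (simp add: c0_def power2_eq_square)
    finally show ?thesis by simp
  qed
  have rP: "r * P \<le> 1224 * c0"
  proof -
    have "r * P = 72 * (D * M * (D / x)) + 1152 * (D * (D * a ^ 3 / x))"
      using pos by (simp add: r_def P_def field_simps power2_eq_square eval_nat_numeral)
    also have "D * M * (D / x) \<le> D * M * H"
    proof (intro mult_left_mono)
      have "D / x \<le> 1" using Dx pos by simp
      thus "D / x \<le> H" using pos by linarith
    qed (use pos in auto)
    also have "D * M * H = c0" by (simp add: c0_def)
    also have "D * (D * a ^ 3 / x) \<le> D * (H * M)"
    proof (intro mult_left_mono)
      have "D * a ^ 3 \<le> D * A ^ 3" using a2 pos by (intro mult_left_mono) auto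
      hence "D * a ^ 3 \<le> x * M" using c5 by linarith
      hence "D * a ^ 3 / x \<le> x * M / x" using pos by (intro divide_right_mono) auto
      also have "\<dots> \<le> H * M" using pos by simp
      finally show "D * a ^ 3 / x \<le> H * M" .
    qed (use pos in auto)
    also have "D * (H * M) = c0" by (simp add: c0_def)
    finally show ?thesis by simp
  qed
  have raM: "r * (a\<^sup>2 * M\<^sup>2) \<le> 4 * c0"
  proof -
    have "r * (a\<^sup>2 * M\<^sup>2) = D * M * (D * M * a / x)"
      using pos by (simp add: r_def field_simps power2_eq_square)
    also have "\<dots> \<le> D * M * (4 * H)"
    proof (intro mult_left_mono)
      have "D * M * a \<le> D * M * A" using pos by (intro mult_left_mono) auto
      hence "D * M * a \<le> 4 * H * x" using c7 by linarith
      hence "D * M * a / x \<le> (4 * H * x) / x" using pos by (intro divide_right_mono) auto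
      thus "D * M * a / x \<le> 4 * H" using pos by simp
    qed (use pos in auto)
    finally show ?thesis by (simp add: c0_def mult_ac)
  qed
  have K': "K \<le> k + 1"
  proof -
    have "16 * pi \<le> 64" using pi_less_4 by simp
    hence "16 * pi * (x * a * H / (M * D)) \<le> 64 * (x * a * H / (M * D))" using pos by (intro mult_right_mono) auto
    thus ?thesis by (simp add: K k_def mult_ac)
  qed
  have K0: "K \<ge> 0" unfolding K using pos by auto
  have R': "2 * R \<le> r"
  proof -
    have "2 * R = (2 / pi) * (D\<^sup>2 / (x * a))" by (simp add: R mult_ac)
    also have "\<dots> \<le> 1 * (D\<^sup>2 / (x * a))" using pi_ge_two pos by (intro mult_right_mono) auto
    finally show ?thesis by (simp add: r_def)
  qed
  have R0: "R \<ge> 0" unfolding R using pos by auto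
  have k0: "k \<ge> 0" "r \<ge> 0" using pos by (auto simp: k_def r_def)
  have "(2 * R + 1) * (K * P + 73728 * (a\<^sup>2 * M\<^sup>2)) \<le> (r + 1) * ((k + 1) * P + 73728 * (a\<^sup>2 * M\<^sup>2))"
    using R' K' P K0 R0 k0 by (intro mult_mono add_mono mult_right_mono add_nonneg_nonneg) auto
  also have "\<dots> = r * k * P + r * P + 73728 * (r * (a\<^sup>2 * M\<^sup>2)) + k * P + P + 73728 * (a\<^sup>2 * M\<^sup>2)"
    by (simp add: algebra_simps)
  also have "\<dots> \<le> 2000000 * c0" using rkP rP raM kP P aM2 c0 by linarith
  finally have main: "(2 * R + 1) * (K * P + 73728 * (a\<^sup>2 * M\<^sup>2)) \<le> 2000000 * c0" .
  have e: "(exp 1 :: real)\<^sup>2 \<le> 9" using power_mono[OF exp_le, of 2] by simp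
  have G3: "\<Gamma>\<^sup>2 \<le> \<Gamma> ^ 3" using pos by (intro power_increasing) auto
  have in1: "4 * K * (\<Gamma>\<^sup>2 * (18 * a * M + 288 * a ^ 4)) + \<Gamma> * (\<Gamma>\<^sup>2 * 73728 * a\<^sup>2 * M\<^sup>2) \<le> \<Gamma> ^ 3 * (K * P + 73728 * (a\<^sup>2 * M\<^sup>2))"
  proof -
    have "\<Gamma>\<^sup>2 * (K * P) \<le> \<Gamma> ^ 3 * (K * P)" using G3 K0 P by (intro mult_right_mono) auto
    thus ?thesis by (simp add: P_def algebra_simps power3_eq_cube power2_eq_square)
  qed
  have in0: "0 \<le> 4 * K * (\<Gamma>\<^sup>2 * (18 * a * M + 288 * a ^ 4)) + \<Gamma> * (\<Gamma>\<^sup>2 * 73728 * a\<^sup>2 * M\<^sup>2)"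
    using K0 pos by auto
  have "Z\<^sup>2 \<le> 9 * ((2 * H * D / M * (2 * R + 1) * \<Gamma>) * (\<Gamma> ^ 3 * (K * P + 73728 * (a\<^sup>2 * M\<^sup>2))))"
    using e in1 in0 R0 pos K0 P by (intro order_trans[OF Z] mult_mono) auto
  also have "\<dots> = 18 * (H * D / M) * \<Gamma> ^ 4 * ((2 * R + 1) * (K * P + 73728 * (a\<^sup>2 * M\<^sup>2)))"
  proof -
    have "9 * ((2 * y * S * \<Gamma>) * (\<Gamma> ^ 3 * X)) = 18 * y * \<Gamma> ^ 4 * (S * X)" for y S X :: real
      by (simp add: eval_nat_numeral mult_ac)
    from this[of "H * D / M" "2 * R + 1"] show ?thesis by (simp only: times_divide_eq_right mult.assoc)
  qed
  also have "\<dots> \<le> 18 * (H * D / M) * \<Gamma> ^ 4 * (2000000 * c0)" using main pos by (intro mult_left_mono) auto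
  also have "\<dots> = (6000 * \<Gamma>\<^sup>2 * (H * D))\<^sup>2"
    using pos by (simp add: c0_def power_mult_distrib power2_eq_square eval_nat_numeral)
  finally show ?thesis by (rule power2_le_imp_le) (use pos in auto)
qed

section \<open>Type II sums\<close>

definition cell :: "nat \<Rightarrow> nat \<Rightarrow> nat \<Rightarrow> nat set" where
  "cell M A c = {m \<in> {M..<2 * M}. m div A = c}"

definition cells :: "nat \<Rightarrow> nat \<Rightarrow> nat set" where
  "cells M A = (\<lambda>m. m div A) ` {M..<2 * M}"

lemma finite_cell [simp]: "finite (cell M A c)" "finite (cells M A)"
  by (auto simp: cell_def cells_def)

lemma cell_diff:
  assumes "m \<in> cell M A c" "m' \<in> cell M A c" "A > 0"
  shows "\<bar>real m - real m'\<bar> \<le> real A"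
proof -
  have "m = A * c + m mod A" "m' = A * c + m' mod A"
    using assms div_mult_mod_eq[of m A] div_mult_mod_eq[of m' A] by (auto simp: cell_def mult.commute)
  moreover have "m mod A < A" "m' mod A < A" using assms by auto
  ultimately have "int m - int m' \<le> int A" "int m' - int m \<le> int A" by linarith+
  thus ?thesis by linarith
qed

lemma card_cells:
  assumes "0 < A" "A \<le> M"
  shows "real (card (cells M A)) \<le> 3 * real M / real A"
proof -
  have "cells M A \<subseteq> {M div A..(2 * M - 1) div A}" by (auto simp: cells_def intro!: div_le_mono)
  hence "card (cells M A) \<le> card {M div A..(2 * M - 1) div A}" by (intro card_mono) auto
  moreover have "M div A \<le> (2 * M - 1) div A" using assms by (intro div_le_mono) auto
  ultimately have "real (card (cells M A)) \<le> real ((2 * M - 1) div A) - real (M div A) + 1" by simp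
  also have "real ((2 * M - 1) div A) \<le> real (2 * M) / real A"
    by (rule order_trans[OF of_nat_div_le_of_nat]) (auto intro!: divide_right_mono)
  also have "real (M div A) \<ge> real M / real A - 1"
    using floor_divide_of_nat_eq[of M A, where ?'a = real] by linarith
  hence "real (2 * M) / real A - real (M div A) + 1 \<le> real (2 * M) / real A - real M / real A + 2" by simp
  also have "2 \<le> 2 * real M / real A" using assms by (simp add: field_simps)
  finally show ?thesis by simp
qed

lemma sum_cells:
  fixes f :: "nat \<Rightarrow> 'a :: comm_monoid_add"
  shows "(\<Sum>m\<in>{M..<2 * M}. f m) = (\<Sum>c\<in>cells M A. \<Sum>m\<in>cell M A c. f m)"
  unfolding cells_def cell_def by (rule sum.image_gen) auto

text \<open>For fixed m the products m n are spaced by m \<ge> M, while the window has half-width at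
  most 2 A D / M.\<close>

lemma near_count:
  assumes M: "0 < M" and m: "M \<le> m"
  shows "real (card {n \<in> len_set D M. \<bar>real m * real n - X\<bar> \<le> real A * real n}) \<le> 1 + 4 * real A * real D / (real M)\<^sup>2"
proof -
  have "{n \<in> len_set D M. \<bar>real m * real n - X\<bar> \<le> real A * real n} \<subseteq>
     {n \<in> len_set D M. \<bar>real m * real n - X\<bar> \<le> 2 * real A * real D / real M}"
  proof safe
    fix n assume n: "n \<in> len_set D M" "\<bar>real m * real n - X\<bar> \<le> real A * real n"
    have "real (M * n) \<le> real (2 * D)" using n(1) unfolding of_nat_le_iff len_set_def by simp
    hence "real n \<le> 2 * real D / real M" using M by (simp add: field_simps)
    hence "real A * real n \<le> real A * (2 * real D / real M)" by (intro mult_left_mono) auto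
    also have "\<dots> = 2 * real A * real D / real M" by simp
    finally show "\<bar>real m * real n - X\<bar> \<le> 2 * real A * real D / real M" using n(2) by linarith
  qed
  hence "card {n \<in> len_set D M. \<bar>real m * real n - X\<bar> \<le> real A * real n} \<le>
     card {n \<in> len_set D M. \<bar>real m * real n - X\<bar> \<le> 2 * real A * real D / real M}"
    using M by (intro card_mono) auto
  also have "real \<dots> \<le> 1 + 2 * (2 * real A * real D / real M) / real M"
  proof (rule card_gap_le)
    fix s t :: nat assume st: "s \<noteq> t"
    hence "1 \<le> \<bar>real s - real t\<bar>" by linarith
    hence "real M * 1 \<le> real m * \<bar>real s - real t\<bar>" using m by (intro mult_mono) auto
    also have "\<dots> = \<bar>real m * real s - real m * real t\<bar>" by (simp add: abs_mult flip: right_diff_distrib)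
    finally show "real M \<le> \<bar>real m * real s - real m * real t\<bar>" by simp
  qed (use M in auto)
  finally show ?thesis by (simp add: power2_eq_square)
qed

text \<open>The double difference carries both factors t and y1 - y2, so it is smaller by a factor
  of order 1/D than the difference 1/y1 - 1/y2 itself.\<close>

lemma phase_perturbation:
  fixes y1 y2 t D :: real
  assumes D: "D > 0" and y: "D \<le> 2 * y1" "D \<le> 2 * y2" and t: "0 \<le> t" "t \<le> 1"
  shows "\<bar>(1 / (y1 + t) - 1 / (y2 + t)) - (1 / y1 - 1 / y2)\<bar> \<le> 16 * \<bar>y1 - y2\<bar> / D ^ 3"
proof -
  have pos: "y1 > 0" "y2 > 0" using D y by auto
  have eq: "(1 / (y1 + t) - 1 / (y2 + t)) - (1 / y1 - 1 / y2) =
     t * ((y1 - y2) * (1 / ((y1 + t) * y2 * (y2 + t)) + 1 / (y1 * (y1 + t) * y2)))"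
    using pos t by (simp add: add_pos_nonneg add_nonneg_eq_0_iff divide_simps) (simp add: algebra_simps)
  have l: "1 / (a * b * c) \<le> 8 / D ^ 3" if "D \<le> 2 * a" "D \<le> 2 * b" "D \<le> 2 * c" for a b c
  proof -
    have "(D / 2) * (D / 2) * (D / 2) \<le> a * b * c" using that D by (intro mult_mono) auto
    hence "1 / (a * b * c) \<le> 1 / ((D / 2) * (D / 2) * (D / 2))" using D that by (intro divide_left_mono mult_pos_pos) auto
    thus ?thesis by (simp add: power3_eq_cube)
  qed
  have s: "1 / ((y1 + t) * y2 * (y2 + t)) + 1 / (y1 * (y1 + t) * y2) \<le> 16 / D ^ 3"
    using l[of "y1 + t" y2 "y2 + t"] l[of y1 "y1 + t" y2] y t by simp
  have s0: "0 \<le> 1 / ((y1 + t) * y2 * (y2 + t)) + 1 / (y1 * (y1 + t) * y2)" using pos t by simp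
  have "\<bar>(1 / (y1 + t) - 1 / (y2 + t)) - (1 / y1 - 1 / y2)\<bar> =
     t * (\<bar>y1 - y2\<bar> * (1 / ((y1 + t) * y2 * (y2 + t)) + 1 / (y1 * (y1 + t) * y2)))"
    unfolding eq using t s0 by (simp only: abs_mult abs_of_nonneg)
  also have "\<dots> \<le> 1 * (\<bar>y1 - y2\<bar> * (16 / D ^ 3))"
    using t s s0 by (intro mult_mono mult_left_mono mult_nonneg_nonneg) auto
  finally show ?thesis by (simp add: mult.commute)
qed

text \<open>Both the upper end \<open>D' h\<close> and the shift \<open>t h\<close> may depend on \<open>h\<close>: the mean value argument of
  \<open>exp_phase_difference\<close> gives no control over them.\<close>

definition typeII_sum :: "real \<Rightarrow> nat \<Rightarrow> nat \<Rightarrow> nat \<Rightarrow> (nat \<Rightarrow> nat) \<Rightarrow> (nat \<Rightarrow> real) \<Rightarrow> (nat \<Rightarrow> complex) \<Rightarrow> (nat \<Rightarrow> nat \<Rightarrow> complex) \<Rightarrow> complex" where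
  "typeII_sum x H D M D' t a b = (\<Sum>h\<in>{H..<2 * H}. \<Sum>n\<in>len_set D M. \<Sum>m\<in>{M..<2 * M}.
     if D < m * n \<and> m * n \<le> D' h then b h n * (a m * ee (real h * x / (real m * real n + t h))) else 0)"

text \<open>For most \<open>n\<close> the condition \<open>D < m * n \<and> m * n \<le> D' h\<close> is constant on a cell; the second summand
  accounts for the exceptional \<open>n\<close>.\<close>

lemma typeII_boundary:
  fixes a :: "nat \<Rightarrow> complex" and b :: "nat \<Rightarrow> nat \<Rightarrow> complex"
  assumes pos: "0 < M" "0 < A" and a: "\<And>m. norm (a m) \<le> 1" and b: "\<And>h n. norm (b h n) \<le> 1"
  shows "norm (typeII_sum x H D M D' t a b) \<le>
     (\<Sum>(h, n)\<in>{H..<2 * H} \<times> len_set D M. \<Sum>c\<in>cells M A. norm (\<Sum>m\<in>cell M A c. a m * ee (real h * x / (real m * real n + t h))))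
     + real H * real M * (2 + 8 * real A * real D / (real M)\<^sup>2)"
proof -
  define P where "P h n m \<longleftrightarrow> D < m * n \<and> m * n \<le> D' h" for h n m
  define N where "N X n m \<longleftrightarrow> \<bar>real m * real n - X\<bar> \<le> real A * real n" for X n m
  define z where "z h n m = a m * ee (real h * x / (real m * real n + t h))" for h n m
  have z: "norm (z h n m) \<le> 1" for h n m using a by (simp add: z_def norm_mult)
  define Nr where "Nr h n m \<longleftrightarrow> N (real D) n m \<or> N (real (D' h)) n m" for h n m
  \<comment> \<open>If the condition fails somewhere in the cell, each m of the cell that satisfies
    it has m n within A n of an end of the range, and is counted trivially.\<close>
  have cellwise: "norm (\<Sum>m\<in>cell M A c. if P h n m then z h n m else 0) \<le>
      norm (\<Sum>m\<in>cell M A c. z h n m) + (\<Sum>m\<in>cell M A c. if Nr h n m then 1 else 0)" for c h n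
  proof (cases "\<forall>m\<in>cell M A c. P h n m")
    case True
    hence "(\<Sum>m\<in>cell M A c. if P h n m then z h n m else 0) = (\<Sum>m\<in>cell M A c. z h n m)" by (intro sum.cong) auto
    thus ?thesis by (simp add: sum_nonneg)
  next
    case False
    then obtain m' where m': "m' \<in> cell M A c" "\<not> P h n m'" by blast
    have "norm (\<Sum>m\<in>cell M A c. if P h n m then z h n m else 0) \<le> (\<Sum>m\<in>cell M A c. if Nr h n m then 1 else 0)"
    proof (rule order_trans[OF norm_sum], rule sum_mono)
      fix m assume m: "m \<in> cell M A c"
      show "norm (if P h n m then z h n m else 0) \<le> (if Nr h n m then 1 else 0)"
      proof (cases "P h n m")
        case True
        have d: "\<bar>real m * real n - real m' * real n\<bar> \<le> real A * real n"
          using mult_right_mono[OF cell_diff[OF m m'(1) pos(2)], of "real n"]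
          by (simp add: abs_mult flip: left_diff_distrib)
        have "real D < real (m * n)" "real (m * n) \<le> real (D' h)"
          using True unfolding P_def of_nat_less_iff of_nat_le_iff by simp_all
        moreover have "real (m' * n) \<le> real D \<or> real (D' h) < real (m' * n)"
          using m'(2) unfolding P_def of_nat_less_iff of_nat_le_iff by (simp add: not_less not_le)
        ultimately have "Nr h n m" using d unfolding Nr_def N_def of_nat_mult by linarith
        with z show ?thesis by auto
      qed auto
    qed
    thus ?thesis by (simp add: add_increasing)
  qed
  have one: "norm (\<Sum>m\<in>{M..<2 * M}. if P h n m then b h n * z h n m else 0) \<le>
     (\<Sum>c\<in>cells M A. norm (\<Sum>m\<in>cell M A c. z h n m)) + (\<Sum>m\<in>{M..<2 * M}. if Nr h n m then 1 else 0)" for h n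
  proof -
    have "(\<Sum>m\<in>{M..<2 * M}. if P h n m then b h n * z h n m else 0) = b h n * (\<Sum>m\<in>{M..<2 * M}. if P h n m then z h n m else 0)"
      by (subst sum_distrib_left, rule sum.cong) simp_all
    also have "norm \<dots> \<le> 1 * norm (\<Sum>m\<in>{M..<2 * M}. if P h n m then z h n m else 0)"
      unfolding norm_mult using b by (intro mult_right_mono) auto
    also have "\<dots> = norm (\<Sum>c\<in>cells M A. \<Sum>m\<in>cell M A c. if P h n m then z h n m else 0)"
      by (subst sum_cells[of _ M A]) simp
    also have "\<dots> \<le> (\<Sum>c\<in>cells M A. norm (\<Sum>m\<in>cell M A c. z h n m) + (\<Sum>m\<in>cell M A c. if Nr h n m then 1 else 0))"
      by (rule order_trans[OF norm_sum], rule sum_mono, rule cellwise)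
    also have "\<dots> = (\<Sum>c\<in>cells M A. norm (\<Sum>m\<in>cell M A c. z h n m)) + (\<Sum>m\<in>{M..<2 * M}. if Nr h n m then 1 else 0)"
      unfolding sum.distrib sum_cells[of "\<lambda>m. if Nr h n m then 1 else 0" M A] ..
    finally show ?thesis .
  qed
  \<comment> \<open>The order of m and n is exchanged here: for each m only few n bring m n close to
    one of the two ends.\<close>
  have count: "(\<Sum>h\<in>{H..<2 * H}. \<Sum>n\<in>len_set D M. \<Sum>m\<in>{M..<2 * M}. if Nr h n m then 1 else (0::real)) \<le>
     real H * real M * (2 + 8 * real A * real D / (real M)\<^sup>2)"
  proof -
    have "(\<Sum>n\<in>len_set D M. if Nr h n m then 1 else (0::real)) \<le> 2 + 8 * real A * real D / (real M)\<^sup>2"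
      if m: "m \<in> {M..<2 * M}" for h m
    proof -
      have "(\<Sum>n\<in>len_set D M. if Nr h n m then 1 else (0::real)) \<le>
        (\<Sum>n\<in>len_set D M. (if N (real D) n m then 1 else 0) + (if N (real (D' h)) n m then 1 else 0))"
        by (intro sum_mono) (auto simp: Nr_def)
      also have "\<dots> = real (card {n\<in>len_set D M. N (real D) n m}) + real (card {n\<in>len_set D M. N (real (D' h)) n m})"
        using pos by (simp add: sum.distrib Int_def flip: sum.inter_filter)
      also have "\<dots> \<le> (1 + 4 * real A * real D / (real M)\<^sup>2) + (1 + 4 * real A * real D / (real M)\<^sup>2)"
        unfolding N_def using m pos by (intro add_mono near_count) auto
      finally show ?thesis by simp
    qed
    hence "(\<Sum>h\<in>{H..<2 * H}. \<Sum>m\<in>{M..<2 * M}. \<Sum>n\<in>len_set D M. if Nr h n m then 1 else (0::real)) \<le>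
      (\<Sum>h\<in>{H..<2 * H}. \<Sum>m\<in>{M..<2 * M}. 2 + 8 * real A * real D / (real M)\<^sup>2)"
      by (intro sum_mono)
    also have "\<dots> = real H * real M * (2 + 8 * real A * real D / (real M)\<^sup>2)" by simp
    also have "(\<Sum>h\<in>{H..<2 * H}. \<Sum>m\<in>{M..<2 * M}. \<Sum>n\<in>len_set D M. if Nr h n m then 1 else (0::real)) =
      (\<Sum>h\<in>{H..<2 * H}. \<Sum>n\<in>len_set D M. \<Sum>m\<in>{M..<2 * M}. if Nr h n m then 1 else (0::real))"
      by (intro sum.cong refl sum.swap)
    finally show ?thesis .
  qed
  have "norm (typeII_sum x H D M D' t a b) = norm (\<Sum>h\<in>{H..<2 * H}. \<Sum>n\<in>len_set D M. \<Sum>m\<in>{M..<2 * M}. if P h n m then b h n * z h n m else 0)"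
    unfolding typeII_sum_def P_def z_def ..
  also have "\<dots> \<le> (\<Sum>h\<in>{H..<2 * H}. \<Sum>n\<in>len_set D M. norm (\<Sum>m\<in>{M..<2 * M}. if P h n m then b h n * z h n m else 0))"
    by (intro order_trans[OF norm_sum] sum_mono order_refl)
  also have "\<dots> \<le> (\<Sum>h\<in>{H..<2 * H}. \<Sum>n\<in>len_set D M. (\<Sum>c\<in>cells M A. norm (\<Sum>m\<in>cell M A c. z h n m)) + (\<Sum>m\<in>{M..<2 * M}. if Nr h n m then 1 else 0))"
    by (intro sum_mono one)
  also have "\<dots> = (\<Sum>(h, n)\<in>{H..<2 * H} \<times> len_set D M. \<Sum>c\<in>cells M A. norm (\<Sum>m\<in>cell M A c. z h n m)) +
     (\<Sum>h\<in>{H..<2 * H}. \<Sum>n\<in>len_set D M. \<Sum>m\<in>{M..<2 * M}. if Nr h n m then 1 else (0::real))"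
    by (simp add: sum.distrib flip: sum.cartesian_product)
  finally show ?thesis using count unfolding z_def by linarith
qed

section \<open>Cauchy's inequality over the cells and the pairs it produces\<close>

lemma cauchy_cells:
  fixes f :: "'a \<Rightarrow> 'b \<Rightarrow> real"
  assumes "finite I"
  shows "(\<Sum>i\<in>I. \<Sum>c\<in>C. f i c)\<^sup>2 \<le> real (card I) * real (card C) * (\<Sum>i\<in>I. \<Sum>c\<in>C. (f i c)\<^sup>2)"
proof -
  have "(\<Sum>i\<in>I. \<Sum>c\<in>C. f i c)\<^sup>2 = (\<Sum>s\<in>I \<times> C. 1 * f (fst s) (snd s))\<^sup>2"
    by (simp add: sum.cartesian_product case_prod_beta)
  also have "\<dots> \<le> (\<Sum>s\<in>I \<times> C. 1\<^sup>2) * (\<Sum>s\<in>I \<times> C. (f (fst s) (snd s))\<^sup>2)"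
    by (rule Cauchy_Schwarz_ineq_sum)
  also have "\<dots> = real (card I) * real (card C) * (\<Sum>i\<in>I. \<Sum>c\<in>C. (f i c)\<^sup>2)"
    by (simp add: sum.cartesian_product case_prod_beta card_cartesian_product)
  finally show ?thesis .
qed

definition cell_pairs :: "nat \<Rightarrow> nat \<Rightarrow> (nat \<times> nat) set" where
  "cell_pairs M A = {(m, m'). m \<in> {M..<2 * M} \<and> m' \<in> {M..<2 * M} \<and> m div A = m' div A}"

lemma finite_cell_pairs [simp]: "finite (cell_pairs M A)"
  by (rule finite_subset[of _ "{M..<2 * M} \<times> {M..<2 * M}"]) (auto simp: cell_pairs_def)

lemma card_cell_pairs: "A > 0 \<Longrightarrow> card (cell_pairs M A) \<le> M * A"
proof -
  assume A: "A > 0"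
  have "cell_pairs M A \<subseteq> Sigma {M..<2 * M} (\<lambda>m. {m div A * A..<m div A * A + A})"
  proof safe
    fix m m' assume mm: "(m, m') \<in> cell_pairs M A"
    have "m' = m div A * A + m' mod A" using mm div_mult_mod_eq[of m' A] by (auto simp: cell_pairs_def)
    thus "m' \<in> {m div A * A..<m div A * A + A}" using A by (metis atLeastLessThan_iff le_add1 mod_less_divisor nat_add_left_cancel_less)
    show "m \<in> {M..<2 * M}" using mm by (auto simp: cell_pairs_def)
  qed
  hence "card (cell_pairs M A) \<le> card (Sigma {M..<2 * M} (\<lambda>m. {m div A * A..<m div A * A + A}))"
    by (intro card_mono) auto
  also have "\<dots> = M * A" by (subst card_SigmaI) auto
  finally show ?thesis .
qed

lemma sum_cell_norm2:
  "complex_of_real (\<Sum>c\<in>cells M A. (norm (\<Sum>m\<in>cell M A c. a m * ee (p m)))\<^sup>2) =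
    (\<Sum>(m, m')\<in>cell_pairs M A. (a m * cnj (a m')) * ee (p m - p m'))"
proof -
  have "complex_of_real (\<Sum>c\<in>cells M A. (norm (\<Sum>m\<in>cell M A c. a m * ee (p m)))\<^sup>2) =
    (\<Sum>c\<in>cells M A. \<Sum>m\<in>cell M A c. \<Sum>m'\<in>cell M A c. (a m * cnj (a m')) * ee (p m - p m'))"
    unfolding of_real_sum
    by (intro sum.cong refl, simp only: complex_norm_square cnj_sum sum_product complex_cnj_mult cnj_ee,
        intro sum.cong refl, simp add: ee_diff)
  also have "\<dots> = (\<Sum>c\<in>cells M A. \<Sum>m\<in>cell M A c. \<Sum>m'\<in>cell M A (m div A). (a m * cnj (a m')) * ee (p m - p m'))"
    by (intro sum.cong refl) (auto simp: cell_def)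
  also have "\<dots> = (\<Sum>m\<in>{M..<2 * M}. \<Sum>m'\<in>cell M A (m div A). (a m * cnj (a m')) * ee (p m - p m'))"
    by (rule sum_cells[symmetric])
  also have "\<dots> = (\<Sum>(m, m')\<in>Sigma {M..<2 * M} (\<lambda>m. cell M A (m div A)). (a m * cnj (a m')) * ee (p m - p m'))"
    by (intro sum.Sigma) auto
  also have "Sigma {M..<2 * M} (\<lambda>m. cell M A (m div A)) = cell_pairs M A"
    by (auto simp: cell_pairs_def cell_def)
  finally show ?thesis .
qed

text \<open>The pairs below the diagonal contribute the conjugate of those above it, and for the
  latter 0 < m' - m < A \<le> 2^L leaves L dyadic ranges.\<close>

lemma sum_cell_pairs_split:
  fixes w :: "nat \<Rightarrow> nat \<Rightarrow> complex"
  assumes A: "0 < A" "A \<le> 2 ^ L" and sym: "\<And>m m'. w m' m = cnj (w m m')"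
  shows "norm (\<Sum>(m, m')\<in>cell_pairs M A. w m m') \<le>
    norm (\<Sum>m\<in>{M..<2 * M}. w m m) + 2 * norm (\<Sum>i<L. \<Sum>p\<in>diff_pairs M A i. w (fst p) (snd p))"
proof -
  define Dg where "Dg = (\<lambda>m. (m, m)) ` {M..<2 * M}"
  define Up where "Up = {(m, m') \<in> cell_pairs M A. m < m'}"
  define Dn where "Dn = {(m, m') \<in> cell_pairs M A. m' < m}"
  have fin: "finite Dg" "finite Up" "finite Dn"
    by (auto simp: Dg_def Up_def Dn_def intro: finite_subset[OF _ finite_cell_pairs[of M A]])
  have un: "cell_pairs M A = Dg \<union> (Up \<union> Dn)"
  proof (intro equalityI subsetI)
    fix p assume p: "p \<in> cell_pairs M A"
    obtain m m' where mm: "p = (m, m')" by (cases p)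
    consider "m < m'" | "m = m'" | "m' < m" by linarith
    thus "p \<in> Dg \<union> (Up \<union> Dn)"
      by cases (use p in \<open>auto simp: mm Dg_def Up_def Dn_def cell_pairs_def\<close>)
  next
    fix p assume "p \<in> Dg \<union> (Up \<union> Dn)"
    thus "p \<in> cell_pairs M A" by (auto simp: Dg_def Up_def Dn_def cell_pairs_def)
  qed
  have "(\<Sum>(m, m')\<in>cell_pairs M A. w m m') = (\<Sum>(m, m')\<in>Dg. w m m') + (\<Sum>(m, m')\<in>Up \<union> Dn. w m m')"
    unfolding un by (rule sum.union_disjoint) (use fin in \<open>auto simp: Dg_def Up_def Dn_def\<close>)
  also have "(\<Sum>(m, m')\<in>Up \<union> Dn. w m m') = (\<Sum>(m, m')\<in>Up. w m m') + (\<Sum>(m, m')\<in>Dn. w m m')"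
    using fin by (intro sum.union_disjoint) (auto simp: Up_def Dn_def)
  also have "(\<Sum>(m, m')\<in>Dn. w m m') = (\<Sum>(m, m')\<in>Up. cnj (w m m'))"
    by (rule sum.reindex_bij_witness[of _ prod.swap prod.swap])
       (auto simp: Up_def Dn_def cell_pairs_def simp flip: sym)
  also have "\<dots> = cnj (\<Sum>(m, m')\<in>Up. w m m')" by (simp add: case_prod_beta)
  also have "(\<Sum>(m, m')\<in>Dg. w m m') = (\<Sum>m\<in>{M..<2 * M}. w m m)"
    unfolding Dg_def by (subst sum.reindex) (auto simp: inj_on_def)
  finally have eq: "(\<Sum>(m, m')\<in>cell_pairs M A. w m m') = (\<Sum>m\<in>{M..<2 * M}. w m m) +
     ((\<Sum>(m, m')\<in>Up. w m m') + cnj (\<Sum>(m, m')\<in>Up. w m m'))" .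
  have UpU: "Up = (\<Union>i<L. diff_pairs M A i)"
  proof (intro equalityI subsetI)
    fix p assume "p \<in> Up"
    then obtain m m' where p: "p = (m, m')" "(m, m') \<in> cell_pairs M A" "m < m'" by (auto simp: Up_def)
    have "m = m div A * A + m mod A" "m' = m div A * A + m' mod A"
      using p(2) div_mult_mod_eq[of m A] div_mult_mod_eq[of m' A] by (auto simp: cell_pairs_def)
    moreover have "m' mod A < A" using A by simp
    ultimately have lt: "m' - m < A" by linarith
    have "1 \<le> m' - m" using p(3) by linarith
    then obtain i where i: "2 ^ i \<le> m' - m" "m' - m < 2 ^ (i + 1)"
      using ex_power_ivl1[of 2 "m' - m"] by auto
    have "(2::nat) ^ i < 2 ^ L" using i(1) lt A by linarith
    hence "i < L" by (rule power_less_imp_less_exp[rotated]) auto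
    moreover have "p \<in> diff_pairs M A i" using p i by (auto simp: diff_pairs_def cell_pairs_def)
    ultimately show "p \<in> (\<Union>i<L. diff_pairs M A i)" by blast
  next
    fix p assume "p \<in> (\<Union>i<L. diff_pairs M A i)"
    thus "p \<in> Up" by (auto simp: Up_def diff_pairs_def cell_pairs_def)
  qed
  have disj: "diff_pairs M A i \<inter> diff_pairs M A j = {}" if "i \<noteq> j" for i j
  proof -
    have False if "i < j" "p \<in> diff_pairs M A i" "p \<in> diff_pairs M A j" for i j p
    proof -
      have "snd p - fst p < 2 * 2 ^ i" "2 ^ j \<le> snd p - fst p" using that by (auto simp: diff_pairs_def)
      moreover have "(2::nat) ^ Suc i \<le> 2 ^ j" using that by (intro power_increasing) auto
      ultimately show False by simp
    qed
    from this[of i j] this[of j i] that show ?thesis by (metis disjoint_iff linorder_neqE_nat)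
  qed
  have upeq: "(\<Sum>(m, m')\<in>Up. w m m') = (\<Sum>i<L. \<Sum>p\<in>diff_pairs M A i. w (fst p) (snd p))"
    unfolding UpU using disj by (subst sum.UNION_disjoint) (auto simp: case_prod_beta)
  have "norm (\<Sum>(m, m')\<in>cell_pairs M A. w m m') \<le> norm (\<Sum>m\<in>{M..<2 * M}. w m m) +
     (norm (\<Sum>(m, m')\<in>Up. w m m') + norm (cnj (\<Sum>(m, m')\<in>Up. w m m')))"
    unfolding eq by (intro order_trans[OF norm_triangle_ineq] add_left_mono norm_triangle_ineq)
  thus ?thesis unfolding complex_mod_cnj upeq by simp
qed


text \<open>Without the shift t the phase is the product of h/n and x/m - x/m', the bilinear shape
  that the double large sieve needs; this is the price of dropping t.\<close>

lemma cell_pairs_perturbation: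
  assumes pos: "0 < H" "0 < D" "0 < M" "0 < A" and x: "x > 0" and t: "0 \<le> t" "t \<le> 1"
    and h: "h < 2 * H" and n: "n \<in> len_set D M" and mm: "(m, m') \<in> cell_pairs M A"
  shows "\<bar>(real h * x / (real m * real n + t) - real h * x / (real m' * real n + t))
      - real h / real n * (x / real m - x / real m')\<bar> \<le> 64 * real H * x * real A / ((real D)\<^sup>2 * real M)"
proof -
  have m: "M \<le> m" "M \<le> m'" "m div A = m' div A" "m < 2 * M" "m' < 2 * M" using mm by (auto simp: cell_pairs_def)
  have nn: "D < 2 * M * n" "M * n \<le> 2 * D" using n by (auto simp: len_set_def)
  have n0: "n > 0" using nn by (auto intro!: Nat.gr0I)
  define y1 y2 where "y1 = real m * real n" and "y2 = real m' * real n"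
  have ge: "real D \<le> 2 * (real k * real n)" if "M \<le> k" for k
  proof -
    have "M * n \<le> k * n" using that by simp
    hence "D \<le> 2 * (k * n)" using nn(1) by linarith
    hence "real D \<le> real (2 * (k * n))" by (simp only: of_nat_le_iff)
    thus ?thesis by simp
  qed
  have n2: "real n \<le> 2 * real D / real M"
  proof -
    have "real (M * n) \<le> real (2 * D)" using nn(2) by (simp only: of_nat_le_iff)
    thus ?thesis using pos by (simp add: field_simps)
  qed
  have "\<bar>real m - real m'\<bar> \<le> real A"
    by (rule cell_diff[of m M A "m div A" m']) (use m pos in \<open>auto simp: cell_def\<close>)
  hence d: "\<bar>y1 - y2\<bar> \<le> real A * (2 * real D / real M)"
  proof -
    have "\<bar>y1 - y2\<bar> = \<bar>real m - real m'\<bar> * real n" unfolding y1_def y2_def by (simp add: abs_mult flip: left_diff_distrib)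
    also have "\<dots> \<le> real A * (2 * real D / real M)"
      using n2 \<open>\<bar>real m - real m'\<bar> \<le> real A\<close> by (intro mult_mono) auto
    finally show ?thesis .
  qed
  have "(real h * x / (y1 + t) - real h * x / (y2 + t)) - real h / real n * (x / real m - x / real m')
     = real h * x * ((1 / (y1 + t) - 1 / (y2 + t)) - (1 / y1 - 1 / y2))"
  proof -
    have "real h / real n * (x / real m - x / real m') = real h * x * (1 / y1 - 1 / y2)"
      by (simp add: y1_def y2_def right_diff_distrib mult_ac)
    thus ?thesis by (simp add: right_diff_distrib)
  qed
  hence "\<bar>(real h * x / (y1 + t) - real h * x / (y2 + t)) - real h / real n * (x / real m - x / real m')\<bar>
     = real h * x * \<bar>(1 / (y1 + t) - 1 / (y2 + t)) - (1 / y1 - 1 / y2)\<bar>"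
    using x by (simp add: abs_mult)
  also have "\<dots> \<le> (2 * real H * x) * (16 * (real A * (2 * real D / real M)) / real D ^ 3)"
  proof (rule mult_mono)
    have "real h \<le> real (2 * H)" using h by (simp only: of_nat_le_iff)
    thus "real h * x \<le> 2 * real H * x" using x by (intro mult_right_mono) auto
    have "\<bar>(1 / (y1 + t) - 1 / (y2 + t)) - (1 / y1 - 1 / y2)\<bar> \<le> 16 * \<bar>y1 - y2\<bar> / real D ^ 3"
      unfolding y1_def y2_def using pos m by (intro phase_perturbation t ge) auto
    also have "\<dots> \<le> 16 * (real A * (2 * real D / real M)) / real D ^ 3"
      using d by (intro divide_right_mono) auto
    finally show "\<bar>(1 / (y1 + t) - 1 / (y2 + t)) - (1 / y1 - 1 / y2)\<bar> \<le> 16 * (real A * (2 * real D / real M)) / real D ^ 3" .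
  qed (use x in auto)
  also have "\<dots> = 64 * real H * x * real A / ((real D)\<^sup>2 * real M)"
    using pos by (simp add: field_simps power2_eq_square power3_eq_cube)
  finally show ?thesis by (simp add: y1_def y2_def)
qed

text \<open>After Cauchy's inequality the diagonal contributes O(H D). By
  \<open>pair_bound_arith\<close> each dyadic off-diagonal range is no larger up to \<Gamma>, and
  neither is the error from removing the shifts. There are at most 3M/A cells, which yields the
  saving sqrt A.\<close>

lemma typeII_core:
  fixes x \<Gamma> :: real and a :: "nat \<Rightarrow> complex" and b :: "nat \<Rightarrow> nat \<Rightarrow> complex"
  assumes pos: "0 < H" "0 < D" "0 < M" "0 < A"
    and a: "\<And>m. norm (a m) \<le> 1" and b: "\<And>h n. norm (b h n) \<le> 1" and t: "\<And>h. 0 \<le> t h \<and> t h \<le> 1"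
    and AM: "A \<le> M" and MD: "M \<le> D" and Dx: "real D \<le> x" and c1: "(real A)\<^sup>2 \<le> 4 * real M"
    and c2: "real H * x * (real A)\<^sup>2 \<le> (real D)\<^sup>2 * real M"
    and c3: "x * real A ^ 5 \<le> (real M)\<^sup>2 * (real D)\<^sup>2" and c5: "real D * real A ^ 3 \<le> x * real M"
    and c6: "(real A)\<^sup>2 * real M \<le> 4 * real H * real D"
    and c7: "real D * real M * real A \<le> 4 * real H * x"
    and c8: "real A * (real M)\<^sup>2 \<le> 4 * (real D)\<^sup>2"
    and div: "\<And>k. 0 < k \<Longrightarrow> k \<le> 4 * H * D \<Longrightarrow> real (card {d. d dvd k}) \<le> \<Gamma>"
    and harm: "harm (4 * D) \<le> \<Gamma>" and L: "real L + 1 \<le> \<Gamma>" "100 * x * real H * real D \<le> 2 ^ L"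
  shows "norm (typeII_sum x H D M D' t a b) \<le> 316 * \<Gamma>\<^sup>2 * (real H * real D) / sqrt (real A)"
proof -
  define I where "I = {H..<2 * H} \<times> len_set D M"
  define ph where "ph = (\<lambda>(h, n) m. real h * x / (real m * real n + t h))"
  define w where "w = (\<lambda>m m'. a m * cnj (a m'))"
  define HD where "HD = real H * real D"
  define Q where "Q = (\<Sum>s\<in>I. \<Sum>c\<in>cells M A. (norm (\<Sum>m\<in>cell M A c. a m * ee (ph s m)))\<^sup>2)"
  define W where "W m m' = (\<Sum>(h, n)\<in>I. w m m' * ee (real h / real n * (x / real m - x / real m')))" for m m'
  have x: "x > 0" using Dx pos by linarith
  have \<Gamma>: "\<Gamma> \<ge> 1" using L by linarith
  have finI: "finite I" using pos by (simp add: I_def)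
  have w: "norm (w m m') \<le> 1" for m m'
    using mult_mono[OF a[of m] a[of m']] by (simp add: w_def norm_mult)
  have HD: "HD \<ge> 1" using mult_mono[of 1 "real H" 1 "real D"] pos by (simp add: HD_def Suc_leI)
  have cardI: "real (card I) \<le> 2 * HD / real M"
  proof -
    have "real (card I) = real H * real (card (len_set D M))" by (simp add: I_def card_cartesian_product)
    also have "\<dots> \<le> real H * (2 * real D / real M)" using pos by (intro mult_left_mono card_len_set) auto
    finally show ?thesis by (simp add: HD_def mult_ac)
  qed
  have diagW: "norm (\<Sum>m\<in>{M..<2 * M}. W m m) \<le> 2 * HD"
  proof -
    have "norm (\<Sum>m\<in>{M..<2 * M}. W m m) \<le> (\<Sum>m\<in>{M..<2 * M}. real (card I))"
    proof (rule order_trans[OF norm_sum], rule sum_mono)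
      fix m
      have "norm (W m m) \<le> (\<Sum>s\<in>I. 1)" unfolding W_def
        by (rule order_trans[OF norm_sum], rule sum_mono) (use w in \<open>auto simp: norm_mult\<close>)
      thus "norm (W m m) \<le> real (card I)" by simp
    qed
    also have "\<dots> = real M * real (card I)" by simp
    also have "\<dots> \<le> real M * (2 * HD / real M)" using cardI by (intro mult_left_mono) auto
    finally show ?thesis using pos by simp
  qed
  have KL: "16 * pi * x * 2 ^ i * real H / (real M * real D) + 1 \<le> 2 ^ L" if "2 ^ i \<le> M" for i
  proof -
    have xHD: "1 \<le> x * HD" using mult_mono[of 1 x 1 HD] HD Dx pos by (simp add: Suc_leI)
    have "real (2 ^ i) \<le> real M" using that by (simp only: of_nat_le_iff)
    hence "16 * pi * x * 2 ^ i * real H / (real M * real D) \<le> 16 * pi * x * real M * real H / (real M * real D)"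
      using x by (intro divide_right_mono mult_left_mono mult_right_mono) auto
    also have "\<dots> = 16 * pi * (x * real H / real D)" using pos by simp
    also have "\<dots> \<le> 64 * (x * real H * real D)"
    proof (intro mult_mono)
      have "x * real H / real D \<le> x * real H / 1" using pos x by (intro divide_left_mono) auto
      also have "\<dots> \<le> x * real H * real D" using pos x by (simp add: Suc_leI)
      finally show "x * real H / real D \<le> x * real H * real D" .
    qed (use pi_less_4 x in auto)
    finally show ?thesis using L(2) xHD by (simp add: HD_def mult_ac)
  qed
  have A_le: "A \<le> 2 ^ L"
  proof -
    have xH: "1 \<le> 100 * x * real H" using mult_mono[of 1 x 1 "real H"] pos Dx by (simp add: Suc_leI)
    have "real A \<le> 1 * real D" using AM MD by simp
    also have "\<dots> \<le> 100 * x * real H * real D" by (rule mult_right_mono[OF xH]) simp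
    finally have "real A \<le> 2 ^ L" using L(2) by linarith
    thus ?thesis by (metis of_nat_le_iff of_nat_numeral of_nat_power)
  qed
  have part: "norm (\<Sum>p\<in>diff_pairs M A i. W (fst p) (snd p)) \<le> 6000 * \<Gamma>\<^sup>2 * HD" for i
  proof (cases "diff_pairs M A i = {}")
    case True
    thus ?thesis using \<Gamma> HD by simp
  next
    case False
    then obtain m m' where mm: "(m, m') \<in> diff_pairs M A i" by auto
    have "m' div A = m div A" "2 ^ i \<le> m' - m" using mm by (simp_all add: diff_pairs_def)
    hence "m = m div A * A + m mod A" "m' = m div A * A + m' mod A"
      using div_mult_mod_eq[of m A] div_mult_mod_eq[of m' A] by simp_all
    moreover have "m' mod A < A" using pos by simp
    ultimately have "m' - m < A" by linarith
    hence iA: "2 ^ i \<le> A" using \<open>2 ^ i \<le> m' - m\<close> by linarith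
    have iM: "2 ^ i \<le> M" using iA AM by linarith
    have "(\<Sum>p\<in>diff_pairs M A i. W (fst p) (snd p)) = (\<Sum>(h, n)\<in>I. \<Sum>p\<in>diff_pairs M A i.
       (\<lambda>p. w (fst p) (snd p)) p * ee (real h / real n * (x / real (fst p) - x / real (snd p))))"
      unfolding W_def case_prod_beta by (rule sum.swap)
    also have "norm \<dots> \<le> 6000 * \<Gamma>\<^sup>2 * HD"
      unfolding HD_def I_def
    proof (rule pair_bound_arith[OF _ _ _ _ _ _ \<Gamma> _ _ Dx c1 c2 c3 c5 c6 c7 refl refl])
      show "(norm (\<Sum>(h, n)\<in>{H..<2 * H} \<times> len_set D M. \<Sum>p\<in>diff_pairs M A i.
         w (fst p) (snd p) * ee (real h / real n * (x / real (fst p) - x / real (snd p)))))\<^sup>2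
        \<le> (exp 1)\<^sup>2 * (2 * real H * real D / real M * (2 * ((real D)\<^sup>2 / (pi * x * 2 ^ i)) + 1) * \<Gamma> *
          (4 * (16 * pi * x * 2 ^ i * real H / (real M * real D) + 1) * (\<Gamma>\<^sup>2 * (18 * 2 ^ i * real M + 288 * (2 ^ i) ^ 4))
          + \<Gamma> * (\<Gamma>\<^sup>2 * 73728 * (2 ^ i)\<^sup>2 * (real M)\<^sup>2)))"
      proof (rule diff_pairs_sum_bound[OF x pos(1,2,3) iM _ div _ L(1) KL[OF iM] refl refl])
        have "harm (4 * M) \<le> (harm (4 * D) :: real)" using MD by (intro harm_mono) auto
        thus "harm (4 * M) \<le> \<Gamma>" using harm by linarith
      qed (use w in auto)
      have "real (2 ^ i) \<le> real A" using iA by (simp only: of_nat_le_iff)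
      thus "2 ^ i \<le> real A" by simp
    qed (use pos AM MD x in \<open>auto simp: Suc_leI\<close>)
    finally show ?thesis .
  qed
  have offW: "norm (\<Sum>i<L. \<Sum>p\<in>diff_pairs M A i. W (fst p) (snd p)) \<le> 6000 * \<Gamma> ^ 3 * HD"
  proof -
    have "norm (\<Sum>i<L. \<Sum>p\<in>diff_pairs M A i. W (fst p) (snd p)) \<le> (\<Sum>i<L. 6000 * \<Gamma>\<^sup>2 * HD)"
      by (rule order_trans[OF norm_sum], rule sum_mono, rule part)
    also have "\<dots> = real L * (6000 * \<Gamma>\<^sup>2 * HD)" by simp
    also have "\<dots> \<le> \<Gamma> * (6000 * \<Gamma>\<^sup>2 * HD)" using L(1) HD by (intro mult_right_mono) auto
    finally show ?thesis by (simp add: power2_eq_square power3_eq_cube)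
  qed
  have E2: "norm (\<Sum>(m, m')\<in>cell_pairs M A. W m m') \<le> 2 * HD + 2 * (6000 * \<Gamma> ^ 3 * HD)"
  proof -
    have e: "ee (u * (q - r)) = cnj (ee (u * (r - q)))" for u q r by (simp add: right_diff_distrib)
    have "W m' m = cnj (W m m')" for m m'
    proof -
      have "w m' m = cnj (w m m')" by (simp add: w_def)
      hence "w m' m * ee (u * (x / real m' - x / real m)) = cnj (w m m' * ee (u * (x / real m - x / real m')))" for u
        unfolding complex_cnj_mult e[of u "x / real m'"] by (rule arg_cong)
      thus ?thesis unfolding W_def case_prod_beta cnj_sum by (intro sum.cong refl) blast
    qed
    from sum_cell_pairs_split[of A L W M, OF pos(4) A_le this] diagW offW show ?thesis by linarith
  qed
  have Err: "norm ((\<Sum>s\<in>I. \<Sum>(m, m')\<in>cell_pairs M A. w m m' * ee (ph s m - ph s m')) - (\<Sum>(m, m')\<in>cell_pairs M A. W m m'))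
     \<le> 1024 * HD"
  proof -
    define \<delta> where "\<delta> = 64 * real H * x * real A / ((real D)\<^sup>2 * real M)"
    have "(\<Sum>(m, m')\<in>cell_pairs M A. W m m') = (\<Sum>s\<in>I. \<Sum>(m, m')\<in>cell_pairs M A. w m m' * ee (real (fst s) / real (snd s) * (x / real m - x / real m')))"
      unfolding W_def case_prod_beta by (rule sum.swap)
    hence "norm ((\<Sum>s\<in>I. \<Sum>(m, m')\<in>cell_pairs M A. w m m' * ee (ph s m - ph s m')) - (\<Sum>(m, m')\<in>cell_pairs M A. W m m')) =
      norm (\<Sum>s\<in>I. \<Sum>(m, m')\<in>cell_pairs M A. w m m' * (ee (ph s m - ph s m') - ee (real (fst s) / real (snd s) * (x / real m - x / real m'))))"
      by (simp only: case_prod_unfold right_diff_distrib[symmetric] sum_subtractf[symmetric])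
    also have "\<dots> \<le> (\<Sum>s\<in>I. \<Sum>p\<in>cell_pairs M A. 2 * pi * \<delta>)"
    proof (rule order_trans[OF norm_sum], rule sum_mono, rule order_trans[OF norm_sum], rule sum_mono)
      fix s p assume s: "s \<in> I" and p: "p \<in> cell_pairs M A"
      obtain h n where s': "s = (h, n)" by (cases s)
      obtain m m' where p': "p = (m, m')" by (cases p)
      have hn: "h < 2 * H" "n \<in> len_set D M" using s by (auto simp: s' I_def)
      have "norm (w m m') * norm (ee (ph s m - ph s m') - ee (real h / real n * (x / real m - x / real m')))
         \<le> 1 * (2 * pi * \<bar>(ph s m - ph s m') - real h / real n * (x / real m - x / real m')\<bar>)"
        by (intro mult_mono w norm_ee_diff_le) auto
      also have "\<dots> \<le> 1 * (2 * pi * \<delta>)"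
        unfolding \<delta>_def ph_def s' prod.case using t p
        by (intro mult_left_mono cell_pairs_perturbation pos x hn) (auto simp: p')
      finally show "norm (case p of (m, m') \<Rightarrow> w m m' * (ee (ph s m - ph s m') - ee (real (fst s) / real (snd s) * (x / real m - x / real m')))) \<le> 2 * pi * \<delta>"
        by (simp add: p' s' norm_mult)
    qed
    also have "\<dots> = (2 * pi * \<delta>) * (real (card I) * real (card (cell_pairs M A)))" by simp
    also have "\<dots> \<le> (8 * \<delta>) * ((2 * HD / real M) * (real M * real A))"
    proof (intro mult_mono cardI)
      have "real (card (cell_pairs M A)) \<le> real (M * A)" using card_cell_pairs[OF pos(4)] by (simp only: of_nat_le_iff)
      thus "real (card (cell_pairs M A)) \<le> real M * real A" by simp
    qed (use pi_less_4 x HD in \<open>auto simp: \<delta>_def\<close>)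
    \<comment> \<open>\<open>c2\<close> is what keeps the phase error, summed over all (h, n) and
      all pairs in cells, within the size of the diagonal.\<close>
    also have "\<dots> = 1024 * HD * (real H * x * (real A)\<^sup>2 / ((real D)\<^sup>2 * real M))"
      using pos by (simp add: \<delta>_def power2_eq_square)
    also have "\<dots> \<le> 1024 * HD * 1"
      using c2 pos HD by (intro mult_left_mono) (auto simp: divide_le_eq)
    finally show ?thesis by simp
  qed
  have Q: "Q \<le> 13026 * \<Gamma> ^ 3 * HD"
  proof -
    have "complex_of_real Q = (\<Sum>s\<in>I. \<Sum>(m, m')\<in>cell_pairs M A. w m m' * ee (ph s m - ph s m'))"
      unfolding Q_def of_real_sum[of _ I] sum_cell_norm2 w_def ..
    hence "\<bar>Q\<bar> = norm (\<Sum>s\<in>I. \<Sum>(m, m')\<in>cell_pairs M A. w m m' * ee (ph s m - ph s m'))"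
      by (metis norm_of_real)
    also have "\<dots> \<le> norm (\<Sum>(m, m')\<in>cell_pairs M A. W m m') + 1024 * HD"
      using Err norm_triangle_sub[of "\<Sum>s\<in>I. \<Sum>(m, m')\<in>cell_pairs M A. w m m' * ee (ph s m - ph s m')"
        "\<Sum>(m, m')\<in>cell_pairs M A. W m m'"] by linarith
    finally have "Q \<le> 1026 * HD + 12000 * (\<Gamma> ^ 3 * HD)" using E2 by linarith
    moreover have "1 * HD \<le> \<Gamma> ^ 3 * HD" using \<Gamma> HD by (intro mult_right_mono) auto
    ultimately show ?thesis by linarith
  qed
  have Q0: "Q \<ge> 0" unfolding Q_def by (intro sum_nonneg) auto
  define S1 where "S1 = (\<Sum>s\<in>I. \<Sum>c\<in>cells M A. norm (\<Sum>m\<in>cell M A c. a m * ee (ph s m)))"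
  have "S1\<^sup>2 \<le> real (card I) * real (card (cells M A)) * Q"
    unfolding S1_def Q_def by (rule cauchy_cells[OF finI])
  also have "\<dots> \<le> (2 * HD / real M) * (3 * real M / real A) * (13026 * \<Gamma> ^ 3 * HD)"
    using HD Q0 by (intro mult_mono cardI card_cells Q AM pos) auto
  also have "\<dots> = 78156 * \<Gamma> ^ 3 * HD\<^sup>2 / real A" using pos by (simp add: power2_eq_square)
  also have "\<dots> \<le> (280 * \<Gamma>\<^sup>2 * HD / sqrt (real A))\<^sup>2"
  proof -
    have "\<Gamma> ^ 3 \<le> \<Gamma> ^ 4" using \<Gamma> by (intro power_increasing) auto
    hence "78156 * \<Gamma> ^ 3 * HD\<^sup>2 / real A \<le> 78400 * \<Gamma> ^ 4 * HD\<^sup>2 / real A"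
      using \<Gamma> by (intro divide_right_mono mult_right_mono mult_mono) auto
    also have "\<dots> = (280 * \<Gamma>\<^sup>2 * HD / sqrt (real A))\<^sup>2" by (simp add: power_divide power_mult_distrib)
    finally show ?thesis .
  qed
  finally have S1: "S1 \<le> 280 * \<Gamma>\<^sup>2 * HD / sqrt (real A)"
    by (rule power2_le_imp_le) (use \<Gamma> HD in auto)
  have sA: "sqrt (real A) > 0" "sqrt (real A) * sqrt (real A) = real A" using pos by auto
  have b1: "real H * real M * (2 + 8 * real A * real D / (real M)\<^sup>2) = 2 * (real H * real M) + 8 * (HD * (real A / real M))"
    using pos by (simp add: HD_def field_simps power2_eq_square)
  \<comment> \<open>The boundary terms must not exceed H D / sqrt A: \<open>c8\<close> takes care of
    H M, and \<open>c1\<close> in the next step of H D A / M.\<close>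
  have b2: "real H * real M \<le> real H * (2 * real D / sqrt (real A))"
  proof (intro mult_left_mono)
    have "(sqrt (real A) * real M)\<^sup>2 \<le> (2 * real D)\<^sup>2" using c8 by (simp add: power_mult_distrib)
    hence "sqrt (real A) * real M \<le> 2 * real D" by (rule power2_le_imp_le) auto
    thus "real M \<le> 2 * real D / sqrt (real A)" using sA by (simp add: field_simps)
  qed auto
  have b3: "real A / real M \<le> 4 / sqrt (real A)"
  proof -
    have "real A * sqrt (real A) \<le> real A * real A"
    proof (rule mult_left_mono)
      have "sqrt (real A) \<le> sqrt ((real A)\<^sup>2)" using pos by (intro real_sqrt_le_mono) (auto simp: power2_eq_square)
      thus "sqrt (real A) \<le> real A" by simp
    qed auto
    also have "\<dots> \<le> 4 * real M" using c1 by (simp add: power2_eq_square)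
    finally show ?thesis using sA pos by (simp add: field_simps)
  qed
  have bd: "real H * real M * (2 + 8 * real A * real D / (real M)\<^sup>2) \<le> 36 * HD / sqrt (real A)"
  proof -
    have "HD * (real A / real M) \<le> HD * (4 / sqrt (real A))" using b3 HD by (intro mult_left_mono) auto
    hence "real H * real M * (2 + 8 * real A * real D / (real M)\<^sup>2) \<le>
      2 * (real H * (2 * real D / sqrt (real A))) + 8 * (HD * (4 / sqrt (real A)))"
      using b1 b2 by linarith
    also have "\<dots> = 36 * HD / sqrt (real A)" unfolding HD_def by (simp add: field_simps)
    finally show ?thesis .
  qed
  have "36 * HD / sqrt (real A) \<le> 36 * \<Gamma>\<^sup>2 * HD / sqrt (real A)"
    using \<Gamma> HD sA by (intro divide_right_mono mult_right_mono) auto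
  moreover have "norm (typeII_sum x H D M D' t a b) \<le> S1 + real H * real M * (2 + 8 * real A * real D / (real M)\<^sup>2)"
    using typeII_boundary[OF pos(3,4) a b] unfolding S1_def I_def ph_def by (simp add: case_prod_beta)
  ultimately have "norm (typeII_sum x H D M D' t a b) \<le> 280 * \<Gamma>\<^sup>2 * HD / sqrt (real A) + 36 * \<Gamma>\<^sup>2 * HD / sqrt (real A)"
    using S1 bd by linarith
  also have "\<dots> = 316 * \<Gamma>\<^sup>2 * (real H * real D) / sqrt (real A)" by (simp add: HD_def add_divide_distrib[symmetric])
  finally show ?thesis .
qed

section \<open>Type I sums\<close>

lemma abel_antimono:
  fixes z :: "nat \<Rightarrow> complex" and w :: "nat \<Rightarrow> real"
  assumes w: "\<And>k. a \<le> k \<Longrightarrow> Suc k < b \<Longrightarrow> w (Suc k) \<le> w k" "\<And>k. a \<le> k \<Longrightarrow> k < b \<Longrightarrow> w k \<ge> 0"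
    and B: "\<And>r. a \<le> r \<Longrightarrow> r \<le> b \<Longrightarrow> norm (\<Sum>k\<in>{a..<r}. z k) \<le> B"
    and ab: "a < b"
  shows "norm (\<Sum>k\<in>{a..<b}. of_real (w k) * z k) \<le> w a * B"
proof -
  have main: "norm ((\<Sum>k\<in>{a..<Suc r}. of_real (w k) * z k) - of_real (w r) * (\<Sum>k\<in>{a..<Suc r}. z k)) \<le> (w a - w r) * B"
    if "a \<le> r" "r < b" for r
    using that
  proof (induction r rule: dec_induct)
    case base
    show ?case by simp
  next
    case (step r)
    define S where "S = (\<Sum>k\<in>{a..<Suc r}. z k)"
    have "(\<Sum>k\<in>{a..<Suc (Suc r)}. of_real (w k) * z k) - of_real (w (Suc r)) * (\<Sum>k\<in>{a..<Suc (Suc r)}. z k) =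
      ((\<Sum>k\<in>{a..<Suc r}. of_real (w k) * z k) - of_real (w r) * S) + of_real (w r - w (Suc r)) * S"
      using step by (simp add: S_def sum.atLeastLessThan_Suc algebra_simps)
    also have "norm \<dots> \<le> (w a - w r) * B + (w r - w (Suc r)) * B"
    proof (rule order_trans[OF norm_triangle_ineq], rule add_mono)
      show "norm ((\<Sum>k\<in>{a..<Suc r}. of_real (w k) * z k) - of_real (w r) * S) \<le> (w a - w r) * B"
        unfolding S_def using step by simp
      have "w (Suc r) \<le> w r" using w(1)[of r] step by simp
      moreover have "norm S \<le> B" unfolding S_def using step by (intro B) auto
      ultimately show "norm (of_real (w r - w (Suc r)) * S) \<le> (w r - w (Suc r)) * B"
        unfolding norm_mult norm_of_real by (simp add: mult_left_mono)
    qed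
    also have "\<dots> = (w a - w (Suc r)) * B" by (simp add: algebra_simps)
    finally show ?case .
  qed
  define r where "r = b - 1"
  have r: "a \<le> r" "r < b" "Suc r = b" using ab by (auto simp: r_def)
  have "norm (of_real (w r) * (\<Sum>k\<in>{a..<b}. z k)) \<le> w r * B"
    unfolding norm_mult norm_of_real using w(2)[of r] B[of b] r by (intro mult_mono) auto
  hence "norm (\<Sum>k\<in>{a..<b}. of_real (w k) * z k) \<le> (w a - w r) * B + w r * B"
    using main[OF r(1,2)] norm_triangle_sub[of "\<Sum>k\<in>{a..<b}. of_real (w k) * z k" "of_real (w r) * (\<Sum>k\<in>{a..<b}. z k)"]
    unfolding r(3) by linarith
  thus ?thesis by (simp add: algebra_simps)
qed

text \<open>Serves the increasing weight ln of the type I sums: the complementary weights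
  \<open>W - w k\<close> fall under the preceding lemma.\<close>

lemma abel_mono:
  fixes z :: "nat \<Rightarrow> complex" and w :: "nat \<Rightarrow> real"
  assumes w: "\<And>k. a \<le> k \<Longrightarrow> Suc k < b \<Longrightarrow> w k \<le> w (Suc k)" "\<And>k. a \<le> k \<Longrightarrow> k < b \<Longrightarrow> 0 \<le> w k \<and> w k \<le> W"
    and B: "\<And>r. a \<le> r \<Longrightarrow> r \<le> b \<Longrightarrow> norm (\<Sum>k\<in>{a..<r}. z k) \<le> B"
    and W: "0 \<le> W" "0 \<le> B"
  shows "norm (\<Sum>k\<in>{a..<b}. of_real (w k) * z k) \<le> 2 * W * B"
proof (cases "a < b")
  case True
  have "norm (\<Sum>k\<in>{a..<b}. of_real (W - w k) * z k) \<le> (W - w a) * B"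
    by (rule abel_antimono) (use w B True in auto)
  also have "\<dots> \<le> W * B" using w(2)[of a] True W by (intro mult_right_mono) auto
  finally have 1: "norm (\<Sum>k\<in>{a..<b}. of_real (W - w k) * z k) \<le> W * B" .
  have 2: "norm (of_real W * (\<Sum>k\<in>{a..<b}. z k)) \<le> W * B"
    unfolding norm_mult norm_of_real using W B[of b] True by (intro mult_mono) auto
  have "(\<Sum>k\<in>{a..<b}. of_real (w k) * z k) = of_real W * (\<Sum>k\<in>{a..<b}. z k) - (\<Sum>k\<in>{a..<b}. of_real (W - w k) * z k)"
    by (simp add: sum_distrib_left left_diff_distrib flip: sum_subtractf)
  with norm_triangle_ineq4[of "of_real W * (\<Sum>k\<in>{a..<b}. z k)" "\<Sum>k\<in>{a..<b}. of_real (W - w k) * z k"] 1 2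
  show ?thesis by simp
next
  case False
  thus ?thesis using W by simp
qed

text \<open>All denominators m k + t that occur lie between D and 4D, so the second differences of
  the phase vary at most by the factor 64.\<close>

lemma typeI_inner:
  fixes X t :: real
  assumes X: "X > 0" and m: "0 < m" "m \<le> D" and t: "0 \<le> t" "t \<le> 1" and small: "X * (real m)\<^sup>2 \<le> 8 * (real D)\<^sup>2 * real D"
    and pq: "D < m * p" "m * q \<le> 2 * D + m"
  shows "norm (\<Sum>k\<in>{p..<q}. ee (X / (real m * real k + t))) \<le> 114 * sqrt (X / real D) + 57 * real D * sqrt (real D / X) / real m"
proof -
  \<comment> \<open>The lower bound 2 X m^2 / (4D)^3 for the second differences;
    \<open>small\<close> makes it at most 1/4.\<close>
  define l where "l = X * (real m)\<^sup>2 / (32 * (real D)\<^sup>2 * real D)"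
  have D: "D > 0" using m by simp
  have l: "0 < l" "l \<le> 1 / 4" using X m D small by (auto simp: l_def divide_le_eq mult_ac)
  have sd: "X / (y + 2 * m') - 2 * (X / (y + m')) + X / y = 2 * X * m'\<^sup>2 / (y * (y + m') * (y + 2 * m'))"
    if "y > 0" "m' > 0" for y m' :: real
    using that by (simp add: divide_simps) (simp add: power2_eq_square algebra_simps)
  have "norm (\<Sum>k\<in>{p..<q}. ee (X / (real m * real k + t))) \<le> (64 * l * real (q - p) + 2) * (5 / sqrt l)"
  proof (rule van_der_corput_second_derivative[OF l])
    fix n assume n: "p \<le> n" "Suc n < q"
    define y where "y = real m * real n + t"
    have "D < m * n" using pq(1) n(1) by (meson less_le_trans mult_le_mono2)
    hence "real D < real (m * n)" by (simp only: of_nat_less_iff)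
    hence y: "real D \<le> y" using t by (simp add: y_def)
    have "m * (n + 2) \<le> m * q" using n by (intro mult_le_mono2) auto
    hence "m * (n + 2) \<le> 3 * D" using pq m by linarith
    hence "real (m * (n + 2)) \<le> real (3 * D)" by (simp only: of_nat_le_iff)
    hence y2: "y + 2 * real m \<le> 4 * real D" using t D by (simp add: y_def algebra_simps)
    have eq: "X / (real m * real (Suc (Suc n)) + t) - 2 * (X / (real m * real (Suc n) + t)) + X / (real m * real n + t)
      = 2 * X * (real m)\<^sup>2 / (y * (y + real m) * (y + 2 * real m))"
      using sd[of y "real m"] y D m by (simp add: y_def algebra_simps)
    have dpos: "0 < y * (y + real m) * (y + 2 * real m)" using y D by auto
    have up: "y * (y + real m) * (y + 2 * real m) \<le> (4 * real D) * (4 * real D) * (4 * real D)"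
      using y y2 D m by (intro mult_mono) auto
    have lo: "real D * real D * real D \<le> y * (y + real m) * (y + 2 * real m)"
      using y D m by (intro mult_mono) auto
    have "l = 2 * X * (real m)\<^sup>2 / ((4 * real D) * (4 * real D) * (4 * real D))"
      by (simp add: l_def power2_eq_square)
    also have "\<dots> \<le> 2 * X * (real m)\<^sup>2 / (y * (y + real m) * (y + 2 * real m))"
      using up dpos X D by (intro divide_left_mono) auto
    finally have 1: "l \<le> \<dots>" .
    have "2 * X * (real m)\<^sup>2 / (y * (y + real m) * (y + 2 * real m)) \<le> 2 * X * (real m)\<^sup>2 / (real D * real D * real D)"
      using lo dpos X D by (intro divide_left_mono) auto
    also have "\<dots> = 64 * l" by (simp add: l_def power2_eq_square)
    finally show "l \<le> X / (real m * real (Suc (Suc n)) + t) - 2 * (X / (real m * real (Suc n) + t)) + X / (real m * real n + t) \<and>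
       X / (real m * real (Suc (Suc n)) + t) - 2 * (X / (real m * real (Suc n) + t)) + X / (real m * real n + t) \<le> 64 * l"
      using 1 unfolding eq by simp
  qed auto
  also have "\<dots> \<le> (64 * l * (2 * real D / real m) + 2) * (5 / sqrt l)"
  proof (intro mult_right_mono add_right_mono mult_left_mono)
    show "real (q - p) \<le> 2 * real D / real m"
    proof (cases "p \<le> q")
      case True
      have "m * (q - p) \<le> D + m" using pq by (simp add: right_diff_distrib')
      hence "m * (q - p) \<le> 2 * D" using m by linarith
      hence "real (m * (q - p)) \<le> real (2 * D)" by (simp only: of_nat_le_iff)
      thus ?thesis using m by (simp add: field_simps)
    qed auto
  qed (use l in auto)
  also have "\<dots> = 640 * (real D / real m) * (l / sqrt l) + 10 / sqrt l" by (simp add: algebra_simps)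
  also have "l / sqrt l = sqrt l" using l by (simp add: real_div_sqrt)
  finally have main: "norm (\<Sum>k\<in>{p..<q}. ee (X / (real m * real k + t))) \<le> 640 * (real D / real m) * sqrt l + 10 / sqrt l" .
  have sl: "sqrt l = real m * sqrt (X / real D) / (sqrt 32 * real D)"
  proof -
    have "l = (real m / real D)\<^sup>2 * (X / real D) / 32" using D by (simp add: l_def power2_eq_square mult_ac)
    hence "sqrt l = (real m / real D) * sqrt (X / real D) / sqrt 32"
      by (simp add: real_sqrt_mult real_sqrt_divide)
    thus ?thesis by simp
  qed
  have s32: "5.65 \<le> sqrt 32" by (rule real_le_rsqrt) (simp add: power2_eq_square)
  have s32': "sqrt 32 \<le> 5.7" by (rule real_le_lsqrt) (simp_all add: power2_eq_square)
  have "640 * (real D / real m) * (real m * sqrt (X / real D) / (sqrt 32 * real D)) = (640 / sqrt 32) * sqrt (X / real D)"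
    using D m by simp
  also have "\<dots> \<le> 114 * sqrt (X / real D)"
  proof (rule mult_right_mono)
    have "640 / sqrt 32 \<le> 640 / 5.65" using s32 by (intro divide_left_mono) auto
    thus "640 / sqrt 32 \<le> 114" by simp
  qed (use X in auto)
  finally have 1: "640 * (real D / real m) * (real m * sqrt (X / real D) / (sqrt 32 * real D)) \<le> 114 * sqrt (X / real D)" .
  have "10 / (real m * sqrt (X / real D) / (sqrt 32 * real D)) = 10 * sqrt 32 * (real D * sqrt (real D / X) / real m)"
    using X D m by (simp add: real_sqrt_divide field_simps)
  also have "\<dots> \<le> 57 * (real D * sqrt (real D / X) / real m)"
    using s32' X by (intro mult_right_mono) auto
  finally have 2: "10 / (real m * sqrt (X / real D) / (sqrt 32 * real D)) \<le> 57 * real D * sqrt (real D / X) / real m" by simp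
  show ?thesis using main 1 2 unfolding sl by linarith
qed


lemma sum_prod_range_slices:
  fixes f :: "nat \<Rightarrow> nat \<Rightarrow> 'a :: comm_monoid_add"
  shows "(\<Sum>(m, k)\<in>prod_range D D'. f m k) = (\<Sum>m\<in>{1..D'}. \<Sum>k\<in>{D div m + 1..<D' div m + 1}. f m k)"
proof -
  have "prod_range D D' = Sigma {1..D'} (\<lambda>m. {D div m + 1..<D' div m + 1})"
  proof (intro equalityI subsetI)
    fix p assume p: "p \<in> prod_range D D'"
    obtain m k where mk: "p = (m, k)" by (cases p)
    have "m \<in> {1..D'}" using p prod_range_subset[of D D'] by (auto simp: mk)
    moreover have "D div m < k" "k \<le> D' div m" using p calculation
      by (auto simp: mk prod_range_def div_less_iff_less_mult less_eq_div_iff_mult_less_eq mult.commute)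
    ultimately show "p \<in> Sigma {1..D'} (\<lambda>m. {D div m + 1..<D' div m + 1})" by (auto simp: mk)
  next
    fix p assume p: "p \<in> Sigma {1..D'} (\<lambda>m. {D div m + 1..<D' div m + 1})"
    then obtain m k where mk: "p = (m, k)" "m \<in> {1..D'}" "D div m < k" "k \<le> D' div m" by auto
    thus "p \<in> prod_range D D'"
      by (auto simp: prod_range_def div_less_iff_less_mult less_eq_div_iff_mult_less_eq mult.commute)
  qed
  thus ?thesis by (simp only:) (rule sum.Sigma[symmetric], auto)
qed

text \<open>For each m the variable k runs through an interval. Abel summation removes the weight,
  and the part of the inner bound with 1/m sums to a harmonic number.\<close>

lemma typeI_sum:
  fixes X t W :: real and c :: "nat \<Rightarrow> complex" and w :: "nat \<Rightarrow> real"
  assumes X: "X > 0" and U: "0 < U" "U \<le> D" and D': "D' \<le> 2 * D" and t: "0 \<le> t" "t \<le> 1"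
    and small: "X * (real U)\<^sup>2 \<le> 8 * (real D)\<^sup>2 * real D"
    and c: "\<And>m. 0 < m \<Longrightarrow> m \<le> U \<Longrightarrow> norm (c m) \<le> 1"
    and w: "\<And>k. 0 < k \<Longrightarrow> k \<le> 2 * D \<Longrightarrow> w k \<le> w (Suc k) \<and> 0 \<le> w k \<and> w k \<le> W" and W: "W \<ge> 0"
  shows "norm (\<Sum>(m, k)\<in>prod_range D D'. (if m \<le> U then c m else 0) * (of_real (w k) * ee (X / (real m * real k + t))))
    \<le> 2 * W * (114 * real U * sqrt (X / real D) + 57 * real D * sqrt (real D / X) * harm U)"
proof -
  define B where "B m = 114 * sqrt (X / real D) + 57 * real D * sqrt (real D / X) / real m" for m :: nat
  define z where "z m k = of_real (w k) * ee (X / (real m * real k + t))" for m k :: nat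
  have B0: "B m \<ge> 0" for m using X by (simp add: B_def)
  have inner: "norm (\<Sum>k\<in>{D div m + 1..<D' div m + 1}. z m k) \<le> 2 * W * B m" if m: "0 < m" "m \<le> U" for m
    unfolding z_def
  proof (rule abel_mono[OF _ _ _ W B0])
    fix r assume r: "D div m + 1 \<le> r" "r \<le> D' div m + 1"
    show "norm (\<Sum>k\<in>{D div m + 1..<r}. ee (X / (real m * real k + t))) \<le> B m"
      unfolding B_def
    proof (rule typeI_inner[OF X m(1) _ t])
      have "X * (real m)\<^sup>2 \<le> X * (real U)\<^sup>2" using m X by (intro mult_left_mono power_mono) auto
      thus "X * (real m)\<^sup>2 \<le> 8 * (real D)\<^sup>2 * real D" using small by linarith
      show "D < m * (D div m + 1)" using m dividend_less_div_times[of m D] by (simp add: algebra_simps)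
      have "m * r \<le> m * (D' div m + 1)" using r by (intro mult_le_mono2)
      also have "\<dots> \<le> D' + m" by simp
      finally show "m * r \<le> 2 * D + m" using D' by linarith
    qed (use m U in auto)
  next
    fix k assume k: "D div m + 1 \<le> k" "k < D' div m + 1"
    hence "0 < k" "k \<le> 2 * D" using D' div_le_dividend[of D' m] by linarith+
    thus "0 \<le> w k \<and> w k \<le> W" using w[of k] by simp
  next
    fix k assume k: "D div m + 1 \<le> k" "Suc k < D' div m + 1"
    hence "0 < k" "k \<le> 2 * D" using D' div_le_dividend[of D' m] by linarith+
    thus "w k \<le> w (Suc k)" using w[of k] by simp
  qed
  have "norm (\<Sum>(m, k)\<in>prod_range D D'. (if m \<le> U then c m else 0) * z m k) =
    norm (\<Sum>m\<in>{1..D'}. (if m \<le> U then c m else 0) * (\<Sum>k\<in>{D div m + 1..<D' div m + 1}. z m k))"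
    by (simp only: sum_prod_range_slices sum_distrib_left)
  also have "\<dots> \<le> (\<Sum>m\<in>{1..D'}. if m \<le> U then 2 * W * B m else 0)"
  proof (rule order_trans[OF norm_sum], rule sum_mono)
    fix m assume "m \<in> {1..D'}"
    thus "norm ((if m \<le> U then c m else 0) * (\<Sum>k\<in>{D div m + 1..<D' div m + 1}. z m k)) \<le> (if m \<le> U then 2 * W * B m else 0)"
      using mult_mono[OF c[of m] inner[of m]] by (auto simp: norm_mult)
  qed
  also have "\<dots> \<le> (\<Sum>m\<in>{1..U}. 2 * W * B m)"
    by (subst sum.inter_filter[symmetric]) (use W B0 in \<open>auto intro!: sum_mono2\<close>)
  also have "\<dots> = 2 * W * (114 * real U * sqrt (X / real D) + 57 * real D * sqrt (real D / X) * harm U)"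
    unfolding sum_distrib_left[symmetric]
    by (simp add: B_def sum.distrib harm_def sum_distrib_left divide_inverse)
  finally show ?thesis unfolding z_def .
qed

section \<open>Exponential sums over primes\<close>

text \<open>\<open>s\<close> is the saving over the trivial bound \<open>H * D\<close>, \<open>U\<close> the cutting point in Vaughan's identity, and \<open>\<Gamma>\<close>
  absorbs divisor functions and logarithms. \<open>P1\<close> to \<open>P8\<close> are the hypotheses of \<open>typeII_core\<close> for cells of
  length $\lceil s^2 \rceil$ and all \<open>M\<close> between $\sqrt{D}/2$ and $2D/U$; \<open>T1\<close> and \<open>T2\<close> serve the type I sums.\<close>

locale exp_sum_params =
  fixes x s \<Gamma> :: real and H D U L :: nat
  assumes pos: "1 \<le> H" "64 \<le> D" "2 \<le> U" "1 \<le> s" and Dx: "real D \<le> x"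
    and P1: "4 * s ^ 8 \<le> real D" and P2: "64 * (real H)\<^sup>2 * x\<^sup>2 * s ^ 8 \<le> real D ^ 5"
    and P3: "128 * x * s ^ 10 \<le> real D ^ 3" and P4: "256 * s ^ 12 * real D \<le> x\<^sup>2"
    and P5: "2 * s ^ 4 \<le> real H * real U" and P6: "(real D)\<^sup>2 * s\<^sup>2 \<le> real H * x * real U"
    and P7: "2 * s\<^sup>2 \<le> (real U)\<^sup>2" and P8: "real U ^ 3 \<le> real D"
    and T1: "(real U)\<^sup>2 * s\<^sup>2 * real H * x \<le> real D ^ 3" and T2: "s\<^sup>2 * real D \<le> real H * x"
    and div: "\<And>k. 0 < k \<Longrightarrow> k \<le> 4 * H * D \<Longrightarrow> real (card {d. d dvd k}) \<le> \<Gamma>"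
    and harm: "harm (4 * D) \<le> \<Gamma>" "ln (2 * real D) \<le> \<Gamma>" and L: "real L + 1 \<le> \<Gamma>" "100 * x * real H * real D \<le> 2 ^ L"
begin

lemma Gamma_ge_1: "\<Gamma> \<ge> 1" using L by linarith

lemma x_pos: "x > 0" using Dx pos by linarith

lemma typeII_dyadic:
  fixes a :: "nat \<Rightarrow> complex" and b :: "nat \<Rightarrow> nat \<Rightarrow> complex"
  assumes M: "0 < M" "D \<le> 4 * M\<^sup>2" "M * U \<le> 2 * D"
    and a: "\<And>m. norm (a m) \<le> 1" and b: "\<And>h n. norm (b h n) \<le> 1" and t: "\<And>h. 0 \<le> t h \<and> t h \<le> 1"
  shows "norm (typeII_sum x H D M D' t a b) \<le> 316 * \<Gamma>\<^sup>2 * (real H * real D) / s"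
proof -
  \<comment> \<open>Rounding up keeps s^2 \<le> A \<le> 2 s^2: the lower bound gives the saving, the
    upper one the size conditions on A.\<close>
  define A where "A = nat \<lceil>s\<^sup>2\<rceil>"
  have s1: "s\<^sup>2 \<ge> 1" using pos(4) by simp
  have A: "s\<^sup>2 \<le> real A" "real A \<le> 2 * s\<^sup>2" "A > 0"
  proof -
    have "real A = of_int \<lceil>s\<^sup>2\<rceil>" using s1 by (simp add: A_def)
    thus "s\<^sup>2 \<le> real A" "real A \<le> 2 * s\<^sup>2" using s1 by linarith+
    thus "A > 0" using s1 by (intro Nat.gr0I) auto
  qed
  have xp: "x > 0" by (rule x_pos)
  have Mr: "real D \<le> 4 * (real M)\<^sup>2" "real M * real U \<le> 2 * real D"
  proof -
    have "real D \<le> real (4 * M\<^sup>2)" using M(2) by (simp only: of_nat_le_iff)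
    thus "real D \<le> 4 * (real M)\<^sup>2" by simp
    have "real (M * U) \<le> real (2 * D)" using M(3) by (simp only: of_nat_le_iff)
    thus "real M * real U \<le> 2 * real D" by simp
  qed
  have Ap: "real A ^ k \<le> (2 * s\<^sup>2) ^ k" for k using A by (intro power_mono) auto
  have M4: "4 \<le> real M"
  proof (rule power2_le_imp_le)
    show "4\<^sup>2 \<le> (real M)\<^sup>2" using Mr(1) pos(2) by simp
  qed auto
  have s4: "s ^ 4 \<le> real M"
  proof (rule power2_le_imp_le)
    have "(s ^ 4)\<^sup>2 = s ^ 8" by simp
    also have "\<dots> \<le> (real M)\<^sup>2" using P1 Mr(1) by simp
    finally show "(s ^ 4)\<^sup>2 \<le> (real M)\<^sup>2" .
  qed auto
  have c1: "(real A)\<^sup>2 \<le> 4 * real M"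
  proof -
    have "(real A)\<^sup>2 \<le> (2 * s\<^sup>2)\<^sup>2" by (rule Ap)
    also have "\<dots> = 4 * s ^ 4" by (simp add: power_mult_distrib)
    finally show ?thesis using s4 by simp
  qed
  have AM: "A \<le> M"
  proof -
    have "4 * real M \<le> real M * real M" by (rule mult_right_mono[OF M4]) simp
    hence "(real A)\<^sup>2 \<le> real M * real M" using c1 by linarith
    hence "(real A)\<^sup>2 \<le> (real M)\<^sup>2" by (simp only: power2_eq_square)
    hence "real A \<le> real M" by (rule power2_le_imp_le) auto
    thus ?thesis by simp
  qed
  have MD: "M \<le> D"
  proof -
    have "M * 2 \<le> M * U" using pos(3) by (intro mult_left_mono) auto
    thus ?thesis using M(3) by linarith
  qed
  have c2: "real H * x * (real A)\<^sup>2 \<le> (real D)\<^sup>2 * real M"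
  proof -
    have "(8 * real H * x * s ^ 4)\<^sup>2 = 64 * (real H)\<^sup>2 * x\<^sup>2 * s ^ 8" by (simp add: power_mult_distrib)
    also have "\<dots> \<le> real D ^ 5" by (rule P2)
    also have "\<dots> = (real D)\<^sup>2 * (real D)\<^sup>2 * real D" by (simp add: eval_nat_numeral)
    also have "\<dots> \<le> (real D)\<^sup>2 * (real D)\<^sup>2 * (4 * (real M)\<^sup>2)" using Mr(1) by (intro mult_left_mono) auto
    also have "\<dots> = (2 * (real D)\<^sup>2 * real M)\<^sup>2" by (simp add: power_mult_distrib power2_eq_square)
    finally have "8 * real H * x * s ^ 4 \<le> 2 * (real D)\<^sup>2 * real M" by (rule power2_le_imp_le) auto
    hence q: "4 * (real H * x * s ^ 4) \<le> (real D)\<^sup>2 * real M" by linarith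
    have "real H * x * (real A)\<^sup>2 \<le> real H * x * (2 * s\<^sup>2)\<^sup>2" using Ap[of 2] xp by (intro mult_left_mono) auto
    also have "\<dots> = 4 * (real H * x * s ^ 4)" by (simp add: power_mult_distrib)
    finally show ?thesis using q by linarith
  qed
  have c3: "x * real A ^ 5 \<le> (real M)\<^sup>2 * (real D)\<^sup>2"
  proof -
    have "x * real A ^ 5 \<le> x * (2 * s\<^sup>2) ^ 5" using Ap[of 5] xp by (intro mult_left_mono) auto
    also have "\<dots> = 32 * x * s ^ 10" by (simp add: power_mult_distrib flip: power_mult)
    also have "\<dots> \<le> real D ^ 3 / 4" using P3 by simp
    also have "\<dots> = (real D)\<^sup>2 * (real D / 4)" by (simp add: eval_nat_numeral)
    also have "\<dots> \<le> (real D)\<^sup>2 * (real M)\<^sup>2" using Mr(1) by (intro mult_left_mono) auto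
    finally show ?thesis by (simp add: mult.commute)
  qed
  have c5: "real D * real A ^ 3 \<le> x * real M"
  proof -
    have "real D * real A ^ 3 \<le> real D * (2 * s\<^sup>2) ^ 3" using Ap[of 3] by (intro mult_left_mono) auto
    also have "\<dots> = 8 * s ^ 6 * real D" by (simp add: power_mult_distrib flip: power_mult)
    also have "\<dots> \<le> x * real M"
    proof (rule power2_le_imp_le)
      have "(8 * s ^ 6 * real D)\<^sup>2 = (256 * s ^ 12 * real D) * (real D / 4)"
        by (simp add: power_mult_distrib power2_eq_square flip: power_mult power_add)
      also have "\<dots> \<le> x\<^sup>2 * (real M)\<^sup>2" using P4 Mr(1) by (intro mult_mono) auto
      finally show "(8 * s ^ 6 * real D)\<^sup>2 \<le> (x * real M)\<^sup>2" by (simp add: power_mult_distrib)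
    qed (use xp in auto)
    finally show ?thesis .
  qed
  have c6: "(real A)\<^sup>2 * real M \<le> 4 * real H * real D"
  proof -
    have "(real A)\<^sup>2 * real M \<le> (2 * s\<^sup>2)\<^sup>2 * real M" using Ap[of 2] by (intro mult_right_mono) auto
    also have "\<dots> = 2 * (2 * s ^ 4) * real M" by (simp add: power_mult_distrib)
    also have "\<dots> \<le> 2 * (real H * real U) * real M" using P5 by (intro mult_right_mono mult_left_mono) auto
    also have "\<dots> = 2 * real H * (real M * real U)" by simp
    also have "\<dots> \<le> 2 * real H * (2 * real D)" using Mr(2) by (intro mult_left_mono) auto
    finally show ?thesis by simp
  qed
  have c7: "real D * real M * real A \<le> 4 * real H * x"
  proof -
    have "real U * (real D * real M * real A) = real D * (real M * real U) * real A" by simp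
    also have "\<dots> \<le> real D * (2 * real D) * (2 * s\<^sup>2)" by (rule mult_mono, rule mult_left_mono[OF Mr(2)]) (use A(2) in auto)
    also have "\<dots> = 4 * ((real D)\<^sup>2 * s\<^sup>2)" by (simp add: power2_eq_square)
    also have "\<dots> \<le> real U * (4 * real H * x)" using P6 by (simp add: mult_ac)
    finally show ?thesis using pos(3) by simp
  qed
  have c8: "real A * (real M)\<^sup>2 \<le> 4 * (real D)\<^sup>2"
  proof -
    have "real A \<le> (real U)\<^sup>2" using A(2) P7 by linarith
    hence "real A * (real M)\<^sup>2 \<le> (real U)\<^sup>2 * (real M)\<^sup>2" by (rule mult_right_mono) simp
    also have "\<dots> = (real M * real U)\<^sup>2" by (simp add: power_mult_distrib)
    also have "\<dots> \<le> (2 * real D)\<^sup>2" using Mr(2) by (intro power_mono) auto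
    finally show ?thesis by (simp add: power_mult_distrib)
  qed
  have "norm (typeII_sum x H D M D' t a b) \<le> 316 * \<Gamma>\<^sup>2 * (real H * real D) / sqrt (real A)"
    by (rule typeII_core[OF _ _ M(1) A(3) a b t AM MD Dx c1 c2 c3 c5 c6 c7 c8 div harm(1) L]) (use pos in auto)
  also have "\<dots> \<le> 316 * \<Gamma>\<^sup>2 * (real H * real D) / s"
  proof (rule divide_left_mono)
    show "s \<le> sqrt (real A)" using A(1) pos(4) by (intro real_le_rsqrt)
  qed (use pos A in auto)
  finally show ?thesis .
qed

text \<open>In a dyadic block [M, 2M) with a nonzero term, D < m m forces D \<le> 4 M^2, and U < n
  forces M U \<le> 2D. So \<open>typeII_dyadic\<close> applies to every block that matters, and L
  blocks suffice.\<close>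

lemma typeII_half:
  fixes a :: "nat \<Rightarrow> complex" and b :: "nat \<Rightarrow> nat \<Rightarrow> complex"
  assumes a: "\<And>m. norm (a m) \<le> 1" and b: "\<And>h n. norm (b h n) \<le> 1" and t: "\<And>h. 0 \<le> t h \<and> t h \<le> 1"
    and D': "\<And>h. D' h \<le> 2 * D"
  shows "norm (\<Sum>h\<in>{H..<2 * H}. \<Sum>(m, n)\<in>prod_range D (D' h). if D < m * m \<and> U < n
      then b h n * (a m * ee (real h * x / (real m * real n + t h))) else 0) \<le> 316 * \<Gamma> ^ 3 * (real H * real D) / s"
proof -
  \<comment> \<open>Cutting off the coefficients expresses both restrictions inside
    \<open>typeII_sum\<close>, which itself carries neither.\<close>
  define a' where "a' m = (if D < m * m then a m else 0)" for m
  define b' where "b' h n = (if U < n then b h n else 0)" for h n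
  define z where "z h m n = b' h n * (a' m * ee (real h * x / (real m * real n + t h)))" for h m n
  have DL: "2 * D < 2 ^ L"
  proof -
    have "1 * 1 \<le> x * real H" using Dx pos by (intro mult_mono) auto
    hence "100 * 1 * real D \<le> 100 * (x * real H) * real D" by (intro mult_right_mono mult_left_mono) auto
    moreover have "100 * (x * real H) * real D = 100 * x * real H * real D" by simp
    ultimately have "100 * real D \<le> 2 ^ L" using L(2) by linarith
    hence "2 * real D < 2 ^ L" using pos(2) by linarith
    hence "real (2 * D) < real (2 ^ L)" by simp
    thus ?thesis by (simp only: of_nat_less_iff)
  qed
  have slice: "(\<Sum>(m, n)\<in>prod_range D (D' h). z h m n) =
    (\<Sum>i<L. \<Sum>n\<in>len_set D (2 ^ i). \<Sum>m\<in>{2 ^ i..<2 * 2 ^ i}. if D < m * n \<and> m * n \<le> D' h then z h m n else 0)" for h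
  proof -
    define R where "R i = {(m, n) \<in> prod_range D (D' h). m \<in> {2 ^ i..<2 * 2 ^ i}}" for i :: nat
    have un: "prod_range D (D' h) = (\<Union>i<L. R i)"
    proof (intro equalityI subsetI)
      fix p assume p: "p \<in> prod_range D (D' h)"
      obtain m n where mn: "p = (m, n)" by (cases p)
      have m: "1 \<le> m" "m \<le> D' h" using p prod_range_subset[of D "D' h"] by (auto simp: mn)
      then obtain i where i: "2 ^ i \<le> m" "m < 2 ^ (i + 1)" using ex_power_ivl1[of 2 m] by auto
      have "(2::nat) ^ i < 2 ^ L" using i(1) m(2) D'[of h] DL by linarith
      hence "i < L" by (rule power_less_imp_less_exp[rotated]) auto
      thus "p \<in> (\<Union>i<L. R i)" using i p by (auto simp: R_def mn)
    qed (auto simp: R_def)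
    have disj: "R i \<inter> R j = {}" if "i \<noteq> j" for i j
    proof -
      have False if "i < j" "p \<in> R i" "p \<in> R j" for i j p
      proof -
        have "fst p < 2 * 2 ^ i" "2 ^ j \<le> fst p" using that by (auto simp: R_def)
        moreover have "(2::nat) ^ Suc i \<le> 2 ^ j" using that by (intro power_increasing) auto
        ultimately show False by simp
      qed
      from this[of i j] this[of j i] that show ?thesis by (metis disjoint_iff linorder_neqE_nat)
    qed
    have "(\<Sum>(m, n)\<in>prod_range D (D' h). z h m n) = (\<Sum>i<L. \<Sum>(m, n)\<in>R i. z h m n)"
      unfolding un using disj
      by (intro sum.UNION_disjoint) (auto simp: R_def intro: finite_subset[OF _ finite_prod_range])
    also have "\<dots> = (\<Sum>i<L. \<Sum>n\<in>len_set D (2 ^ i). \<Sum>m\<in>{2 ^ i..<2 * 2 ^ i}. if D < m * n \<and> m * n \<le> D' h then z h m n else 0)"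
    proof (rule sum.cong[OF refl])
      fix i
      have "(\<Sum>n\<in>len_set D (2 ^ i). \<Sum>m\<in>{2 ^ i..<2 * 2 ^ i}. if D < m * n \<and> m * n \<le> D' h then z h m n else 0) =
         (\<Sum>(n, m)\<in>len_set D (2 ^ i) \<times> {2 ^ i..<2 * 2 ^ i}. if D < m * n \<and> m * n \<le> D' h then z h m n else 0)"
        by (rule sum.cartesian_product)
      also have "\<dots> = (\<Sum>(n, m) | (n, m) \<in> len_set D (2 ^ i) \<times> {2 ^ i..<2 * 2 ^ i} \<and> D < m * n \<and> m * n \<le> D' h. z h m n)"
        by (rule sum.mono_neutral_cong_right) (auto split: if_splits)
      also have "\<dots> = (\<Sum>(m, n)\<in>R i. z h m n)"
      proof (rule sum.reindex_bij_witness[of _ prod.swap prod.swap])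
        fix p assume "p \<in> R i"
        then obtain m n where mn: "p = (m, n)" "D < m * n" "m * n \<le> D' h" "2 ^ i \<le> m" "m < 2 * 2 ^ i"
          by (auto simp: R_def prod_range_def)
        have "m * n \<le> 2 * 2 ^ i * n" "2 ^ i * n \<le> m * n" using mn by (auto intro!: mult_right_mono)
        hence "n \<in> len_set D (2 ^ i)" using mn D'[of h] unfolding len_set_def by (simp only: mem_Collect_eq) linarith
        thus "prod.swap p \<in> {(n, m). (n, m) \<in> len_set D (2 ^ i) \<times> {2 ^ i..<2 * 2 ^ i} \<and> D < m * n \<and> m * n \<le> D' h}"
          using mn by simp
      qed (auto simp: R_def prod_range_def)
      finally show "(\<Sum>(m, n)\<in>R i. z h m n) = (\<Sum>n\<in>len_set D (2 ^ i). \<Sum>m\<in>{2 ^ i..<2 * 2 ^ i}. if D < m * n \<and> m * n \<le> D' h then z h m n else 0)" ..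
    qed
    finally show ?thesis .
  qed
  have "(\<Sum>h\<in>{H..<2 * H}. \<Sum>(m, n)\<in>prod_range D (D' h). if D < m * m \<and> U < n
      then b h n * (a m * ee (real h * x / (real m * real n + t h))) else 0) = (\<Sum>h\<in>{H..<2 * H}. \<Sum>(m, n)\<in>prod_range D (D' h). z h m n)"
    by (intro sum.cong refl) (auto simp: z_def a'_def b'_def)
  also have "\<dots> = (\<Sum>i<L. typeII_sum x H D (2 ^ i) D' t a' b')"
    unfolding typeII_sum_def z_def[symmetric] slice by (rule sum.swap)
  also have "norm \<dots> \<le> (\<Sum>i<L. 316 * \<Gamma>\<^sup>2 * (real H * real D) / s)"
  proof (rule order_trans[OF norm_sum], rule sum_mono)
    fix i :: nat
    define M :: nat where "M = 2 ^ i"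
    show "norm (typeII_sum x H D (2 ^ i) D' t a' b') \<le> 316 * \<Gamma>\<^sup>2 * (real H * real D) / s"
    proof (cases "D \<le> 4 * M\<^sup>2 \<and> M * U \<le> 2 * D")
      case True
      show ?thesis unfolding M_def[symmetric]
      proof (rule typeII_dyadic)
        show "norm (a' m) \<le> 1" for m using a by (simp add: a'_def)
        show "norm (b' h n) \<le> 1" for h n using b by (simp add: b'_def)
      qed (use True t in \<open>auto simp: M_def\<close>)
    next
      case False
      have "b' h n * (a' m * ee (real h * x / (real m * real n + t h))) = 0" if m: "m \<in> {M..<2 * M}" and n: "n \<in> len_set D M" for h m n
      proof (cases "D \<le> 4 * M\<^sup>2")
        case True
        hence "2 * D < M * U" using False by simp
        moreover have "M * n \<le> 2 * D" using n by (simp add: len_set_def)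
        ultimately have "M * n < M * U" by linarith
        hence "\<not> U < n" by auto
        thus ?thesis by (simp add: b'_def)
      next
        case False
        have "m * m \<le> (2 * M) * (2 * M)" using m by (intro mult_mono) auto
        also have "\<dots> = 4 * M\<^sup>2" by (simp add: power2_eq_square)
        finally have "\<not> D < m * m" using False by linarith
        thus ?thesis by (simp add: a'_def)
      qed
      hence "typeII_sum x H D M D' t a' b' = 0"
        unfolding typeII_sum_def by (intro sum.neutral ballI) simp
      thus ?thesis unfolding M_def[symmetric] using pos by simp
    qed
  qed
  also have "\<dots> = real L * (316 * \<Gamma>\<^sup>2 * (real H * real D) / s)" by simp
  also have "\<dots> \<le> \<Gamma> * (316 * \<Gamma>\<^sup>2 * (real H * real D) / s)" using L(1) pos by (intro mult_right_mono) auto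
  also have "\<dots> = 316 * \<Gamma> ^ 3 * (real H * real D) / s" by (simp add: power2_eq_square power3_eq_cube)
  finally show ?thesis .
qed

text \<open>Of two factors with m n > D at least one has square above D. The terms with m m > D go
  to \<open>typeII_half\<close> directly, the others with m and n exchanged. The absolute values are
  absorbed into coefficients that may depend on h.\<close>

lemma typeII_full:
  fixes \<alpha> \<beta> :: "nat \<Rightarrow> complex"
  assumes \<alpha>: "\<And>m. norm (\<alpha> m) \<le> 1" and \<beta>: "\<And>n. norm (\<beta> n) \<le> 1" and t: "\<And>h. 0 \<le> t h \<and> t h \<le> 1"
    and D': "\<And>h. D' h \<le> 2 * D"
  shows "(\<Sum>h\<in>{H..<2 * H}. norm (\<Sum>(m, n)\<in>prod_range D (D' h). (if U < m \<and> U < n then \<alpha> m * \<beta> n else 0)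
      * ee (real h * x / (real m * real n + t h)))) \<le> 632 * \<Gamma> ^ 3 * (real H * real D) / s"
proof -
  define z where "z h = (\<Sum>(m, n)\<in>prod_range D (D' h). (if U < m \<and> U < n then \<alpha> m * \<beta> n else 0)
      * ee (real h * x / (real m * real n + t h)))" for h
  \<comment> \<open>The conjugate of the sign of \<open>z h\<close>, so that
    \<open>c h * z h\<close> is the norm; it is 0 where \<open>z h\<close> is 0.\<close>
  define c where "c h = cnj (sgn (z h))" for h
  have c: "norm (c h) \<le> 1" for h by (simp add: c_def norm_sgn)
  have cz: "of_real (norm (z h)) = c h * z h" for h
    by (cases "z h = 0") (simp_all add: c_def sgn_eq complex_norm_square[symmetric] power2_eq_square mult.commute[of "cnj _"])
  define S1 where "S1 = (\<Sum>h\<in>{H..<2 * H}. \<Sum>(m, n)\<in>prod_range D (D' h). if D < m * m \<and> U < n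
      then (c h * \<beta> n) * ((if U < m then \<alpha> m else 0) * ee (real h * x / (real m * real n + t h))) else 0)"
  \<comment> \<open>The cut \<open>m * m \<le> D\<close> keeps the terms of \<open>S1\<close> from
    being counted twice.\<close>
  define S2 where "S2 = (\<Sum>h\<in>{H..<2 * H}. \<Sum>(n, m)\<in>prod_range D (D' h). if D < n * n \<and> U < m
      then (c h * (if m * m \<le> D then \<alpha> m else 0)) * ((if U < n then \<beta> n else 0) * ee (real h * x / (real n * real m + t h))) else 0)"
  have cb: "norm (u * v) \<le> 1" if "norm u \<le> 1" "norm v \<le> 1" for u v :: complex
    using mult_mono[OF that] by (simp add: norm_mult)
  have S1: "norm S1 \<le> 316 * \<Gamma> ^ 3 * (real H * real D) / s"
    unfolding S1_def by (rule typeII_half) (use \<alpha> \<beta> c t D' in \<open>auto intro: cb\<close>)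
  have S2: "norm S2 \<le> 316 * \<Gamma> ^ 3 * (real H * real D) / s"
    unfolding S2_def by (rule typeII_half) (use \<alpha> \<beta> c t D' in \<open>auto intro: cb\<close>)
  have "of_real (\<Sum>h\<in>{H..<2 * H}. norm (z h)) = (\<Sum>h\<in>{H..<2 * H}. c h * z h)"
    by (simp add: cz)
  also have "\<dots> = S1 + S2"
  proof -
    have S2': "S2 = (\<Sum>h\<in>{H..<2 * H}. \<Sum>(m, n)\<in>prod_range D (D' h). if D < n * n \<and> U < m
      then (c h * (if m * m \<le> D then \<alpha> m else 0)) * ((if U < n then \<beta> n else 0) * ee (real h * x / (real m * real n + t h))) else 0)"
      unfolding S2_def
      by (intro sum.cong refl sum.reindex_bij_witness[of _ prod.swap prod.swap])
         (auto simp: prod_range_def mult.commute)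
    show ?thesis unfolding S1_def S2' sum.distrib[symmetric] z_def sum_distrib_left
    proof (intro sum.cong refl)
      fix h p assume p: "p \<in> prod_range D (D' h)"
      obtain m n where mn: "p = (m, n)" by (cases p)
      have "D < n * n" if "m * m \<le> D"
      proof -
        have "D < m * n" using p by (simp add: mn prod_range_def)
        hence "m * m < m * n" using that by linarith
        hence "m < n" by simp
        hence "m * n \<le> n * n" by (intro mult_right_mono) auto
        thus ?thesis using \<open>D < m * n\<close> by linarith
      qed
      thus "c h * (case p of (m, n) \<Rightarrow> (if U < m \<and> U < n then \<alpha> m * \<beta> n else 0) * ee (real h * x / (real m * real n + t h))) =
        (case p of (m, n) \<Rightarrow> if D < m * m \<and> U < n
          then (c h * \<beta> n) * ((if U < m then \<alpha> m else 0) * ee (real h * x / (real m * real n + t h))) else 0) +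
        (case p of (m, n) \<Rightarrow> if D < n * n \<and> U < m
          then (c h * (if m * m \<le> D then \<alpha> m else 0)) * ((if U < n then \<beta> n else 0) * ee (real h * x / (real m * real n + t h))) else 0)"
        unfolding mn prod.case by (cases "m * m \<le> D") (auto simp: mult_ac)
    qed
  qed
  finally have "norm (complex_of_real (\<Sum>h\<in>{H..<2 * H}. norm (z h))) \<le> norm S1 + norm S2"
    using norm_triangle_ineq[of S1 S2] by (simp only:)
  hence "(\<Sum>h\<in>{H..<2 * H}. norm (z h)) \<le> norm S1 + norm S2" by (simp only: norm_of_real abs_of_nonneg sum_nonneg norm_ge_zero)
  also have "\<dots> \<le> 316 * \<Gamma> ^ 3 * (real H * real D) / s + 316 * \<Gamma> ^ 3 * (real H * real D) / s" by (intro add_mono S1 S2)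
  also have "\<dots> = 632 * \<Gamma> ^ 3 * (real H * real D) / s" by (simp add: add_divide_distrib[symmetric])
  finally show ?thesis unfolding z_def .
qed

text \<open>\<open>T1\<close> and \<open>T2\<close> match the two terms of van der Corput's bound:
  the first makes U sqrt(h x / D) of order at most D / s, the second makes sqrt(D / (h x)) at most 1
  / s.\<close>

lemma typeI_bound:
  fixes c :: "nat \<Rightarrow> complex" and w :: "nat \<Rightarrow> real"
  assumes c: "\<And>m. 0 < m \<Longrightarrow> m \<le> U \<Longrightarrow> norm (c m) \<le> 1" and t: "\<And>h. 0 \<le> t h \<and> t h \<le> 1"
    and w: "\<And>k. 0 < k \<Longrightarrow> k \<le> 2 * D \<Longrightarrow> w k \<le> w (Suc k) \<and> 0 \<le> w k \<and> w k \<le> \<Gamma>"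
    and D': "\<And>h. D' h \<le> 2 * D"
  shows "(\<Sum>h\<in>{H..<2 * H}. norm (\<Sum>(m, k)\<in>prod_range D (D' h). (if m \<le> U then c m else 0) *
      (of_real (w k) * ee (real h * x / (real m * real k + t h))))) \<le> 456 * \<Gamma>\<^sup>2 * (real H * real D) / s"
proof -
  have x: "x > 0" by (rule x_pos)
  have \<Gamma>: "\<Gamma> \<ge> 1" by (rule Gamma_ge_1)
  have UD: "U \<le> D"
  proof -
    have "real U * 1 \<le> real U * (real U)\<^sup>2" using pos(3) by (intro mult_left_mono) auto
    also have "\<dots> \<le> real D" using P8 by (simp add: power3_eq_cube power2_eq_square)
    finally show ?thesis by simp
  qed
  have U3: "harm U \<le> \<Gamma>"
    using harm(1) harm_mono[of U "4 * D", where ?'a = real] UD by simp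
  have "norm (\<Sum>(m, k)\<in>prod_range D (D' h). (if m \<le> U then c m else 0) *
      (of_real (w k) * ee (real h * x / (real m * real k + t h)))) \<le> 456 * \<Gamma>\<^sup>2 * (real D / s)" if h: "h \<in> {H..<2 * H}" for h
  proof -
    have hr: "real H \<le> real h" "real h \<le> 2 * real H" "real h > 0" using h pos(1) by auto
    have hx: "real h * x > 0" using hr x by simp
    have Hx: "real H * x > 0" using pos(1) x by simp
    have s0: "s > 0" using pos by simp
    have s2: "1 \<le> s\<^sup>2" using pos by simp
    have main: "norm (\<Sum>(m, k)\<in>prod_range D (D' h). (if m \<le> U then c m else 0) *
      (of_real (w k) * ee (real h * x / (real m * real k + t h))))
      \<le> 2 * \<Gamma> * (114 * real U * sqrt (real h * x / real D) + 57 * real D * sqrt (real D / (real h * x)) * harm U)"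
    proof (rule typeI_sum[where c = c and w = w and W = \<Gamma>, OF hx _ UD D'])
      have "real h * x * (real U)\<^sup>2 \<le> 2 * real H * x * (real U)\<^sup>2" using hr x by (intro mult_right_mono) auto
      also have "\<dots> = 2 * (1 * ((real U)\<^sup>2 * real H * x))" by simp
      also have "\<dots> \<le> 2 * (s\<^sup>2 * ((real U)\<^sup>2 * real H * x))" using s2 x by (intro mult_left_mono mult_right_mono) auto
      also have "\<dots> \<le> 8 * (real D)\<^sup>2 * real D"
      proof -
        have "s\<^sup>2 * ((real U)\<^sup>2 * real H * x) \<le> real D ^ 3" using T1 by (simp add: mult_ac)
        moreover have "8 * (real D)\<^sup>2 * real D = 8 * real D ^ 3" by (simp add: eval_nat_numeral)
        ultimately show ?thesis using zero_le_power[of "real D" 3] by linarith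
      qed
      finally show "real h * x * (real U)\<^sup>2 \<le> 8 * (real D)\<^sup>2 * real D" .
    qed (use pos t \<Gamma> c w in auto)
    \<comment> \<open>The factor 1.5 rounds up the sqrt 2 that comes from h \<le> 2H.\<close>
    have 1: "real U * sqrt (real h * x / real D) \<le> 1.5 * (real D / s)"
    proof (rule power2_le_imp_le)
      have "(real U * sqrt (real h * x / real D))\<^sup>2 = (real U)\<^sup>2 * (real h * x / real D)"
        using hx by (simp add: power_mult_distrib)
      also have "\<dots> \<le> (real U)\<^sup>2 * (2 * real H * x / real D)"
        using hr x by (intro mult_left_mono divide_right_mono mult_right_mono) auto
      also have "\<dots> = 2 * ((real U)\<^sup>2 * s\<^sup>2 * real H * x) / (real D * s\<^sup>2)" using s0 by simp
      also have "\<dots> \<le> 2 * real D ^ 3 / (real D * s\<^sup>2)" using T1 s0 by (intro divide_right_mono) auto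
      also have "\<dots> = 2 * (real D / s)\<^sup>2" using pos(2) by (simp add: power_divide eval_nat_numeral)
      also have "\<dots> \<le> 2.25 * (real D / s)\<^sup>2" by (rule mult_right_mono) auto
      also have "\<dots> = (1.5 * (real D / s))\<^sup>2" by (simp add: power2_eq_square)
      finally show "(real U * sqrt (real h * x / real D))\<^sup>2 \<le> (1.5 * (real D / s))\<^sup>2" .
    qed (use s0 in auto)
    have 2: "sqrt (real D / (real h * x)) \<le> 1 / s"
    proof (rule real_le_lsqrt)
      have "real H * x \<le> real h * x" using hr(1) x by (intro mult_right_mono) auto
      hence "s\<^sup>2 * real D \<le> real h * x" using T2 by linarith
      thus "real D / (real h * x) \<le> (1 / s)\<^sup>2" using hx s0 by (simp add: power_divide field_simps)
    qed (use s0 in auto)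
    have "114 * real U * sqrt (real h * x / real D) + 57 * real D * sqrt (real D / (real h * x)) * harm U
       \<le> 114 * (1.5 * (real D / s)) + 57 * real D * (1 / s) * \<Gamma>"
    proof (rule add_mono)
      show "114 * real U * sqrt (real h * x / real D) \<le> 114 * (1.5 * (real D / s))"
        using mult_left_mono[OF 1, of 114] by (simp only: mult.assoc)
      show "57 * real D * sqrt (real D / (real h * x)) * harm U \<le> 57 * real D * (1 / s) * \<Gamma>"
        by (rule mult_mono[OF mult_left_mono[OF 2] U3]) (use s0 harm_nonneg[of U, where ?'a = real] in auto)
    qed
    also have "\<dots> = 171 * (real D / s) * 1 + 57 * (real D / s) * \<Gamma>" by simp
    also have "\<dots> \<le> 171 * (real D / s) * \<Gamma> + 57 * (real D / s) * \<Gamma>" using \<Gamma> s0 by (intro add_right_mono mult_left_mono) auto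
    also have "\<dots> = 228 * (real D / s) * \<Gamma>" by simp
    finally have f: "114 * real U * sqrt (real h * x / real D) + 57 * real D * sqrt (real D / (real h * x)) * harm U
      \<le> 228 * (real D / s) * \<Gamma>" .
    have "2 * \<Gamma> * (114 * real U * sqrt (real h * x / real D) + 57 * real D * sqrt (real D / (real h * x)) * harm U)
       \<le> 2 * \<Gamma> * (228 * (real D / s) * \<Gamma>)" by (rule mult_left_mono[OF f]) (use \<Gamma> in simp)
    with main show ?thesis by (simp add: power2_eq_square mult_ac)
  qed
  hence "(\<Sum>h\<in>{H..<2 * H}. norm (\<Sum>(m, k)\<in>prod_range D (D' h). (if m \<le> U then c m else 0) *
      (of_real (w k) * ee (real h * x / (real m * real k + t h))))) \<le> (\<Sum>h\<in>{H..<2 * H}. 456 * \<Gamma>\<^sup>2 * (real D / s))"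
    by (rule sum_mono)
  also have "\<dots> = 456 * \<Gamma>\<^sup>2 * (real H * real D) / s" by simp
  finally show ?thesis .
qed

text \<open>\<open>vaughan_E\<close> reaches up to m = U^2, too far for type I sums. But U^3 \<le> D
  and m \<le> U^2 force k > U, so its part with m > U is of type II. The coefficients
  \<open>vaughan_E\<close>, \<open>vaughan_B\<close> and \<open>mangoldt\<close> are divided by
  \<Gamma> to have norm at most 1.\<close>

lemma mangoldt_exp_sum:
  assumes t: "\<And>h. 0 \<le> t h \<and> t h \<le> 1" and D': "\<And>h. D' h \<le> 2 * D"
  shows "(\<Sum>h\<in>{H..<2 * H}. norm (\<Sum>d\<in>{D<..D' h}. of_real (mangoldt d) * ee (real h * x / (real d + t h))))
    \<le> 2176 * \<Gamma> ^ 5 * (real H * real D) / s"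
proof -
  define F where "F h m k = ee (real h * x / (real m * real k + t h))" for h m k :: nat
  have \<Gamma>: "\<Gamma> \<ge> 1" by (rule Gamma_ge_1)
  have UD: "U \<le> D"
  proof -
    have "real U * 1 \<le> real U * (real U)\<^sup>2" using pos(3) by (intro mult_left_mono) auto
    also have "\<dots> \<le> real D" using P8 by (simp add: power3_eq_cube power2_eq_square)
    finally show ?thesis by simp
  qed
  have lnG: "ln (real m) \<le> \<Gamma>" if "0 < m" "m \<le> 2 * D" for m :: nat
  proof -
    have "real m \<le> real (2 * D)" using that(2) by (simp only: of_nat_le_iff)
    hence "ln (real m) \<le> ln (2 * real D)" using that by simp
    thus ?thesis using harm(2) by linarith
  qed
  define e where "e m = (if 0 < m \<and> m \<le> 2 * D then complex_of_real (vaughan_E U m / \<Gamma>) else 0)" for m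
  define a where "a m = (if 0 < m \<and> m \<le> 2 * D then complex_of_real (vaughan_B U m / \<Gamma>) else 0)" for m
  define b where "b m = (if 0 < m \<and> m \<le> 2 * D then complex_of_real (mangoldt m / \<Gamma>) else 0)" for m :: nat
  have e: "norm (e m) \<le> 1" for m
  proof (cases "0 < m \<and> m \<le> 2 * D")
    case True
    hence "\<bar>vaughan_E U m\<bar> \<le> \<Gamma>" using abs_vaughan_E_le[of m U] lnG[of m] by linarith
    thus ?thesis using \<Gamma> by (simp add: e_def norm_divide)
  qed (auto simp: e_def)
  have a: "norm (a m) \<le> 1" for m
  proof (cases "0 < m \<and> m \<le> 2 * D")
    case True
    have "2 * D \<le> 4 * H * D" using pos(1) by simp
    hence "\<bar>vaughan_B U m\<bar> \<le> \<Gamma>" using abs_vaughan_B_le[of U m] div[of m] True by linarith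
    thus ?thesis using \<Gamma> by (simp add: a_def norm_divide)
  qed (auto simp: a_def)
  have b: "norm (b m) \<le> 1" for m
  proof (cases "0 < m \<and> m \<le> 2 * D")
    case True
    hence "mangoldt m \<le> \<Gamma>" using mangoldt_le[of m] lnG[of m] by linarith
    thus ?thesis using \<Gamma> mangoldt_nonneg[of m] by (simp add: b_def norm_divide)
  qed (auto simp: b_def)
  define V1 where "V1 h = (\<Sum>(m, k)\<in>prod_range D (D' h). (if m \<le> U then complex_of_real (moebius m) else 0) * (of_real (ln (real k)) * F h m k))" for h
  define V2 where "V2 h = (\<Sum>(m, k)\<in>prod_range D (D' h). (if m \<le> U then e m else 0) * (of_real 1 * F h m k))" for h
  define V3 where "V3 h = (\<Sum>(m, k)\<in>prod_range D (D' h). (if U < m \<and> U < k then e m * 1 else 0) * F h m k)" for h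
  define V4 where "V4 h = (\<Sum>(m, k)\<in>prod_range D (D' h). (if U < m \<and> U < k then a m * b k else 0) * F h m k)" for h
  have range: "0 < m \<and> m \<le> 2 * D \<and> 0 < k \<and> k \<le> 2 * D" if "(m, k) \<in> prod_range D (D' h)" for m k h
    using that prod_range_subset[of D "D' h"] D'[of h] by auto
  have dec: "(\<Sum>d\<in>{D<..D' h}. of_real (mangoldt d) * ee (real h * x / (real d + t h))) =
     V1 h - of_real \<Gamma> * V2 h - of_real \<Gamma> * V3 h + of_real (\<Gamma>\<^sup>2) * V4 h" for h
  proof -
    have 2: "(\<Sum>(m, k)\<in>prod_range D (D' h). of_real (vaughan_E U m) * ee (real h * x / (real (m * k) + t h))) =
      of_real \<Gamma> * V2 h + of_real \<Gamma> * V3 h"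
      unfolding V2_def V3_def sum_distrib_left sum.distrib[symmetric]
    proof (rule sum.cong[OF refl])
      fix p assume p: "p \<in> prod_range D (D' h)"
      obtain m k where mk: "p = (m, k)" by (cases p)
      have r: "0 < m" "m \<le> 2 * D" using range[of m k h] p by (auto simp: mk)
      have "U < k" if "vaughan_E U m \<noteq> 0"
      proof -
        have mU: "m \<le> U * U" using vaughan_E_eq_0[of U m] that by (meson not_less)
        have "real (U * U * U) \<le> real D" using P8 by (simp add: power3_eq_cube)
        hence "U * U * U \<le> D" by (simp only: of_nat_le_iff)
        also have "D < m * k" using p by (simp add: mk prod_range_def)
        also have "m * k \<le> (U * U) * k" using mU by (rule mult_le_mono1)
        finally show ?thesis by simp
      qed
      thus "(case p of (m, k) \<Rightarrow> of_real (vaughan_E U m) * ee (real h * x / (real (m * k) + t h))) =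
        of_real \<Gamma> * (case p of (m, k) \<Rightarrow> (if m \<le> U then e m else 0) * (of_real 1 * F h m k)) +
        of_real \<Gamma> * (case p of (m, k) \<Rightarrow> (if U < m \<and> U < k then e m * 1 else 0) * F h m k)"
        using r \<Gamma> by (cases "vaughan_E U m = 0") (auto simp: mk e_def F_def)
    qed
    have 3: "(\<Sum>(m, k)\<in>prod_range D (D' h). of_real (vaughan_B U m * (if k > U then mangoldt k else 0)) * ee (real h * x / (real (m * k) + t h))) =
      of_real (\<Gamma>\<^sup>2) * V4 h"
      unfolding V4_def sum_distrib_left
    proof (rule sum.cong[OF refl])
      fix p assume p: "p \<in> prod_range D (D' h)"
      obtain m k where mk: "p = (m, k)" by (cases p)
      have r: "0 < m" "m \<le> 2 * D" "0 < k" "k \<le> 2 * D" using range[of m k h] p by (auto simp: mk)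
      show "(case p of (m, k) \<Rightarrow> of_real (vaughan_B U m * (if k > U then mangoldt k else 0)) * ee (real h * x / (real (m * k) + t h))) =
        of_real (\<Gamma>\<^sup>2) * (case p of (m, k) \<Rightarrow> (if U < m \<and> U < k then a m * b k else 0) * F h m k)"
        using r \<Gamma> vaughan_B_eq_0[of m U] by (cases "m \<le> U") (auto simp: mk a_def b_def F_def power2_eq_square)
    qed
    have 1: "(\<Sum>(m, k)\<in>prod_range D (D' h). of_real ((if m \<le> U then moebius m else 0) * ln (real k)) * ee (real h * x / (real (m * k) + t h))) = V1 h"
      unfolding V1_def by (intro sum.cong refl) (auto simp: F_def)
    show ?thesis using vaughan_sum[OF UD, of "\<lambda>d. ee (real h * x / (real d + t h))" "D' h"] unfolding 1 2 3 by simp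
  qed
  have N1: "(\<Sum>h\<in>{H..<2 * H}. norm (V1 h)) \<le> 456 * \<Gamma>\<^sup>2 * (real H * real D) / s"
    unfolding V1_def F_def
    by (rule typeI_bound) (use abs_moebius_le t D' lnG in \<open>auto simp: norm_of_real\<close>)
  have N2: "(\<Sum>h\<in>{H..<2 * H}. norm (V2 h)) \<le> 456 * \<Gamma>\<^sup>2 * (real H * real D) / s"
    unfolding V2_def F_def by (rule typeI_bound) (use e t D' \<Gamma> in auto)
  have N3: "(\<Sum>h\<in>{H..<2 * H}. norm (V3 h)) \<le> 632 * \<Gamma> ^ 3 * (real H * real D) / s"
    unfolding V3_def F_def by (rule typeII_full) (use e t D' in auto)
  have N4: "(\<Sum>h\<in>{H..<2 * H}. norm (V4 h)) \<le> 632 * \<Gamma> ^ 3 * (real H * real D) / s"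
    unfolding V4_def F_def by (rule typeII_full) (use a b t D' in auto)
  define Y where "Y = real H * real D / s"
  have Y: "Y \<ge> 0" using pos by (simp add: Y_def)
  have "(\<Sum>h\<in>{H..<2 * H}. norm (\<Sum>d\<in>{D<..D' h}. of_real (mangoldt d) * ee (real h * x / (real d + t h)))) \<le>
     (\<Sum>h\<in>{H..<2 * H}. norm (V1 h) + \<Gamma> * norm (V2 h) + \<Gamma> * norm (V3 h) + \<Gamma>\<^sup>2 * norm (V4 h))"
  proof (rule sum_mono)
    fix h
    have "norm (V1 h - of_real \<Gamma> * V2 h - of_real \<Gamma> * V3 h + of_real (\<Gamma>\<^sup>2) * V4 h) \<le>
      norm (V1 h) + norm (of_real \<Gamma> * V2 h) + norm (of_real \<Gamma> * V3 h) + norm (of_real (\<Gamma>\<^sup>2) * V4 h)"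
      by (intro order_trans[OF norm_triangle_ineq] add_mono order_trans[OF norm_triangle_ineq4] order_refl)
    also have "\<dots> = norm (V1 h) + \<Gamma> * norm (V2 h) + \<Gamma> * norm (V3 h) + \<Gamma>\<^sup>2 * norm (V4 h)"
      using \<Gamma> by (simp only: norm_mult norm_of_real) simp
    finally show "norm (\<Sum>d\<in>{D<..D' h}. of_real (mangoldt d) * ee (real h * x / (real d + t h))) \<le> \<dots>"
      unfolding dec .
  qed
  also have "\<dots> = (\<Sum>h\<in>{H..<2 * H}. norm (V1 h)) + \<Gamma> * (\<Sum>h\<in>{H..<2 * H}. norm (V2 h))
     + \<Gamma> * (\<Sum>h\<in>{H..<2 * H}. norm (V3 h)) + \<Gamma>\<^sup>2 * (\<Sum>h\<in>{H..<2 * H}. norm (V4 h))"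
    by (simp only: sum.distrib sum_distrib_left)
  also have "\<dots> \<le> 456 * \<Gamma>\<^sup>2 * (real H * real D) / s + \<Gamma> * (456 * \<Gamma>\<^sup>2 * (real H * real D) / s)
     + \<Gamma> * (632 * \<Gamma> ^ 3 * (real H * real D) / s) + \<Gamma>\<^sup>2 * (632 * \<Gamma> ^ 3 * (real H * real D) / s)"
    using \<Gamma> by (intro add_mono mult_left_mono N1 N2 N3 N4) auto
  also have "\<dots> = 456 * (\<Gamma> ^ 2 * Y) + 456 * (\<Gamma> ^ 3 * Y) + 632 * (\<Gamma> ^ 4 * Y) + 632 * (\<Gamma> ^ 5 * Y)"
    by (simp add: Y_def eval_nat_numeral mult_ac)
  also have "\<dots> \<le> 456 * (\<Gamma> ^ 5 * Y) + 456 * (\<Gamma> ^ 5 * Y) + 632 * (\<Gamma> ^ 5 * Y) + 632 * (\<Gamma> ^ 5 * Y)"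
    using \<Gamma> Y by (intro add_mono mult_left_mono mult_right_mono power_increasing) auto
  also have "\<dots> = 2176 * \<Gamma> ^ 5 * (real H * real D) / s" by (simp add: Y_def)
  finally show ?thesis .
qed

end

section \<open>Truncated Fourier series of the sawtooth function\<close>

definition sawtooth :: "real \<Rightarrow> real" where "sawtooth y = frac y - 1 / 2"

text \<open>Partial sum of the Fourier series of minus the sawtooth; hence it is the sum of
  \<open>sawtooth\<close> and \<open>saw_poly\<close> that becomes small.\<close>

definition saw_poly :: "nat \<Rightarrow> real \<Rightarrow> real" where
  "saw_poly H y = (\<Sum>h\<in>{1..<H}. sin (2 * pi * (real h * y)) / (pi * real h))"

text \<open>The Fejer kernel divided by its length, so that its value at 0 is 1 for L \<ge>
  1.\<close>

definition fejer :: "nat \<Rightarrow> real \<Rightarrow> real" where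
  "fejer L y = (norm (\<Sum>k<L. ee (real k * y)))\<^sup>2 / (real L)\<^sup>2"

lemma fejer_nonneg [simp]: "fejer L y \<ge> 0" by (simp add: fejer_def)

text \<open>The bracket is the derivative of \<open>y + saw_poly (Suc n) y\<close>.\<close>

lemma dirichlet_kernel:
  "(1 + (\<Sum>h\<in>{1..<Suc n}. 2 * cos (2 * pi * (real h * y)))) * sin (pi * y) = sin (real (2 * n + 1) * (pi * y))"
proof (induction n)
  case (Suc n)
  have "sin (real (2 * Suc n + 1) * (pi * y)) - sin (real (2 * n + 1) * (pi * y)) = 2 * cos (2 * pi * (real (Suc n) * y)) * sin (pi * y)"
  proof -
    have "(real (2 * Suc n + 1) * (pi * y) - real (2 * n + 1) * (pi * y)) / 2 = pi * y"
      "(real (2 * Suc n + 1) * (pi * y) + real (2 * n + 1) * (pi * y)) / 2 = 2 * pi * (real (Suc n) * y)"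
      by (simp_all add: field_simps)
    thus ?thesis unfolding sin_diff_sin by (simp only: mult_ac)
  qed
  with Suc show ?case by (simp add: algebra_simps)
qed simp

text \<open>The error \<open>g\<close> vanishes at 1/2 and its derivative is the Dirichlet kernel.
  Integrating from 1/2, one integration by parts exploits the oscillation and produces the factor
  1/H.\<close>

lemma saw_poly_approx_half:
  assumes H: "H \<ge> 1" and y: "0 < y" "y \<le> 1 / 2"
  shows "\<bar>y - 1 / 2 + saw_poly H y\<bar> \<le> 1 / (2 * real H * y)"
proof -
  define n where "n = H - 1"
  have Hn: "H = Suc n" using H by (simp add: n_def)
  define N where "N = real (2 * n + 1)"
  have N: "N \<ge> 1" "N \<ge> real H" by (auto simp: N_def Hn)
  define g where "g u = u - 1 / 2 + saw_poly H u" for u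
  \<comment> \<open>\<open>g\<close> without the boundary term of the integration by parts; its
    derivative is of size 1/(N u^2) instead of 1/u.\<close>
  define G where "G u = g u + cos (N * (pi * u)) / (N * pi * sin (pi * u))" for u
  \<comment> \<open>Minus the derivative of \<open>K\<close> dominates |G'|, so the monotonicity of
    G + K and of K - G replaces the integral.\<close>
  define K where "K u = 1 / (4 * N * u)" for u
  have sin_ge: "sin (pi * u) \<ge> 2 * u" if "y \<le> u" "u \<le> 1 / 2" for u using that y by (intro sin_pi_ge) auto
  have dg: "(g has_real_derivative sin (N * (pi * u)) / sin (pi * u)) (at u)" if "y \<le> u" "u \<le> 1 / 2" for u
  proof -
    have s: "sin (pi * u) > 0" using sin_ge[OF that] that y by linarith
    have "(g has_real_derivative 1 + (\<Sum>h\<in>{1..<H}. 2 * cos (2 * pi * (real h * u)))) (at u)"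
      unfolding g_def saw_poly_def
      by (auto intro!: derivative_eq_intros sum.cong simp: field_simps)
    also have "1 + (\<Sum>h\<in>{1..<H}. 2 * cos (2 * pi * (real h * u))) = sin (N * (pi * u)) / sin (pi * u)"
      using dirichlet_kernel[where n = n and y = u] s by (simp add: Hn N_def field_simps)
    finally show ?thesis .
  qed
  have dG: "(G has_real_derivative - (cos (N * (pi * u)) * cos (pi * u)) / (N * (sin (pi * u))\<^sup>2)) (at u)" if u: "y \<le> u" "u \<le> 1 / 2" for u
  proof -
    have s: "sin (pi * u) > 0" using sin_ge[OF u] u y by linarith
    have "(G has_real_derivative sin (N * (pi * u)) / sin (pi * u) +
       ((- sin (N * (pi * u)) * (N * pi)) * (N * pi * sin (pi * u)) - cos (N * (pi * u)) * (N * pi * (cos (pi * u) * pi))) / (N * pi * sin (pi * u) * (N * pi * sin (pi * u)))) (at u)"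
      unfolding G_def using s N
      by (auto intro!: derivative_eq_intros dg[OF u])
    also have "sin (N * (pi * u)) / sin (pi * u) +
       ((- sin (N * (pi * u)) * (N * pi)) * (N * pi * sin (pi * u)) - cos (N * (pi * u)) * (N * pi * (cos (pi * u) * pi))) / (N * pi * sin (pi * u) * (N * pi * sin (pi * u)))
       = - (cos (N * (pi * u)) * cos (pi * u)) / (N * (sin (pi * u))\<^sup>2)"
      using s N by (simp add: field_simps power2_eq_square)
    finally show ?thesis .
  qed
  have dK: "(K has_real_derivative - 1 / (4 * N * u\<^sup>2)) (at u)" if "y \<le> u" for u
    unfolding K_def using that y N by (auto intro!: derivative_eq_intros simp: field_simps power2_eq_square)
  have dle: "\<bar>- (cos (N * (pi * u)) * cos (pi * u)) / (N * (sin (pi * u))\<^sup>2)\<bar> \<le> 1 / (4 * N * u\<^sup>2)" if u: "y \<le> u" "u \<le> 1 / 2" for u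
  proof -
    have "\<bar>cos (N * (pi * u)) * cos (pi * u)\<bar> \<le> 1 * 1" unfolding abs_mult by (intro mult_mono) auto
    moreover have "4 * N * u\<^sup>2 \<le> N * (sin (pi * u))\<^sup>2"
    proof -
      have "(2 * u)\<^sup>2 \<le> (sin (pi * u))\<^sup>2" using sin_ge[OF u] u y by (intro power_mono) auto
      hence "N * (2 * u)\<^sup>2 \<le> N * (sin (pi * u))\<^sup>2" using N by (intro mult_left_mono) auto
      thus ?thesis by (simp add: power_mult_distrib mult_ac)
    qed
    moreover have "4 * N * u\<^sup>2 > 0" using N u y by auto
    ultimately have "\<bar>cos (N * (pi * u)) * cos (pi * u)\<bar> / (N * (sin (pi * u))\<^sup>2) \<le> 1 / (4 * N * u\<^sup>2)"
      by (intro frac_le) auto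
    thus ?thesis using N by (simp add: abs_divide abs_mult)
  qed
  have Ghalf: "G (1 / 2) = 0"
  proof -
    have "cos (N * (pi * (1 / 2))) = 0"
      unfolding cos_zero_iff N_def by (rule disjI1, rule exI[of _ "2 * n + 1"]) auto
    moreover have "saw_poly H (1 / 2) = 0"
      unfolding saw_poly_def by (intro sum.neutral) (auto simp: mult.commute[of pi])
    ultimately show ?thesis by (simp add: G_def g_def)
  qed
  have "G (1 / 2) + K (1 / 2) \<le> G y + K y"
    using y(2)
  proof (rule DERIV_nonpos_imp_nonincreasing[where f = "\<lambda>u. G u + K u"])
    fix u assume u: "y \<le> u" "u \<le> 1 / 2"
    show "\<exists>z. ((\<lambda>u. G u + K u) has_real_derivative z) (at u) \<and> z \<le> 0"
      using DERIV_add[OF dG[OF u] dK[OF u(1)]] dle[OF u] by (intro exI conjI) (assumption, linarith)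
  qed
  moreover have "K (1 / 2) - G (1 / 2) \<le> K y - G y"
    using y(2)
  proof (rule DERIV_nonpos_imp_nonincreasing[where f = "\<lambda>u. K u - G u"])
    fix u assume u: "y \<le> u" "u \<le> 1 / 2"
    show "\<exists>z. ((\<lambda>u. K u - G u) has_real_derivative z) (at u) \<and> z \<le> 0"
      using DERIV_diff[OF dK[OF u(1)] dG[OF u]] dle[OF u] by (intro exI conjI) (assumption, linarith)
  qed
  moreover have "K (1 / 2) \<ge> 0" using N by (simp add: K_def)
  ultimately have G_le: "\<bar>G y\<bar> \<le> K y" using Ghalf by linarith
  have "\<bar>cos (N * (pi * y)) / (N * pi * sin (pi * y))\<bar> \<le> K y"
  proof -
    have "4 * N * y \<le> N * pi * sin (pi * y)"
    proof -
      have "N * 2 * (2 * y) \<le> N * pi * sin (pi * y)" using N y sin_ge[of y] pi_ge_two by (intro mult_mono) auto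
      thus ?thesis by simp
    qed
    hence "\<bar>cos (N * (pi * y))\<bar> / (N * pi * sin (pi * y)) \<le> 1 / (4 * N * y)"
      using N y by (intro frac_le) auto
    moreover have "N * pi * sin (pi * y) \<ge> 0" using N sin_ge[of y] y by (intro mult_nonneg_nonneg) auto
    ultimately show ?thesis by (simp add: K_def abs_divide)
  qed
  hence "\<bar>g y\<bar> \<le> 2 * K y" using G_le unfolding G_def by linarith
  also have "\<dots> = 1 / (2 * N * y)" by (simp add: K_def)
  also have "\<dots> \<le> 1 / (2 * real H * y)" using N y H by (intro divide_left_mono mult_right_mono mult_left_mono mult_pos_pos) auto
  finally show ?thesis by (simp add: g_def)
qed

lemma saw_poly_approx_small:
  assumes H: "H \<ge> 1" and y: "0 \<le> y" "y \<le> 1 / (2 * real H)"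
  shows "\<bar>y - 1 / 2 + saw_poly H y\<bar> \<le> 3 / 2"
proof -
  have "\<bar>saw_poly H y\<bar> \<le> (\<Sum>h\<in>{1..<H}. 2 * y)"
    unfolding saw_poly_def
  proof (rule order_trans[OF sum_abs], rule sum_mono)
    fix h assume "h \<in> {1..<H}"
    hence h: "real h > 0" by simp
    have "\<bar>sin (2 * pi * (real h * y))\<bar> \<le> 2 * pi * (real h * y)"
      using abs_sin_x_le_abs_x[of "2 * pi * (real h * y)"] y by (simp add: abs_mult)
    hence "\<bar>sin (2 * pi * (real h * y))\<bar> / (pi * real h) \<le> 2 * pi * (real h * y) / (pi * real h)"
      using h by (intro divide_right_mono) auto
    thus "\<bar>sin (2 * pi * (real h * y)) / (pi * real h)\<bar> \<le> 2 * y" using h by (simp add: abs_divide abs_mult)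
  qed
  also have "\<dots> \<le> real H * (2 * y)" using y by (simp add: mult_right_mono)
  also have "\<dots> \<le> 1" using y H by (simp add: field_simps)
  finally have "\<bar>saw_poly H y\<bar> \<le> 1" .
  moreover have "1 / (2 * real H) \<le> 1 / 2" using H by (simp add: field_simps)
  ultimately show ?thesis using y by linarith
qed

text \<open>In the quotient (1 - e(L y)) / (1 - e(y)) the numerator is at least 4 L |y| because |L
  y| \<le> 1/2, and the denominator is at most 8 |y|.\<close>

lemma fejer_ge:
  assumes L: "L \<ge> 1" and y: "\<bar>y\<bar> \<le> 1 / (2 * real L)"
  shows "fejer L y \<ge> 1 / 4"
proof -
  have "norm (\<Sum>k<L. ee (real k * y)) \<ge> real L / 2"
  proof (cases "y = 0")
    case False
    have L2: "1 / (2 * real L) \<le> 1 / 2" using L by (simp add: field_simps)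
    have ne: "ee y \<noteq> 1" using norm_ee_diff_1_ge[of y] y L2 False by auto
    have "\<bar>real L * y\<bar> \<le> 1 / 2" using y L by (simp add: abs_mult field_simps)
    hence "4 * \<bar>real L * y\<bar> \<le> norm (1 - ee (real L * y))" by (rule norm_ee_diff_1_ge)
    also have "1 - ee (real L * y) = (1 - ee y) * (\<Sum>k<L. ee (real k * y))"
      unfolding ee_of_nat_mult using ne by (simp add: geometric_sum field_simps)
    also have "norm \<dots> \<le> (8 * \<bar>y\<bar>) * norm (\<Sum>k<L. ee (real k * y))"
    proof -
      have "norm (1 - ee y) \<le> 2 * pi * \<bar>0 - y\<bar>" using norm_ee_diff_le[of 0 y] by simp
      also have "\<dots> \<le> 8 * \<bar>y\<bar>" using pi_less_4 by (simp add: mult_right_mono)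
      finally show ?thesis unfolding norm_mult by (intro mult_right_mono) auto
    qed
    finally have "\<bar>y\<bar> * (4 * real L) \<le> \<bar>y\<bar> * (8 * norm (\<Sum>k<L. ee (real k * y)))" by (simp add: abs_mult mult_ac)
    hence "4 * real L \<le> 8 * norm (\<Sum>k<L. ee (real k * y))" using False by (simp add: mult_le_cancel_left)
    thus ?thesis by simp
  qed simp
  hence "(real L / 2)\<^sup>2 \<le> (norm (\<Sum>k<L. ee (real k * y)))\<^sup>2" by (intro power_mono) auto
  thus ?thesis using L by (simp add: fejer_def field_simps)
qed

lemma saw_poly_int_add: "saw_poly H (y + of_int k) = saw_poly H y"
proof -
  have "sin (2 * pi * (real h * (y + of_int k))) = sin (2 * pi * (real h * y))" for h
  proof -
    have "2 * pi * (real h * (y + of_int k)) = 2 * pi * (real h * y) + 2 * pi * of_int (int h * k)" by (simp add: algebra_simps)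
    also have "sin \<dots> = sin (2 * pi * (real h * y))"
      unfolding sin_add using sin_int_2pin[of "int h * k"] cos_int_2pin[of "int h * k"] by simp
    finally show ?thesis .
  qed
  thus ?thesis unfolding saw_poly_def by simp
qed

lemma saw_poly_minus: "saw_poly H (- y) = - saw_poly H y"
  by (simp add: saw_poly_def sum_negf)

lemma fejer_int_add: "fejer L (y + of_int k) = fejer L y"
proof -
  have "ee (real h * (y + of_int k)) = ee (real h * y)" for h
    using ee_int_add[of "real h * y" "int h * k"] by (simp add: algebra_simps)
  thus ?thesis by (simp add: fejer_def)
qed

lemma fejer_minus: "fejer L (- y) = fejer L y"
proof -
  have "(\<Sum>k<L. ee (real k * (- y))) = cnj (\<Sum>k<L. ee (real k * y))" by simp
  thus ?thesis unfolding fejer_def by (simp only: complex_mod_cnj)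
qed

text \<open>The truncation error at \<open>y\<close> is at most a constant times the minimum of 1 and $1/(2^J \|y\|)$, which
  the Fejer kernels of lengths $2^j$, $j \le J$, with weights $2^{j-J}$ dominate.\<close>

lemma saw_poly_approx_0:
  assumes y: "0 \<le> y" "y \<le> 1 / 2"
  shows "\<bar>y - 1 / 2 + saw_poly (2 ^ J) y\<bar> \<le> 8 * (\<Sum>j\<le>J. fejer (2 ^ (J - j)) y / 2 ^ j)"
proof -
  define P where "P j \<longleftrightarrow> y \<le> 2 ^ j / (2 * 2 ^ J)" for j :: nat
  \<comment> \<open>The least j with y \<le> 2^(j - J) / 2: at this scale the Fejer kernel of length
    2^(J - j) is at least 1/4, and the error at most 2/2^j.\<close>
  define j where "j = (LEAST j. P j)"
  have "P J" using y by (simp add: P_def)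
  hence j: "P j" "j \<le> J" unfolding j_def by (auto intro: LeastI Least_le)
  have F: "fejer (2 ^ (J - j)) y \<ge> 1 / 4"
  proof (rule fejer_ge)
    have "(2::real) ^ J = 2 ^ (J - j) * 2 ^ j" using j(2) by (simp flip: power_add)
    thus "\<bar>y\<bar> \<le> 1 / (2 * real (2 ^ (J - j)))" using j(1) y by (simp add: P_def)
  qed simp
  have "\<bar>y - 1 / 2 + saw_poly (2 ^ J) y\<bar> \<le> 2 / 2 ^ j"
  proof (cases j)
    case 0
    have "\<bar>y - 1 / 2 + saw_poly (2 ^ J) y\<bar> \<le> 3 / 2"
      using j(1) y by (intro saw_poly_approx_small) (auto simp: P_def 0)
    thus ?thesis by (simp add: 0)
  next
    case (Suc j')
    hence "\<not> P j'" using not_less_Least[of j' P] by (simp add: j_def)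
    hence gt: "y > 2 ^ j' / (2 * 2 ^ J)" by (simp add: P_def)
    have y0: "y > 0" by (rule le_less_trans[OF _ gt]) simp
    have "\<bar>y - 1 / 2 + saw_poly (2 ^ J) y\<bar> \<le> 1 / (2 * real (2 ^ J) * y)"
      using y y0 by (intro saw_poly_approx_half) auto
    also have "\<dots> \<le> 1 / (2 * 2 ^ J * (2 ^ j' / (2 * 2 ^ J)))"
      using gt y0 by (intro divide_left_mono mult_pos_pos) (auto simp: field_simps)
    also have "\<dots> = 2 / 2 ^ j" by (simp add: Suc)
    finally show ?thesis .
  qed
  also have "\<dots> \<le> 8 * (fejer (2 ^ (J - j)) y / 2 ^ j)" using F by (simp add: divide_right_mono)
  also have "fejer (2 ^ (J - j)) y / 2 ^ j \<le> (\<Sum>j\<le>J. fejer (2 ^ (J - j)) y / 2 ^ j)"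
    using j(2) by (intro member_le_sum) auto
  finally show ?thesis by simp
qed

lemma saw_poly_approx:
  "\<bar>sawtooth y + saw_poly (2 ^ J) y\<bar> \<le> 8 * (\<Sum>j\<le>J. fejer (2 ^ (J - j)) y / 2 ^ j)"
proof -
  define z where "z = frac y"
  have z: "0 \<le> z" "z < 1" by (auto simp: z_def frac_lt_1)
  have yz: "y = z + of_int \<lfloor>y\<rfloor>" by (simp add: z_def frac_def)
  have eq: "saw_poly H y = saw_poly H z" "fejer L y = fejer L z" for H L
    by (subst yz, simp only: saw_poly_int_add fejer_int_add)+
  show ?thesis
  proof (cases "z \<le> 1 / 2")
    case True
    thus ?thesis using saw_poly_approx_0[of z J] z unfolding eq sawtooth_def z_def[symmetric] by simp
  next
    \<comment> \<open>The other half of the period follows by replacing z with 1 - z: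
      \<open>saw_poly\<close> is odd and \<open>fejer\<close> even.\<close>
    case False
    have s: "saw_poly H (1 - z) = - saw_poly H z" for H
      using saw_poly_int_add[of H "- z" 1] by (simp add: saw_poly_minus)
    have f: "fejer L (1 - z) = fejer L z" for L
      using fejer_int_add[of L "- z" 1] by (simp add: fejer_minus)
    have "\<bar>(1 - z) - 1 / 2 + saw_poly (2 ^ J) (1 - z)\<bar> \<le> 8 * (\<Sum>j\<le>J. fejer (2 ^ (J - j)) (1 - z) / 2 ^ j)"
      using z False by (intro saw_poly_approx_0) auto
    hence "\<bar>- (z - 1 / 2 + saw_poly (2 ^ J) z)\<bar> \<le> 8 * (\<Sum>j\<le>J. fejer (2 ^ (J - j)) z / 2 ^ j)"
      unfolding s f by (simp add: algebra_simps)
    thus ?thesis unfolding eq sawtooth_def z_def[symmetric] by (simp only: abs_minus_cancel)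
  qed
qed

text \<open>Opening the square gives sums over d at the frequencies k - l; for each k every value h
  = |k - l| \<ge> 1 occurs at most twice.\<close>

lemma sum_fejer_le:
  fixes w :: "'a \<Rightarrow> real" and y :: "'a \<Rightarrow> real"
  assumes w: "\<And>d. d \<in> I \<Longrightarrow> w d \<ge> 0" and L: "L \<ge> 1"
  shows "(\<Sum>d\<in>I. w d * fejer L (y d)) \<le>
    (1 / real L) * ((\<Sum>d\<in>I. w d) + 2 * (\<Sum>h\<in>{1..<L}. norm (\<Sum>d\<in>I. of_real (w d) * ee (real h * y d))))"
proof -
  define S where "S h = (\<Sum>d\<in>I. of_real (w d) * ee (real h * y d))" for h :: nat
  have kl: "norm (\<Sum>d\<in>I. of_real (w d) * ee ((real k - real l) * y d)) = norm (S (if l \<le> k then k - l else l - k))" for k l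
  proof (cases "l \<le> k")
    case True
    thus ?thesis by (simp add: S_def of_nat_diff)
  next
    case False
    have "(\<Sum>d\<in>I. of_real (w d) * ee ((real k - real l) * y d)) = cnj (S (l - k))"
      using False by (simp add: S_def of_nat_diff algebra_simps)
    thus ?thesis using False by (simp only: complex_mod_cnj) simp
  qed
  have "complex_of_real (\<Sum>d\<in>I. w d * (norm (\<Sum>k<L. ee (real k * y d)))\<^sup>2) =
    (\<Sum>d\<in>I. of_real (w d) * (\<Sum>k<L. \<Sum>l<L. ee ((real k - real l) * y d)))"
    unfolding of_real_sum of_real_mult
    by (intro sum.cong refl arg_cong2[of _ _ _ _ "(*)"], simp only: complex_norm_square cnj_sum sum_product cnj_ee,
        intro sum.cong refl, simp add: left_diff_distrib ee_diff)
  also have "\<dots> = (\<Sum>k<L. \<Sum>l<L. \<Sum>d\<in>I. of_real (w d) * ee ((real k - real l) * y d))"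
    unfolding sum_distrib_left by (subst sum.swap, intro sum.cong refl, rule sum.swap)
  finally have eq: "complex_of_real (\<Sum>d\<in>I. w d * (norm (\<Sum>k<L. ee (real k * y d)))\<^sup>2) = \<dots>" .
  have "(\<Sum>d\<in>I. w d * (norm (\<Sum>k<L. ee (real k * y d)))\<^sup>2) \<le> norm (complex_of_real (\<Sum>d\<in>I. w d * (norm (\<Sum>k<L. ee (real k * y d)))\<^sup>2))"
    unfolding norm_of_real by simp
  also have "\<dots> \<le> (\<Sum>k<L. \<Sum>l<L. norm (S (if l \<le> k then k - l else l - k)))"
    unfolding eq kl[symmetric] by (intro order_trans[OF norm_sum] sum_mono order_refl)
  also have "\<dots> \<le> (\<Sum>k<L. norm (S 0) + 2 * (\<Sum>h\<in>{1..<L}. norm (S h)))"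
  proof (rule sum_mono)
    fix k assume k: "k \<in> {..<L}"
    have split: "{..<L} = {..<k} \<union> ({k} \<union> {k<..<L})" using k by auto
    have "(\<Sum>l<L. norm (S (if l \<le> k then k - l else l - k))) =
      (\<Sum>l<k. norm (S (k - l))) + (norm (S 0) + (\<Sum>l\<in>{k<..<L}. norm (S (l - k))))"
      unfolding split by (subst sum.union_disjoint, simp, simp, force, subst sum.union_disjoint) auto
    also have "(\<Sum>l<k. norm (S (k - l))) = (\<Sum>h\<in>{1..k}. norm (S h))"
      by (rule sum.reindex_bij_witness[of _ "\<lambda>h. k - h" "\<lambda>l. k - l"]) auto
    also have "\<dots> \<le> (\<Sum>h\<in>{1..<L}. norm (S h))" using k by (intro sum_mono2) auto
    also have "(\<Sum>l\<in>{k<..<L}. norm (S (l - k))) = (\<Sum>h\<in>{1..<L - k}. norm (S h))"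
      by (rule sum.reindex_bij_witness[of _ "\<lambda>h. k + h" "\<lambda>l. l - k"]) auto
    also have "\<dots> \<le> (\<Sum>h\<in>{1..<L}. norm (S h))" by (intro sum_mono2) auto
    finally show "(\<Sum>l<L. norm (S (if l \<le> k then k - l else l - k))) \<le> norm (S 0) + 2 * (\<Sum>h\<in>{1..<L}. norm (S h))" by simp
  qed
  also have "\<dots> = real L * (norm (S 0) + 2 * (\<Sum>h\<in>{1..<L}. norm (S h)))" by simp
  also have "norm (S 0) = (\<Sum>d\<in>I. w d)"
  proof -
    have "S 0 = of_real (\<Sum>d\<in>I. w d)" by (simp add: S_def)
    thus ?thesis using w by (simp only: norm_of_real) (simp add: sum_nonneg)
  qed
  finally have "(\<Sum>d\<in>I. w d * (norm (\<Sum>k<L. ee (real k * y d)))\<^sup>2) / (real L)\<^sup>2 \<le>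
     real L * ((\<Sum>d\<in>I. w d) + 2 * (\<Sum>h\<in>{1..<L}. norm (S h))) / (real L)\<^sup>2"
    by (intro divide_right_mono) auto
  also have "\<dots> = (1 / real L) * ((\<Sum>d\<in>I. w d) + 2 * (\<Sum>h\<in>{1..<L}. norm (S h)))"
    using L by (simp add: power2_eq_square)
  finally show ?thesis by (simp add: fejer_def S_def sum_divide_distrib)
qed

text \<open>In the majorant of the truncation error the weight 1/2^j and the factor 1/2^(J - j) of
  the Fejer sum multiply to 1/2^J, so all J + 1 scales have the same bound.\<close>

lemma sum_saw_poly_error_le:
  fixes w :: "'a \<Rightarrow> real" and y :: "'a \<Rightarrow> real"
  assumes w: "\<And>d. d \<in> I \<Longrightarrow> w d \<ge> 0"
  shows "(\<Sum>d\<in>I. w d * \<bar>sawtooth (y d) + saw_poly (2 ^ J) (y d)\<bar>) \<le>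
    (8 * (real J + 1) / 2 ^ J) * ((\<Sum>d\<in>I. w d) + 2 * (\<Sum>h\<in>{1..<2 ^ J}. norm (\<Sum>d\<in>I. of_real (w d) * ee (real h * y d))))"
proof -
  define T where "T L = (\<Sum>d\<in>I. w d) + 2 * (\<Sum>h\<in>{1..<L}. norm (\<Sum>d\<in>I. of_real (w d) * ee (real h * y d)))" for L :: nat
  have "(\<Sum>d\<in>I. w d * \<bar>sawtooth (y d) + saw_poly (2 ^ J) (y d)\<bar>) \<le> (\<Sum>d\<in>I. w d * (8 * (\<Sum>j\<le>J. fejer (2 ^ (J - j)) (y d) / 2 ^ j)))"
    using w by (intro sum_mono mult_left_mono saw_poly_approx) auto
  also have "\<dots> = (\<Sum>d\<in>I. \<Sum>j\<le>J. (8 / 2 ^ j) * (w d * fejer (2 ^ (J - j)) (y d)))"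
    by (simp add: sum_distrib_left mult_ac)
  also have "\<dots> = (\<Sum>j\<le>J. (8 / 2 ^ j) * (\<Sum>d\<in>I. w d * fejer (2 ^ (J - j)) (y d)))"
    unfolding sum_distrib_left by (rule sum.swap)
  also have "\<dots> \<le> (\<Sum>j\<le>J. 8 / 2 ^ J * T (2 ^ J))"
  proof (rule sum_mono)
    fix j assume j: "j \<in> {..J}"
    have p: "(2::real) ^ J = 2 ^ (J - j) * 2 ^ j" using j by (simp flip: power_add)
    have "(8 / 2 ^ j) * (\<Sum>d\<in>I. w d * fejer (2 ^ (J - j)) (y d)) \<le> (8 / 2 ^ j) * ((1 / real (2 ^ (J - j))) * T (2 ^ (J - j)))"
      unfolding T_def using w by (intro mult_left_mono sum_fejer_le) auto
    also have "\<dots> = 8 / 2 ^ J * T (2 ^ (J - j))" unfolding p by simp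
    also have "T (2 ^ (J - j)) \<le> T (2 ^ J)"
    proof -
      have "(2::nat) ^ (J - j) \<le> 2 ^ J" by (intro power_increasing) auto
      thus ?thesis unfolding T_def by (intro add_left_mono mult_left_mono sum_mono2) auto
    qed
    finally show "(8 / 2 ^ j) * (\<Sum>d\<in>I. w d * fejer (2 ^ (J - j)) (y d)) \<le> 8 / 2 ^ J * T (2 ^ J)"
      by (simp add: mult_left_mono divide_right_mono)
  qed
  also have "\<dots> = (8 * (real J + 1) / 2 ^ J) * T (2 ^ J)" by simp
  finally show ?thesis by (simp add: T_def)
qed

section \<open>The sums over dyadic blocks\<close>

text \<open>The mean value theorem in the shift \<open>t\<close> produces the weight $x/(d+t)^2$, which is monotone in \<open>d\<close> and is
  removed by Abel summation.\<close>

lemma exp_phase_difference: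
  fixes x :: real and c :: "nat \<Rightarrow> real"
  assumes x: "x > 0" and D: "D > 0" and D': "D \<le> D'"
  obtains t D'' where "0 \<le> t" "t \<le> 1" "D'' \<le> D'"
    "norm (\<Sum>d\<in>{D<..D'}. of_real (c d) * (ee (x / (real d + 1)) - ee (x / real d)))
      \<le> 2 * pi * x / (real D)\<^sup>2 * norm (\<Sum>d\<in>{D<..D''}. of_real (c d) * ee (x / (real d + t)))"
proof -
  have cis_exp: "cis = (\<lambda>t. exp (\<i> * of_real t))" by (rule ext) (rule cis_conv_exp)
  define G where "G t = (\<Sum>d\<in>{D<..D'}. of_real (c d) * ee (x / (real d + t)))" for t
  define G' where "G' t = (\<Sum>d\<in>{D<..D'}. of_real (c d) * (\<i> * of_real (2 * pi * (- x / (real d + t)\<^sup>2)) * ee (x / (real d + t))))" for t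
  have dG: "(G has_vector_derivative G' t) (at t)" if t: "t \<ge> 0" for t
  proof -
    have dd: "((\<lambda>t. ee (x / (real d + t))) has_vector_derivative \<i> * of_real (2 * pi * (- x / (real d + t)\<^sup>2)) * ee (x / (real d + t))) (at t)"
      if d: "d > D" for d
    proof -
      have pos: "real d + t > 0" using d t by simp
      have 1: "((\<lambda>t. 2 * pi * (x / (real d + t))) has_vector_derivative 2 * pi * (- x / (real d + t)\<^sup>2)) (at t)"
        unfolding has_real_derivative_iff_has_vector_derivative[symmetric]
        using pos by (auto intro!: derivative_eq_intros simp: field_simps power2_eq_square)
      have 2: "(cis has_vector_derivative \<i> * cis y) (at y)" for y
        using exp_scaleR_has_vector_derivative_right[of \<i> y UNIV]
        by (simp add: cis_exp scaleR_conv_of_real mult.commute)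
      from vector_diff_chain_at[OF 1 2]
      show ?thesis unfolding ee_def o_def by (simp add: scaleR_conv_of_real mult_ac)
    qed
    show ?thesis unfolding G_def G'_def
      by (intro has_vector_derivative_sum has_vector_derivative_mult_right dd) auto
  qed
  have "\<exists>t\<in>{0<..<1}. norm (G 1 - G 0) \<le> norm ((1 - 0) *\<^sub>R G' t)"
  proof (rule mvt_general)
    show "continuous_on {0..1} G"
      using dG by (intro continuous_at_imp_continuous_on ballI has_vector_derivative_continuous) auto
    show "(G has_derivative (\<lambda>h. h *\<^sub>R G' t)) (at t)" if "0 < t" "t < 1" for t
      using dG[of t] that by (simp add: has_vector_derivative_def)
  qed auto
  then obtain t where t': "t \<in> {0<..<1}" "norm (G 1 - G 0) \<le> norm ((1 - 0) *\<^sub>R G' t)" by blast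
  hence t: "0 \<le> t" "t \<le> 1" "norm (G 1 - G 0) \<le> norm (G' t)" by auto
  define z where "z d = of_real (c d) * ee (x / (real d + t))" for d
  define w where "w d = 1 / (real d + t)\<^sup>2" for d :: nat
  define N where "N r = norm (\<Sum>d\<in>{D + 1..<r}. z d)" for r
  \<comment> \<open>The maximal norm of a partial sum controls the whole Abel summation; the place
    where it is attained supplies \<open>D''\<close>.\<close>
  define B where "B = Max (N ` {D + 1..D' + 1})"
  have "B \<in> N ` {D + 1..D' + 1}" unfolding B_def using D' by (intro Max_in) auto
  then obtain r where r: "r \<in> {D + 1..D' + 1}" "B = N r" by blast
  have B: "N q \<le> B" if "D + 1 \<le> q" "q \<le> D' + 1" for q unfolding B_def using that by (intro Max_ge) auto
  have iv: "{D + 1..<D' + 1} = {D<..D'}" "{D + 1..<r} = {D<..r - 1}" using r by auto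
  have B0: "B \<ge> 0" using r by (simp add: N_def)
  have "norm (\<Sum>d\<in>{D + 1..<D' + 1}. of_real (w d) * z d) \<le> 1 / (real D)\<^sup>2 * B"
  proof (cases "D < D'")
    case True
    have "norm (\<Sum>d\<in>{D + 1..<D' + 1}. of_real (w d) * z d) \<le> w (D + 1) * B"
    proof (rule abel_antimono)
      show "norm (sum z {D + 1..<q}) \<le> B" if "D + 1 \<le> q" "q \<le> D' + 1" for q using B[OF that] by (simp add: N_def)
      show "w (Suc k) \<le> w k" if "D + 1 \<le> k" for k unfolding w_def
        using t that by (intro divide_left_mono power_mono mult_pos_pos) auto
    qed (use True t in \<open>auto simp: w_def\<close>)
    also have "\<dots> \<le> 1 / (real D)\<^sup>2 * B"
      using B0 D t by (intro mult_right_mono) (auto simp: w_def intro!: divide_left_mono power_mono mult_pos_pos)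
    finally show ?thesis .
  qed (use B0 in auto)
  moreover have "norm (G' t) = 2 * pi * x * norm (\<Sum>d\<in>{D + 1..<D' + 1}. of_real (w d) * z d)"
  proof -
    have "G' t = (- \<i> * of_real (2 * pi * x)) * (\<Sum>d\<in>{D<..D'}. of_real (w d) * z d)"
      unfolding G'_def sum_distrib_left by (intro sum.cong refl) (simp add: w_def z_def)
    thus ?thesis unfolding iv using x by (simp add: norm_mult)
  qed
  ultimately have "norm (G' t) \<le> 2 * pi * x * (1 / (real D)\<^sup>2 * B)"
    using x by (simp only:) (intro mult_left_mono, auto)
  hence "norm (G 1 - G 0) \<le> 2 * pi * x / (real D)\<^sup>2 * norm (\<Sum>d\<in>{D<..r - 1}. z d)"
    using t(3) r(2) unfolding N_def iv by simp
  moreover have "G 1 - G 0 = (\<Sum>d\<in>{D<..D'}. of_real (c d) * (ee (x / (real d + 1)) - ee (x / real d)))"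
    unfolding G_def by (simp add: right_diff_distrib sum_subtractf)
  ultimately show ?thesis using t r by (intro that[of t "r - 1"]) (auto simp: z_def)
qed

text \<open>One \<Gamma> bounds all the divisor functions and logarithms that get lost. The range 4
  x^2 is wide enough for integers up to 4 H D, where D and H are at most x.\<close>

locale gamma_params =
  fixes x \<Gamma> :: real and L :: nat
  assumes G1: "\<And>k. 0 < k \<Longrightarrow> real k \<le> 4 * x\<^sup>2 \<Longrightarrow> real (card {d. d dvd k}) \<le> \<Gamma>"
    and G2: "\<And>n. real n \<le> 4 * x \<Longrightarrow> harm n \<le> \<Gamma>" and G3: "ln (2 * x) \<le> \<Gamma>"
    and G4: "real L + 1 \<le> \<Gamma>" "100 * x ^ 3 \<le> 2 ^ L"

text \<open>A saving of $r = D/y^{92}$ suffices when $x/(d+1)$ and $x/d$ are treated separately. For small \<open>H\<close> their difference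
  gains the factor $Hx/D^2 = Hy^{11}/r^2$, and the saving $Hy^{11}/r$ suffices.\<close>

lemma exp_sum_params_powers:
  fixes y r x \<Gamma> :: real
  assumes y: "y \<ge> 128" and x: "x = y ^ 195" and r: "1 \<le> r" "r \<le> y ^ 11" and D: "real D = y ^ 92 * r"
    and H: "1 \<le> H" "real H \<le> r" and s: "s = min r (real H * (y ^ 11 / r))"
    and U: "U = nat \<lceil>2 * (y ^ 11 * r\<^sup>2)\<rceil> + 2"
    and G: "gamma_params x \<Gamma> L"
  shows "exp_sum_params x s \<Gamma> H D U L"
proof -
  interpret gamma_params x \<Gamma> L by (rule G)
  define V where "V = y ^ 11 / r"
  have y0: "y > 0" "y \<ge> 1" using y by auto
  have V: "V \<ge> 1" "V * r = y ^ 11" using r by (auto simp: V_def)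
  have H1: "real H \<ge> 1" using H by simp
  have HV: "real H * V \<ge> 1" using mult_mono[of 1 "real H" 1 V] H1 V by simp
  have s': "1 \<le> s" "s \<le> r" "s \<le> real H * V" using r HV by (auto simp: s V_def)
  have rk: "r ^ k \<le> y ^ (11 * k)" for k using power_mono[OF r(2), of k] r by (simp add: power_mult)
  have sk: "s ^ k \<le> r ^ k" for k using s' by (intro power_mono) auto
  \<comment> \<open>Since y \<ge> 128, one extra power of y swallows a numerical constant up to
    128.\<close>
  have yk: "128 * y ^ k \<le> y ^ Suc k" for k using y y0 by (simp add: mult_right_mono)
  have Z: "y ^ 11 * r\<^sup>2 = V * r ^ 3" using r by (simp add: V_def power2_eq_square power3_eq_cube)
  have Z1: "1 \<le> y ^ 11 * r\<^sup>2" using mult_mono[of 1 "y ^ 11" 1 "r\<^sup>2"] y0 r by simp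
  \<comment> \<open>\<open>P5\<close> dictates the size of U: as s^4 \<le> r^3 H V, it is enough to
    have U at least 2 V r^3 = 2 y^11 r^2. The matching upper bound serves \<open>P8\<close> and
    \<open>T1\<close>, which want U small.\<close>
  have Ulo: "2 * (V * r ^ 3) \<le> real U"
  proof -
    have "2 * (y ^ 11 * r\<^sup>2) \<le> real (nat \<lceil>2 * (y ^ 11 * r\<^sup>2)\<rceil>)" by linarith
    thus ?thesis unfolding U Z by simp
  qed
  have Uhi: "real U \<le> 5 * (y ^ 11 * r\<^sup>2)"
  proof -
    have "real (nat \<lceil>2 * (y ^ 11 * r\<^sup>2)\<rceil>) \<le> 2 * (y ^ 11 * r\<^sup>2) + 1" using Z1 by linarith
    moreover have "real U = real (nat \<lceil>2 * (y ^ 11 * r\<^sup>2)\<rceil>) + 2" by (simp add: U)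
    ultimately show ?thesis using Z1 by linarith
  qed
  have ymono: "y ^ a \<le> y ^ b" if "a \<le> b" for a b using that y0 by (intro power_increasing) auto
  have xge: "x \<ge> 1" unfolding x using y0 by (simp add: one_le_power)
  have Dx: "real D \<le> x"
  proof -
    have "real D \<le> y ^ 92 * y ^ 11" unfolding D using r y0 by (intro mult_left_mono) auto
    also have "\<dots> \<le> x" unfolding x power_add[symmetric] by (rule ymono) simp
    finally show ?thesis .
  qed
  have Hx: "real H \<le> x"
  proof -
    have "real H \<le> y ^ 11" using H r by linarith
    also have "\<dots> \<le> x" unfolding x by (rule ymono) simp
    finally show ?thesis .
  qed
  have D0: "real D > 0" unfolding D using y0 r by simp
  have DH: "real D * real H \<le> x\<^sup>2" unfolding power2_eq_square using Dx Hx by (intro mult_mono) auto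
  show ?thesis
  proof
    show "1 \<le> H" by (rule H(1))
    show "1 \<le> s" by (rule s')
    show "2 \<le> U" by (simp add: U)
    show "real D \<le> x" by (rule Dx)
    have "64 \<le> y ^ 92 * 1" using ymono[of 1 92] y by simp
    also have "\<dots> \<le> real D" unfolding D using r y0 by (intro mult_left_mono) auto
    finally show "64 \<le> D" by simp
    show "4 * s ^ 8 \<le> real D"
    proof -
      have "4 * s ^ 8 \<le> 4 * (r ^ 7 * r)" using sk[of 8] by (simp add: eval_nat_numeral mult_ac)
      also have "\<dots> \<le> 128 * (y ^ 77 * r)" using rk[of 7] r y0 by (intro mult_mono) auto
      also have "\<dots> = (128 * y ^ 77) * r" by simp
      also have "\<dots> \<le> y ^ 92 * r" using yk[of 77] ymono[of 78 92] r by (intro mult_right_mono) auto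
      finally show ?thesis unfolding D .
    qed
    show "64 * (real H)\<^sup>2 * x\<^sup>2 * s ^ 8 \<le> real D ^ 5"
    proof -
      have "64 * (real H)\<^sup>2 * x\<^sup>2 * s ^ 8 \<le> 64 * r\<^sup>2 * x\<^sup>2 * r ^ 8"
        using H sk[of 8] s' xge by (intro mult_mono power_mono) auto
      also have "\<dots> = 64 * (r ^ 5 * (y ^ 390 * r ^ 5))" unfolding x by (simp flip: power_mult power_add add: mult_ac)
      also have "\<dots> \<le> 128 * (y ^ 55 * (y ^ 390 * r ^ 5))" using rk[of 5] y0 r by (intro mult_mono) auto
      also have "\<dots> = (128 * y ^ 445) * r ^ 5" by (simp flip: power_add mult.assoc)
      also have "\<dots> \<le> y ^ 460 * r ^ 5" using yk[of 445] ymono[of 446 460] r by (intro mult_right_mono) auto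
      also have "\<dots> = real D ^ 5" unfolding D power_mult_distrib by (simp flip: power_mult)
      finally show ?thesis .
    qed
    show "128 * x * s ^ 10 \<le> real D ^ 3"
    proof -
      have "128 * x * s ^ 10 \<le> 128 * x * r ^ 10" using sk[of 10] xge by (intro mult_left_mono) auto
      also have "\<dots> = 128 * (r ^ 7 * (y ^ 195 * r ^ 3))" unfolding x by (simp flip: power_add add: mult_ac)
      also have "\<dots> \<le> 128 * (y ^ 77 * (y ^ 195 * r ^ 3))" using rk[of 7] y0 r by (intro mult_mono) auto
      also have "\<dots> = (128 * y ^ 272) * r ^ 3" by (simp flip: power_add mult.assoc)
      also have "\<dots> \<le> y ^ 276 * r ^ 3" using yk[of 272] ymono[of 273 276] r by (intro mult_right_mono) auto
      also have "\<dots> = real D ^ 3" unfolding D power_mult_distrib by (simp flip: power_mult)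
      finally show ?thesis .
    qed
    show "256 * s ^ 12 * real D \<le> x\<^sup>2"
    proof -
      have "256 * s ^ 12 * real D \<le> 256 * r ^ 12 * (y ^ 92 * r)" unfolding D using sk[of 12] y0 r by (intro mult_mono) auto
      also have "\<dots> = 256 * (r ^ 13 * y ^ 92)" by (simp add: eval_nat_numeral)
      also have "\<dots> \<le> 16384 * (y ^ 143 * y ^ 92)" using rk[of 13] y0 r by (intro mult_mono) auto
      also have "\<dots> = 128 * (128 * y ^ 235)" by (simp flip: power_add)
      also have "\<dots> \<le> 128 * y ^ 236" using yk[of 235] by simp
      also have "\<dots> \<le> y ^ 390" using yk[of 236] ymono[of 237 390] by simp
      finally show ?thesis unfolding x by (simp flip: power_mult)
    qed
    show "2 * s ^ 4 \<le> real H * real U"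
    proof -
      have "2 * s ^ 4 = 2 * (s ^ 3 * s)" by (simp add: eval_nat_numeral)
      also have "\<dots> \<le> 2 * (r ^ 3 * (real H * V))" using sk[of 3] s' r by (intro mult_mono) auto
      also have "\<dots> = real H * (2 * (V * r ^ 3))" by simp
      also have "\<dots> \<le> real H * real U" using Ulo by (intro mult_left_mono) auto
      finally show ?thesis .
    qed
    show "(real D)\<^sup>2 * s\<^sup>2 \<le> real H * x * real U"
    proof -
      have "(real D)\<^sup>2 * s\<^sup>2 \<le> (real D)\<^sup>2 * (r * (real H * V))" unfolding power2_eq_square[of s]
        using s' r by (intro mult_left_mono mult_mono) auto
      also have "\<dots> = real H * y ^ 184 * (V * r ^ 3)" unfolding D power_mult_distrib
        by (simp add: eval_nat_numeral flip: power_mult)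
      also have "\<dots> \<le> real H * x * real U"
      proof (intro mult_mono mult_left_mono)
        show "y ^ 184 \<le> x" unfolding x by (rule ymono) simp
        have "0 \<le> V * r ^ 3" using V r by simp
        thus "V * r ^ 3 \<le> real U" using Ulo by linarith
      qed (use V r xge in auto)
      finally show ?thesis .
    qed
    show "2 * s\<^sup>2 \<le> (real U)\<^sup>2"
    proof -
      have "r * 1 \<le> r ^ 3 * V" using V r power_increasing[of 1 3 r] by (intro mult_mono) auto
      hence "2 * s \<le> real U" using Ulo s' by (simp add: mult.commute)
      hence "(2 * s)\<^sup>2 \<le> (real U)\<^sup>2" using s' by (intro power_mono) auto
      moreover have "2 * s\<^sup>2 \<le> (2 * s)\<^sup>2" by (simp add: power_mult_distrib)
      ultimately show ?thesis by linarith
    qed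
    show "real U ^ 3 \<le> real D"
    proof -
      have "real U ^ 3 \<le> (5 * (y ^ 11 * r\<^sup>2)) ^ 3" using Uhi by (intro power_mono) auto
      also have "\<dots> = 125 * (r ^ 5 * (y ^ 33 * r))" unfolding power_mult_distrib by (simp flip: power_mult add: eval_nat_numeral)
      also have "\<dots> \<le> 128 * (y ^ 55 * (y ^ 33 * r))" using rk[of 5] y0 r by (intro mult_mono) auto
      also have "\<dots> = (128 * y ^ 88) * r" by (simp flip: power_add mult.assoc)
      also have "\<dots> \<le> y ^ 92 * r" using yk[of 88] ymono[of 89 92] r by (intro mult_right_mono) auto
      finally show ?thesis unfolding D .
    qed
    show "(real U)\<^sup>2 * s\<^sup>2 * real H * x \<le> real D ^ 3"
    proof -
      have "(real U)\<^sup>2 * s\<^sup>2 * real H * x \<le> (5 * (y ^ 11 * r\<^sup>2))\<^sup>2 * r\<^sup>2 * r * x"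
        using Uhi s' H xge r y0 by (intro mult_mono power_mono) auto
      also have "\<dots> = 25 * (r ^ 4 * (y ^ 217 * r ^ 3))" unfolding x power_mult_distrib
        by (simp flip: power_mult power_add add: mult_ac) (simp add: eval_nat_numeral)
      also have "\<dots> \<le> 128 * (y ^ 44 * (y ^ 217 * r ^ 3))" using rk[of 4] y0 r by (intro mult_mono) auto
      also have "\<dots> = (128 * y ^ 261) * r ^ 3" by (simp flip: power_add mult.assoc)
      also have "\<dots> \<le> y ^ 276 * r ^ 3" using yk[of 261] ymono[of 262 276] r by (intro mult_right_mono) auto
      also have "\<dots> = real D ^ 3" unfolding D power_mult_distrib by (simp flip: power_mult)
      finally show ?thesis .
    qed
    show "s\<^sup>2 * real D \<le> real H * x"
    proof -
      have "s\<^sup>2 * real D \<le> r\<^sup>2 * (y ^ 92 * r)" unfolding D using sk[of 2] y0 r by (intro mult_mono) auto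
      also have "\<dots> = r ^ 3 * y ^ 92" by (simp add: eval_nat_numeral)
      also have "\<dots> \<le> y ^ 33 * y ^ 92" using rk[of 3] y0 by (intro mult_right_mono) auto
      also have "\<dots> \<le> x" unfolding x power_add[symmetric] by (rule ymono) simp
      also have "\<dots> \<le> real H * x" using H1 xge by simp
      finally show ?thesis .
    qed
    show "real (card {d. d dvd k}) \<le> \<Gamma>" if k: "0 < k" "k \<le> 4 * H * D" for k
    proof (rule G1[OF k(1)])
      have "real k \<le> real (4 * H * D)" using k(2) by (simp only: of_nat_le_iff)
      thus "real k \<le> 4 * x\<^sup>2" using DH by (simp add: mult_ac)
    qed
    show "harm (4 * D) \<le> \<Gamma>" using Dx by (intro G2) auto
    show "ln (2 * real D) \<le> \<Gamma>"
    proof -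
      have "ln (2 * real D) \<le> ln (2 * x)" using Dx D0 by simp
      thus ?thesis using G3 by linarith
    qed
    show "real L + 1 \<le> \<Gamma>" by (rule G4)
    have "100 * x * (real D * real H) \<le> 100 * x * x\<^sup>2" using DH xge by (intro mult_left_mono) auto
    also have "\<dots> = 100 * x ^ 3" by (simp add: eval_nat_numeral)
    finally show "100 * x * real H * real D \<le> 2 ^ L" using G4(2) by (simp add: mult_ac)
  qed
qed


lemma sum_dyadic_blocks:
  fixes f :: "nat \<Rightarrow> real"
  shows "(\<Sum>h\<in>{1..<2 ^ J}. f h) = (\<Sum>i<J. \<Sum>h\<in>{2 ^ i..<2 * 2 ^ i}. f h)"
proof (induction J)
  case (Suc J)
  have "1 \<le> (2::nat) ^ J" by simp
  hence "{1..<2 ^ Suc J} = {1..<2 ^ J} \<union> {2 ^ J..<2 * 2 ^ J :: nat}" by auto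
  hence "(\<Sum>h\<in>{1..<2 ^ Suc J}. f h) = (\<Sum>h\<in>{1..<2 ^ J}. f h) + (\<Sum>h\<in>{2 ^ J..<2 * 2 ^ J}. f h)"
    by (simp only:) (rule sum.union_disjoint, auto)
  thus ?case using Suc by simp
qed simp

text \<open>The truncation errors of the two sawtooth terms are bounded separately, and so are their
  main parts when H V \<ge> r. For H V < r the factor H x / D^2 gained from the phase difference
  makes the saving H V enough: (H x / D^2) D / (H V) = x / (D V) = y^92.\<close>

lemma sawtooth_sum_bound:
  fixes y x \<Gamma> :: real
  assumes y: "y \<ge> 128" and x: "x = y ^ 195" and G: "gamma_params x \<Gamma> L"
    and D: "y ^ 92 \<le> real D" "real D \<le> y ^ 103" and D': "D \<le> D'" "D' \<le> 2 * D"
  shows "\<bar>\<Sum>d\<in>{D<..D'}. mangoldt d * (sawtooth (x / (real d + 1)) - sawtooth (x / real d))\<bar> \<le> 110000 * \<Gamma> ^ 7 * y ^ 92"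
proof -
  interpret gamma_params x \<Gamma> L by (rule G)
  define r where "r = real D / y ^ 92"
  define V where "V = y ^ 11 / r"
  have y0: "y > 0" "y \<ge> 1" using y by auto
  have Dr: "real D = y ^ 92 * r" using y0 by (simp add: r_def)
  have r: "1 \<le> r" "r \<le> y ^ 11"
  proof -
    show "1 \<le> r" using D(1) y0 by (simp add: r_def)
    have "y ^ 103 = y ^ 11 * y ^ 92" by (simp flip: power_add)
    thus "r \<le> y ^ 11" using D(2) y0 by (simp add: r_def divide_le_eq)
  qed
  have V1: "V \<ge> 1" "V * r = y ^ 11" using r by (auto simp: V_def)
  hence V: "V \<ge> 1" "V > 0" "V * r = y ^ 11" by auto
  have x1: "x \<ge> 1" unfolding x using y0 by (simp add: one_le_power)
  have xD: "x / (real D * V) = y ^ 92"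
  proof -
    have "real D * V = y ^ 92 * (V * r)" unfolding Dr by simp
    also have "\<dots> = y ^ 103" unfolding V(3) by (simp flip: power_add)
    finally have DV: "real D * V = y ^ 103" .
    have xy: "x = y ^ 92 * y ^ 103" unfolding x by (simp flip: power_add)
    show ?thesis unfolding DV xy by (rule nonzero_mult_div_cancel_right) (use y0 in simp)
  qed
  \<comment> \<open>The least J with r \<le> 2^J: the truncation is long enough, and yet every
    dyadic block starts at some 2^i < r, as \<open>exp_sum_params_powers\<close> requires.\<close>
  define J where "J = (LEAST J. r \<le> 2 ^ J)"
  have J: "r \<le> 2 ^ J"
  proof -
    obtain n where "r < 2 ^ n" using real_arch_pow[of 2 r] by auto
    hence "r \<le> 2 ^ n" by simp
    thus ?thesis unfolding J_def by (rule LeastI)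
  qed
  have iJ: "2 ^ i < r" if "i < J" for i
    using not_less_Least[of i "\<lambda>J. r \<le> 2 ^ J"] that by (simp add: J_def)
  have JL: "real J + 1 \<le> \<Gamma>"
  proof -
    have "J \<le> L"
    proof (cases J)
      case (Suc J')
      have "(2::real) ^ J = 2 * 2 ^ J'" by (simp add: Suc)
      also have "\<dots> \<le> 2 * y ^ 11" using iJ[of J'] r by (simp add: Suc)
      also have "\<dots> \<le> 2 * x" unfolding x using y0 by (intro mult_left_mono power_increasing) auto
      also have "\<dots> \<le> 100 * x ^ 3" using power_increasing[of 1 3 x] x1 by simp
      also have "\<dots> \<le> 2 ^ L" by (rule G4)
      finally show ?thesis by simp
    qed auto
    thus ?thesis using G4(1) by linarith
  qed
  have \<Gamma>: "\<Gamma> \<ge> 1" using G4(1) by linarith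
  define s where "s i = min r (2 ^ i * V)" for i :: nat
  have s0: "s i > 0" for i using r V by (simp add: s_def)
  have ES: "(\<Sum>h\<in>{2 ^ i..<2 * 2 ^ i}. norm (\<Sum>d\<in>{D<..E h}. of_real (mangoldt d) * ee (real h * x / (real d + t h))))
     \<le> 2176 * \<Gamma> ^ 5 * (2 ^ i * real D) / s i"
    if i: "i < J" and t: "\<And>h. 0 \<le> t h \<and> t h \<le> 1" and E: "\<And>h. E h \<le> 2 * D" for i t E
  proof -
    interpret exp_sum_params x "s i" \<Gamma> "2 ^ i" D "nat \<lceil>2 * (y ^ 11 * r\<^sup>2)\<rceil> + 2" L
      by (rule exp_sum_params_powers[OF y x r Dr _ _ _ refl G]) (use iJ[OF i] in \<open>auto simp: s_def V_def\<close>)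
    show ?thesis using mangoldt_exp_sum[of t E, OF t E] by simp
  qed
  define S where "S t h = norm (\<Sum>d\<in>{D<..D'}. of_real (mangoldt d) * ee (real h * (x / (real d + t))))" for t :: real and h :: nat
  have ES': "(\<Sum>h\<in>{2 ^ i..<2 * 2 ^ i}. S t h) \<le> 2176 * \<Gamma> ^ 5 * (2 ^ i * real D) / s i"
    if "i < J" "0 \<le> t" "t \<le> 1" for i t
    using ES[of i "\<lambda>_. t" "\<lambda>_. D'"] that D' by (simp add: S_def)
  have ES1: "(\<Sum>h\<in>{1..<2 ^ J}. S t h) \<le> 2176 * \<Gamma> ^ 6 * real D" if t: "0 \<le> t" "t \<le> 1" for t
  proof -
    have "(\<Sum>h\<in>{1..<2 ^ J}. S t h) \<le> (\<Sum>i<J. 2176 * \<Gamma> ^ 5 * real D)"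
      unfolding sum_dyadic_blocks
    proof (rule sum_mono)
      fix i assume i: "i \<in> {..<J}"
      have "2 ^ i \<le> s i" using iJ[of i] i V by (simp add: s_def)
      hence "2 ^ i / s i \<le> 1" using s0[of i] by simp
      hence "2176 * \<Gamma> ^ 5 * real D * (2 ^ i / s i) \<le> 2176 * \<Gamma> ^ 5 * real D * 1"
        using \<Gamma> by (intro mult_left_mono) auto
      thus "(\<Sum>h\<in>{2 ^ i..<2 * 2 ^ i}. S t h) \<le> 2176 * \<Gamma> ^ 5 * real D"
        using ES'[of i t] i t by (simp add: mult_ac)
    qed
    also have "\<dots> = real J * (2176 * \<Gamma> ^ 5 * real D)" by simp
    also have "\<dots> \<le> \<Gamma> * (2176 * \<Gamma> ^ 5 * real D)" using JL \<Gamma> by (intro mult_right_mono) auto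
    finally show ?thesis by (simp add: eval_nat_numeral mult_ac)
  qed
  have Lam: "(\<Sum>d\<in>{D<..D'}. mangoldt d) \<le> \<Gamma> ^ 6 * real D"
  proof -
    have Dx: "real D \<le> x" unfolding x using D(2) y0 power_increasing[of 103 195 y] by linarith
    have "(\<Sum>d\<in>{D<..D'}. mangoldt d) \<le> (\<Sum>d\<in>{D<..D'}. \<Gamma>)"
    proof (rule sum_mono)
      fix d assume d: "d \<in> {D<..D'}"
      have "mangoldt d \<le> ln (real d)" using d by (intro mangoldt_le) auto
      also have "\<dots> \<le> ln (2 * x)"
      proof -
        have "real d \<le> real (2 * D)" using d D' by (simp only: of_nat_le_iff) auto
        thus ?thesis using d Dx by simp
      qed
      also have "\<dots> \<le> \<Gamma>" by (rule G3)
      finally show "mangoldt d \<le> \<Gamma>" .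
    qed
    also have "\<dots> = real (D' - D) * \<Gamma>" by simp
    also have "\<dots> \<le> real D * \<Gamma> ^ 6" using D' \<Gamma> power_increasing[of 1 6 \<Gamma>] by (intro mult_mono) auto
    finally show ?thesis by (simp add: mult.commute)
  qed
  have Err: "(\<Sum>d\<in>{D<..D'}. mangoldt d * \<bar>sawtooth (x / (real d + t)) + saw_poly (2 ^ J) (x / (real d + t))\<bar>) \<le> 34824 * \<Gamma> ^ 7 * y ^ 92"
    if t: "0 \<le> t" "t \<le> 1" for t
  proof -
    have "(\<Sum>d\<in>{D<..D'}. mangoldt d * \<bar>sawtooth (x / (real d + t)) + saw_poly (2 ^ J) (x / (real d + t))\<bar>) \<le>
      (8 * (real J + 1) / 2 ^ J) * ((\<Sum>d\<in>{D<..D'}. mangoldt d) + 2 * (\<Sum>h\<in>{1..<2 ^ J}. S t h))"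
      unfolding S_def using sum_saw_poly_error_le[of "{D<..D'}" mangoldt "\<lambda>d. x / (real d + t)" J] mangoldt_nonneg by simp
    also have "\<dots> \<le> (8 * \<Gamma> / r) * (\<Gamma> ^ 6 * real D + 2 * (2176 * \<Gamma> ^ 6 * real D))"
    proof (intro mult_mono add_mono Lam mult_left_mono ES1 t)
      show "8 * (real J + 1) / 2 ^ J \<le> 8 * \<Gamma> / r" using JL J r \<Gamma> by (intro frac_le) auto
    qed (use \<Gamma> r mangoldt_nonneg in \<open>auto simp: S_def intro!: add_nonneg_nonneg sum_nonneg\<close>)
    also have "\<dots> = 34824 * \<Gamma> ^ 7 * y ^ 92" unfolding Dr using r by (simp add: field_simps eval_nat_numeral)
    finally show ?thesis .
  qed
  define \<Delta> where "\<Delta> h = (\<Sum>d\<in>{D<..D'}. of_real (mangoldt d) * (ee (real h * x / (real d + 1)) - ee (real h * x / real d)))" for h :: nat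
  have D0: "D > 0" using D(1) y0 by (intro Nat.gr0I) (auto simp: power_le_zero_eq not_le)
  have main: "(\<Sum>h\<in>{2 ^ i..<2 * 2 ^ i}. norm (\<Delta> h) / real h) \<le> 34816 * \<Gamma> ^ 5 * y ^ 92" if i: "i < J" for i
  proof -
    have total: "(\<Sum>h\<in>{2 ^ i..<2 * 2 ^ i}. norm (\<Delta> h)) \<le> 2 ^ i * (34816 * \<Gamma> ^ 5 * y ^ 92)"
    proof (cases "r \<le> 2 ^ i * V")
      case True
      hence si: "s i = r" by (simp add: s_def)
      have "norm (\<Delta> h) \<le> S 1 h + S 0 h" for h
        unfolding \<Delta>_def S_def right_diff_distrib sum_subtractf
        using norm_triangle_ineq4 by simp
      hence "(\<Sum>h\<in>{2 ^ i..<2 * 2 ^ i}. norm (\<Delta> h)) \<le> (\<Sum>h\<in>{2 ^ i..<2 * 2 ^ i}. S 1 h + S 0 h)" by (intro sum_mono)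
      also have "\<dots> \<le> 2176 * \<Gamma> ^ 5 * (2 ^ i * real D) / r + 2176 * \<Gamma> ^ 5 * (2 ^ i * real D) / r"
        unfolding sum.distrib using ES'[OF i, of 1] ES'[OF i, of 0] unfolding si by (intro add_mono) auto
      also have "\<dots> = 2 ^ i * (4352 * \<Gamma> ^ 5 * y ^ 92)" unfolding Dr using r by simp
      also have "\<dots> \<le> 2 ^ i * (34816 * \<Gamma> ^ 5 * y ^ 92)" using \<Gamma> y0 by (intro mult_left_mono mult_right_mono) auto
      finally show ?thesis .
    next
      case False
      hence si: "s i = 2 ^ i * V" by (simp add: s_def)
      define Q where "Q h p \<longleftrightarrow> 0 \<le> fst p \<and> fst p \<le> 1 \<and> snd p \<le> D' \<and>
        norm (\<Delta> h) \<le> 2 * pi * (real h * x) / (real D)\<^sup>2 *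
          norm (\<Sum>d\<in>{D<..snd p}. of_real (mangoldt d) * ee (real h * x / (real d + fst p)))" for h :: nat and p :: "real \<times> nat"
      \<comment> \<open>The shift and the end point from \<open>exp_phase_difference\<close> differ
        from one h to the next, so they are chosen as functions of h.\<close>
      have "\<forall>h\<in>{2 ^ i..<2 * 2 ^ i}. \<exists>p. Q h p"
      proof
        fix h :: nat assume h: "h \<in> {2 ^ i..<2 * 2 ^ i}"
        have "(2::nat) ^ i > 0" by simp
        hence "h > 0" using h unfolding atLeastLessThan_iff by linarith
        hence hx: "real h * x > 0" using x1 by simp
        obtain t E where "0 \<le> t" "t \<le> 1" "E \<le> D'"
          "norm (\<Delta> h) \<le> 2 * pi * (real h * x) / (real D)\<^sup>2 * norm (\<Sum>d\<in>{D<..E}. of_real (mangoldt d) * ee (real h * x / (real d + t)))"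
          unfolding \<Delta>_def by (rule exp_phase_difference[OF hx D0 D'(1), of mangoldt])
        hence "Q h (t, E)" by (simp add: Q_def)
        thus "\<exists>p. Q h p" by blast
      qed
      from bchoice[OF this] obtain f where f: "\<forall>h\<in>{2 ^ i..<2 * 2 ^ i}. Q h (f h)" by blast
      define t E where "t h = fst (f h)" and "E h = snd (f h)" for h
      have tE: "0 \<le> t h \<and> t h \<le> 1 \<and> E h \<le> D' \<and>
        norm (\<Delta> h) \<le> 2 * pi * (real h * x) / (real D)\<^sup>2 * norm (\<Sum>d\<in>{D<..E h}. of_real (mangoldt d) * ee (real h * x / (real d + t h)))"
        if "h \<in> {2 ^ i..<2 * 2 ^ i}" for h
        using bspec[OF f that] unfolding Q_def t_def E_def .
      \<comment> \<open>Default value 0 outside the block, for the shift and for the end point,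
        because \<open>ES\<close> requires its bounds for all h.\<close>
      define t' where "t' h = (if h \<in> {2 ^ i..<2 * 2 ^ i} then t h else 0)" for h
      define E' where "E' h = (if h \<in> {2 ^ i..<2 * 2 ^ i} then E h else 0)" for h
      define c where "c = 16 * 2 ^ i * x / (real D)\<^sup>2"
      have c0: "c \<ge> 0" using x1 by (simp add: c_def)
      have "(\<Sum>h\<in>{2 ^ i..<2 * 2 ^ i}. norm (\<Delta> h)) \<le>
        (\<Sum>h\<in>{2 ^ i..<2 * 2 ^ i}. c * norm (\<Sum>d\<in>{D<..E' h}. of_real (mangoldt d) * ee (real h * x / (real d + t' h))))"
      proof (rule sum_mono)
        fix h :: nat assume h: "h \<in> {2 ^ i..<2 * 2 ^ i}"
        have "2 * pi * (real h * x) / (real D)\<^sup>2 \<le> c" unfolding c_def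
        proof (rule divide_right_mono)
          have "real h \<le> real (2 * 2 ^ i)" using h by (simp only: of_nat_le_iff) auto
          hence "real h \<le> 2 * 2 ^ i" by simp
          hence "2 * pi * (real h * x) \<le> 8 * ((2 * 2 ^ i) * x)"
            using pi_less_4 x1 by (intro mult_mono) auto
          thus "2 * pi * (real h * x) \<le> 16 * 2 ^ i * x" by simp
        qed simp
        hence "2 * pi * (real h * x) / (real D)\<^sup>2 * norm (\<Sum>d\<in>{D<..E h}. of_real (mangoldt d) * ee (real h * x / (real d + t h)))
          \<le> c * norm (\<Sum>d\<in>{D<..E h}. of_real (mangoldt d) * ee (real h * x / (real d + t h)))"
          by (rule mult_right_mono) simp
        thus "norm (\<Delta> h) \<le> c * norm (\<Sum>d\<in>{D<..E' h}. of_real (mangoldt d) * ee (real h * x / (real d + t' h)))"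
          using tE[OF h] h by (simp add: E'_def t'_def)
      qed
      also have "\<dots> = c * (\<Sum>h\<in>{2 ^ i..<2 * 2 ^ i}. norm (\<Sum>d\<in>{D<..E' h}. of_real (mangoldt d) * ee (real h * x / (real d + t' h))))"
        by (rule sum_distrib_left[symmetric])
      also have "\<dots> \<le> c * (2176 * \<Gamma> ^ 5 * (2 ^ i * real D) / s i)"
      proof (intro mult_left_mono ES i c0)
        show "0 \<le> t' h \<and> t' h \<le> 1" for h using tE[of h] by (simp add: t'_def)
        show "E' h \<le> 2 * D" for h using tE[of h] D'(2) by (auto simp: E'_def)
      qed
      also have "\<dots> = 2 ^ i * (34816 * \<Gamma> ^ 5 * (x / (real D * V)))"
        unfolding si c_def using V D0 by (simp add: field_simps power2_eq_square)
      finally show ?thesis unfolding xD .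
    qed
    have "(\<Sum>h\<in>{2 ^ i..<2 * 2 ^ i}. norm (\<Delta> h) / real h) \<le> (\<Sum>h\<in>{2 ^ i..<2 * 2 ^ i}. norm (\<Delta> h) / 2 ^ i)"
    proof (rule sum_mono)
      fix h :: nat assume h: "h \<in> {2 ^ i..<2 * 2 ^ i}"
      have "real (2 ^ i) \<le> real h" using h by (simp only: of_nat_le_iff) auto
      thus "norm (\<Delta> h) / real h \<le> norm (\<Delta> h) / 2 ^ i" by (intro divide_left_mono mult_pos_pos) (auto intro: less_le_trans[of 0 "2 ^ i"])
    qed
    also have "\<dots> = (\<Sum>h\<in>{2 ^ i..<2 * 2 ^ i}. norm (\<Delta> h)) / 2 ^ i" by (rule sum_divide_distrib[symmetric])
    also have "\<dots> \<le> 2 ^ i * (34816 * \<Gamma> ^ 5 * y ^ 92) / 2 ^ i" by (rule divide_right_mono[OF total]) simp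
    finally show ?thesis by simp
  qed
  have mainsum: "\<bar>\<Sum>d\<in>{D<..D'}. mangoldt d * (saw_poly (2 ^ J) (x / (real d + 1)) - saw_poly (2 ^ J) (x / real d))\<bar> \<le> 34816 * \<Gamma> ^ 7 * y ^ 92"
  proof -
    \<comment> \<open>The sines are imaginary parts of exponentials; exchanging the sums brings out
      the \<open>\<Delta> h\<close> with weights 1/(pi h).\<close>
    have im: "(\<Sum>d\<in>{D<..D'}. mangoldt d * (saw_poly (2 ^ J) (x / (real d + 1)) - saw_poly (2 ^ J) (x / real d))) =
       (\<Sum>h\<in>{1..<2 ^ J}. Im (\<Delta> h) / (pi * real h))"
    proof -
      have "(\<Sum>d\<in>{D<..D'}. mangoldt d * (saw_poly (2 ^ J) (x / (real d + 1)) - saw_poly (2 ^ J) (x / real d))) =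
        (\<Sum>d\<in>{D<..D'}. \<Sum>h\<in>{1..<2 ^ J}. mangoldt d * (Im (ee (real h * x / (real d + 1))) - Im (ee (real h * x / real d))) / (pi * real h))"
        unfolding saw_poly_def sum_subtractf[symmetric] sum_distrib_left
        by (intro sum.cong refl) (simp add: ee_def right_diff_distrib diff_divide_distrib)
      also have "\<dots> = (\<Sum>h\<in>{1..<2 ^ J}. \<Sum>d\<in>{D<..D'}. mangoldt d * (Im (ee (real h * x / (real d + 1))) - Im (ee (real h * x / real d))) / (pi * real h))"
        by (rule sum.swap)
      also have "\<dots> = (\<Sum>h\<in>{1..<2 ^ J}. Im (\<Delta> h) / (pi * real h))"
        unfolding sum_divide_distrib[symmetric] by (simp add: \<Delta>_def Im_sum)
      finally show ?thesis .
    qed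
    have "\<bar>\<Sum>h\<in>{1..<2 ^ J}. Im (\<Delta> h) / (pi * real h)\<bar> \<le> (\<Sum>h\<in>{1..<2 ^ J}. norm (\<Delta> h) / real h)"
    proof (rule order_trans[OF sum_abs], rule sum_mono)
      fix h :: nat assume h: "h \<in> {1..<2 ^ J}"
      have "\<bar>Im (\<Delta> h)\<bar> / (pi * real h) \<le> norm (\<Delta> h) / (1 * real h)"
        using h pi_ge_two abs_Im_le_cmod by (intro frac_le mult_right_mono) auto
      thus "\<bar>Im (\<Delta> h) / (pi * real h)\<bar> \<le> norm (\<Delta> h) / real h" by (simp add: abs_divide abs_mult)
    qed
    also have "\<dots> \<le> (\<Sum>i<J. 34816 * \<Gamma> ^ 5 * y ^ 92)" unfolding sum_dyadic_blocks by (intro sum_mono main) auto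
    also have "\<dots> = real J * (34816 * \<Gamma> ^ 5 * y ^ 92)" by simp
    also have "\<dots> \<le> \<Gamma>\<^sup>2 * (34816 * \<Gamma> ^ 5 * y ^ 92)"
    proof (rule mult_right_mono)
      have "\<Gamma> * 1 \<le> \<Gamma> * \<Gamma>" using \<Gamma> by (intro mult_left_mono) auto
      thus "real J \<le> \<Gamma>\<^sup>2" using JL unfolding power2_eq_square by linarith
    qed (use \<Gamma> y0 in auto)
    finally show ?thesis unfolding im by (simp add: eval_nat_numeral mult_ac)
  qed
  define e where "e t d = sawtooth (x / (real d + t)) + saw_poly (2 ^ J) (x / (real d + t))" for t :: real and d :: nat
  have e_le: "\<bar>\<Sum>d\<in>{D<..D'}. mangoldt d * e t d\<bar> \<le> 34824 * \<Gamma> ^ 7 * y ^ 92" if "0 \<le> t" "t \<le> 1" for t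
  proof -
    have "\<bar>\<Sum>d\<in>{D<..D'}. mangoldt d * e t d\<bar> \<le> (\<Sum>d\<in>{D<..D'}. mangoldt d * \<bar>e t d\<bar>)"
      by (rule order_trans[OF sum_abs]) (simp add: abs_mult)
    with Err[OF that] show ?thesis by (simp add: e_def)
  qed
  have "(\<Sum>d\<in>{D<..D'}. mangoldt d * (sawtooth (x / (real d + 1)) - sawtooth (x / real d))) =
    (\<Sum>d\<in>{D<..D'}. mangoldt d * e 1 d) - (\<Sum>d\<in>{D<..D'}. mangoldt d * e 0 d) -
    (\<Sum>d\<in>{D<..D'}. mangoldt d * (saw_poly (2 ^ J) (x / (real d + 1)) - saw_poly (2 ^ J) (x / real d)))"
    unfolding sum_subtractf[symmetric] by (intro sum.cong refl) (simp add: e_def algebra_simps)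
  hence "\<bar>\<Sum>d\<in>{D<..D'}. mangoldt d * (sawtooth (x / (real d + 1)) - sawtooth (x / real d))\<bar> \<le>
     34824 * \<Gamma> ^ 7 * y ^ 92 + 34824 * \<Gamma> ^ 7 * y ^ 92 + 34816 * \<Gamma> ^ 7 * y ^ 92"
    using e_le[of 1] e_le[of 0] mainsum by linarith
  also have "\<dots> = 104464 * (\<Gamma> ^ 7 * y ^ 92)" by simp
  also have "\<dots> \<le> 110000 * (\<Gamma> ^ 7 * y ^ 92)" using \<Gamma> y0 by (intro mult_right_mono) auto
  finally show ?thesis by simp
qed

text \<open>Induction on the number of doublings of K; the last block may be incomplete.\<close>

lemma sum_doubling_bound:
  fixes f :: "nat \<Rightarrow> real"
  assumes B: "\<And>D D'. K \<le> D \<Longrightarrow> D \<le> D' \<Longrightarrow> D' \<le> 2 * D \<Longrightarrow> D' \<le> N \<Longrightarrow> \<bar>\<Sum>d\<in>{D<..D'}. f d\<bar> \<le> B"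
    and KN: "K \<le> N"
  shows "M \<le> N \<Longrightarrow> M \<le> K * 2 ^ n \<Longrightarrow> \<bar>\<Sum>d\<in>{K<..M}. f d\<bar> \<le> real n * B"
proof (induction n arbitrary: M)
  case (Suc n)
  have B0: "B \<ge> 0" using B[of K K] KN by simp
  show ?case
  proof (cases "M \<le> K * 2 ^ n")
    case True
    thus ?thesis using Suc.IH[of M] Suc.prems B0 by (simp add: algebra_simps)
  next
    case False
    define D where "D = K * 2 ^ n"
    have D: "K \<le> D" "D \<le> M" "M \<le> 2 * D" using False Suc.prems by (auto simp: D_def)
    have "{K<..M} = {K<..D} \<union> {D<..M}" using D by auto
    hence "(\<Sum>d\<in>{K<..M}. f d) = (\<Sum>d\<in>{K<..D}. f d) + (\<Sum>d\<in>{D<..M}. f d)"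
      by (simp only:) (rule sum.union_disjoint, auto)
    moreover have "\<bar>\<Sum>d\<in>{K<..D}. f d\<bar> \<le> real n * B" using Suc.IH[of D] D Suc.prems by (simp add: D_def)
    moreover have "\<bar>\<Sum>d\<in>{D<..M}. f d\<bar> \<le> B" using D Suc.prems by (intro B) auto
    ultimately show ?thesis by (simp add: algebra_simps)
  qed
qed simp

section \<open>The asymptotic formula\<close>

text \<open>Lets x be replaced by its integer part, so that all counting is done with
  \<open>div\<close>.\<close>

lemma floor_div_real:
  fixes n :: nat and x :: real
  assumes "x \<ge> 0" "n > 0"
  shows "nat \<lfloor>x / real n\<rfloor> = nat \<lfloor>x\<rfloor> div n"
proof -
  define N where "N = nat \<lfloor>x\<rfloor>"
  have N: "real N \<le> x" "x < real N + 1" using assms by (auto simp: N_def)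
  have "N div n * n \<le> N" "N + 1 \<le> (N div n + 1) * n"
    using assms dividend_less_div_times[of n N] by (auto simp: algebra_simps)
  hence "real (N div n * n) \<le> real N" "real (N + 1) \<le> real ((N div n + 1) * n)" by (simp_all only: of_nat_le_iff)
  hence "real (N div n) * real n \<le> x" "x < (real (N div n) + 1) * real n" using N by (simp_all add: algebra_simps)
  hence "real (N div n) \<le> x / real n" "x / real n < real (N div n) + 1"
    using assms by (simp_all add: pos_le_divide_eq pos_divide_less_eq)
  hence "\<lfloor>x / real n\<rfloor> = int (N div n)" by (intro floor_unique) auto
  thus ?thesis by (simp add: N_def)
qed

lemma div_eq_interval:
  fixes d N :: nat
  assumes "d > 0"
  shows "{n \<in> {1..N}. N div n = d} = {N div (d + 1)<..N div d}"
proof (intro equalityI subsetI)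
  fix n assume "n \<in> {n \<in> {1..N}. N div n = d}"
  hence n: "n > 0" "N div n = d" by auto
  have "d * n \<le> N" using n by auto
  moreover have "N < (d + 1) * n" using n dividend_less_div_times[of n N] by (auto simp: algebra_simps)
  ultimately show "n \<in> {N div (d + 1)<..N div d}"
    using assms by (auto simp: less_eq_div_iff_mult_less_eq div_less_iff_less_mult mult.commute)
next
  fix n assume "n \<in> {N div (d + 1)<..N div d}"
  hence n: "N < (d + 1) * n" "d * n \<le> N" "n > 0"
    using assms by (auto simp: less_eq_div_iff_mult_less_eq div_less_iff_less_mult mult.commute)
  have "1 * n \<le> d * n" using assms by (intro mult_right_mono) auto
  hence "n \<le> N" using n(2) by linarith
  moreover have "N div n = d" using n by (intro div_nat_eqI) (auto simp: mult.commute)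
  ultimately show "n \<in> {n \<in> {1..N}. N div n = d}" using n by simp
qed

lemma sum_telescope_interval:
  fixes g :: "nat \<Rightarrow> real"
  shows "a \<le> b \<Longrightarrow> (\<Sum>d\<in>{a<..b}. g d - g (Suc d)) = g (Suc a) - g (Suc b)"
proof (induction b rule: dec_induct)
  case (step n)
  have "{a<..Suc n} = insert (Suc n) {a<..n}" using step by auto
  thus ?case using step by simp
qed simp

lemma S_Lambda_altdef:
  assumes x: "x \<ge> 1" and N: "N = nat \<lfloor>x\<rfloor>"
  shows "S_Lambda x = (\<Sum>d\<in>{1..N}. mangoldt d * (real (N div d) - real (N div Suc d)))"
proof -
  have "{n. 1 \<le> n \<and> real n \<le> x} = {1..N}" using x by (auto simp: N le_nat_floor) linarith
  hence "S_Lambda x = (\<Sum>n\<in>{1..N}. mangoldt (N div n))"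
    unfolding S_Lambda_def N using x by (intro sum.cong) (auto simp: floor_div_real)
  also have "\<dots> = (\<Sum>d\<in>{1..N}. \<Sum>n | n \<in> {1..N} \<and> N div n = d. mangoldt (N div n))"
    by (rule sum.group[symmetric]) (auto simp: Suc_le_eq div_greater_zero_iff)
  also have "\<dots> = (\<Sum>d\<in>{1..N}. mangoldt d * (real (N div d) - real (N div Suc d)))"
  proof (rule sum.cong[OF refl])
    fix d assume d: "d \<in> {1..N}"
    have "(\<Sum>n | n \<in> {1..N} \<and> N div n = d. mangoldt (N div n)) = (\<Sum>n | n \<in> {1..N} \<and> N div n = d. mangoldt d :: real)"
      by (intro sum.cong) auto
    also have "\<dots> = real (card {n \<in> {1..N}. N div n = d}) * mangoldt d" by simp
    also have "card {n \<in> {1..N}. N div n = d} = N div d - N div Suc d"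
      using div_eq_interval[of d N] d by simp
    also have "real \<dots> = real (N div d) - real (N div Suc d)"
      using div_le_mono2[of d "Suc d" N] d by (simp add: of_nat_diff)
    finally show "(\<Sum>n | n \<in> {1..N} \<and> N div n = d. mangoldt (N div n)) = mangoldt d * (real (N div d) - real (N div Suc d))"
      by (simp only: mult.commute)
  qed
  finally show ?thesis .
qed

text \<open>For n \<ge> 1 this is the integral of log t / t^2 from n to infinity. Its decrements
  dominate the terms of the series, which gives convergence and the tail bound at once.\<close>

definition tail_majorant :: "nat \<Rightarrow> real" where
  "tail_majorant n = (ln (real n) + 1) / real n"

lemma mangoldt_series_term_nonneg: "0 \<le> mangoldt_series_term k"
  by (simp add: mangoldt_series_term_def Let_def mangoldt_nonneg)

lemma mangoldt_series_term_le: "mangoldt_series_term k \<le> tail_majorant (Suc k) - tail_majorant (Suc (Suc k))"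
proof -
  define n where "n = real (Suc k)"
  have n: "n \<ge> 1" by (simp add: n_def)
  have "n * (ln (n + 1) - ln n) \<le> 1"
  proof -
    have "1 + 1 / n = (n + 1) / n" using n by (simp add: field_simps)
    hence "ln (n + 1) - ln n = ln (1 + 1 / n)" using n by (simp only:) (simp add: ln_div)
    also have "\<dots> \<le> 1 / n" using n by (intro ln_add_one_self_le_self) auto
    finally have "n * (ln (n + 1) - ln n) \<le> n * (1 / n)" using n by (intro mult_left_mono) auto
    thus ?thesis using n by simp
  qed
  hence le: "ln n \<le> (n + 1) * (ln n + 1) - n * (ln (n + 1) + 1)" by (simp add: algebra_simps)
  have "mangoldt_series_term k \<le> ln n / (n * (n + 1))"
    unfolding mangoldt_series_term_def Let_def n_def
    using mangoldt_le[of "Suc k"] by (intro divide_right_mono) auto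
  also have "\<dots> \<le> ((n + 1) * (ln n + 1) - n * (ln (n + 1) + 1)) / (n * (n + 1))"
    using le n by (intro divide_right_mono) auto
  also have "\<dots> = (ln n + 1) / n - (ln (n + 1) + 1) / (n + 1)" using n by (simp add: field_simps)
  finally show ?thesis by (simp add: tail_majorant_def n_def add.commute)
qed

lemma tail_majorant_nonneg: "0 \<le> tail_majorant (Suc n)"
  by (simp add: tail_majorant_def)

lemma mangoldt_series_block_le: "(\<Sum>k<n. mangoldt_series_term (k + a)) \<le> tail_majorant (Suc a) - tail_majorant (Suc (n + a))"
proof (induction n)
  case (Suc n)
  thus ?case using mangoldt_series_term_le[of "n + a"] by simp
qed simp

lemma summable_mangoldt_series: "summable mangoldt_series_term"
proof (rule summableI_nonneg_bounded[OF mangoldt_series_term_nonneg])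
  show "(\<Sum>k<n. mangoldt_series_term k) \<le> tail_majorant (Suc 0)" for n
    using mangoldt_series_block_le[of 0 n] tail_majorant_nonneg[of n] by simp
qed

lemma mangoldt_series_tail:
  "0 \<le> (\<Sum>k. mangoldt_series_term k) - (\<Sum>k<P. mangoldt_series_term k)"
  "(\<Sum>k. mangoldt_series_term k) - (\<Sum>k<P. mangoldt_series_term k) \<le> tail_majorant (Suc P)"
proof -
  have s: "summable (\<lambda>k. mangoldt_series_term (k + P))" using summable_mangoldt_series by (subst summable_iff_shift)
  have eq: "(\<Sum>k. mangoldt_series_term k) - (\<Sum>k<P. mangoldt_series_term k) = (\<Sum>k. mangoldt_series_term (k + P))"
    by (rule suminf_minus_initial_segment[OF summable_mangoldt_series, symmetric])
  show "0 \<le> (\<Sum>k. mangoldt_series_term k) - (\<Sum>k<P. mangoldt_series_term k)"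
    unfolding eq by (rule suminf_nonneg[OF s mangoldt_series_term_nonneg])
  show "(\<Sum>k. mangoldt_series_term k) - (\<Sum>k<P. mangoldt_series_term k) \<le> tail_majorant (Suc P)"
    unfolding eq
  proof (rule suminf_le_const[OF s])
    show "(\<Sum>k<n. mangoldt_series_term (k + P)) \<le> tail_majorant (Suc P)" for n
      using mangoldt_series_block_le[of P n] tail_majorant_nonneg[of "n + P"] by simp
  qed
qed

text \<open>Every range costs y^92 up to powers of \<Gamma>. A single d \<le> \<open>K\<close>
  contributes at most Lambda(d); for d > \<open>P\<close> the differences telescope to at most x /
  y^103; the blocks between come from \<open>sawtooth_sum_bound\<close>. Completing the series adds
  a tail of order x / y^103.\<close>

lemma S_Lambda_bound:
  fixes y x \<Gamma> :: real
  assumes y: "y \<ge> 128" and x: "x = y ^ 195" and G: "gamma_params x \<Gamma> L"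
  shows "\<bar>S_Lambda x - (\<Sum>k. mangoldt_series_term k) * x\<bar> \<le> 110005 * \<Gamma> ^ 8 * y ^ 92"
proof -
  interpret gamma_params x \<Gamma> L by (rule G)
  have y0: "y > 0" "y \<ge> 1" using y by auto
  have \<Gamma>: "\<Gamma> \<ge> 1" using G4(1) by linarith
  have x1: "x \<ge> 1" unfolding x using y0 by (simp add: one_le_power)
  have xy: "x = y ^ 92 * y ^ 103" unfolding x by (simp flip: power_add)
  have y92: "y ^ 92 \<ge> 1" "y ^ 103 \<ge> 1" using y0 by (auto intro: one_le_power)
  define N where "N = nat \<lfloor>x\<rfloor>"
  define P where "P = nat \<lfloor>y ^ 103\<rfloor>"
  define K where "K = nat \<lceil>y ^ 92\<rceil>"
  have N: "real N \<le> x" "x < real N + 1" using x1 by (auto simp: N_def)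
  have "\<lfloor>y ^ 103\<rfloor> \<ge> 0" using y92(2) by linarith
  hence Pf: "real P = of_int \<lfloor>y ^ 103\<rfloor>" unfolding P_def by simp
  have P: "real P \<le> y ^ 103" "y ^ 103 < real P + 1" unfolding Pf by linarith+
  have P1: "P \<ge> 1" using y92 by (simp add: P_def le_nat_floor)
  have K: "y ^ 92 \<le> real K" "real K \<le> 2 * y ^ 92" using y92 by (auto simp: K_def) linarith+
  have P103: "y ^ 103 \<le> x" unfolding x using y0 by (intro power_increasing) auto
  have PN: "P \<le> N"
  proof -
    have "real P < real N + 1" using P N P103 by linarith
    thus ?thesis by linarith
  qed
  have KP: "K \<le> P"
  proof -
    have "2 * y ^ 92 \<le> y ^ 103"
    proof -
      have "2 * y ^ 92 \<le> y * y ^ 92" using y y0 by (intro mult_right_mono) auto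
      also have "\<dots> = y ^ 93" by (simp flip: power_Suc)
      also have "\<dots> \<le> y ^ 103" using y0 by (intro power_increasing) auto
      finally show ?thesis .
    qed
    hence "real K < real P + 1" using K P by linarith
    thus ?thesis by linarith
  qed
  have lam: "mangoldt d \<le> \<Gamma>" if "d \<in> {1..N}" for d
  proof -
    have "mangoldt d \<le> ln (real d)" using that by (intro mangoldt_le) auto
    also have "\<dots> \<le> ln (2 * x)"
    proof -
      have "real d \<le> real N" using that by simp
      thus ?thesis using that N x1 by simp
    qed
    finally show ?thesis using G3 by linarith
  qed
  define g where "g d = real (N div d)" for d
  define w where "w d = sawtooth (x / (real d + 1)) - sawtooth (x / real d)" for d :: nat
  have g: "g d = x / real d - sawtooth (x / real d) - 1 / 2" if "d > 0" for d
  proof -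
    have "g d = real (nat \<lfloor>x / real d\<rfloor>)" unfolding g_def N_def using floor_div_real[of x d] x1 that by simp
    also have "\<dots> = of_int \<lfloor>x / real d\<rfloor>" using x1 by simp
    finally show ?thesis by (simp add: sawtooth_def frac_def)
  qed
  have gd: "g d - g (Suc d) = x * (1 / (real d * (real d + 1))) + w d" if "d > 0" for d
  proof -
    have "x / real d - x / (real d + 1) = x * (1 / (real d * (real d + 1)))" using that by (simp add: field_simps)
    thus ?thesis unfolding w_def using g[of d] g[of "Suc d"] that by (simp add: add.commute)
  qed
  have S: "S_Lambda x = (\<Sum>d\<in>{1..P}. mangoldt d * (g d - g (Suc d))) + (\<Sum>d\<in>{P<..N}. mangoldt d * (g d - g (Suc d)))"
  proof -
    have "{1..N} = {1..P} \<union> {P<..N}" using PN P1 by auto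
    thus ?thesis unfolding S_Lambda_altdef[OF x1 N_def] g_def
      by (simp only:) (rule sum.union_disjoint, auto)
  qed
  have S2: "\<bar>\<Sum>d\<in>{P<..N}. mangoldt d * (g d - g (Suc d))\<bar> \<le> \<Gamma> * y ^ 92"
  proof -
    have gm: "g d - g (Suc d) \<ge> 0" if "d > 0" for d using div_le_mono2[of d "Suc d" N] that by (simp add: g_def)
    have "\<bar>\<Sum>d\<in>{P<..N}. mangoldt d * (g d - g (Suc d))\<bar> \<le> (\<Sum>d\<in>{P<..N}. \<Gamma> * (g d - g (Suc d)))"
    proof (rule order_trans[OF sum_abs], rule sum_mono)
      fix d assume d: "d \<in> {P<..N}"
      show "\<bar>mangoldt d * (g d - g (Suc d))\<bar> \<le> \<Gamma> * (g d - g (Suc d))"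
        using lam[of d] gm[of d] d mangoldt_nonneg[of d] by (simp add: abs_mult mult_right_mono)
    qed
    also have "\<dots> = \<Gamma> * (g (Suc P) - g (Suc N))"
      unfolding sum_distrib_left[symmetric] sum_telescope_interval[OF PN] ..
    also have "\<dots> \<le> \<Gamma> * y ^ 92"
    proof (rule mult_left_mono)
      have "g (Suc P) \<le> real N / real (Suc P)" unfolding g_def by (rule of_nat_div_le_of_nat)
      also have "\<dots> \<le> x / y ^ 103" using N P y0 x1 by (intro frac_le) auto
      also have "\<dots> = y ^ 92" unfolding xy by (rule nonzero_mult_div_cancel_right) (use y0 in simp)
      finally show "g (Suc P) - g (Suc N) \<le> y ^ 92" by (simp add: g_def)
    qed (use \<Gamma> in auto)
    finally show ?thesis .
  qed
  have S1: "(\<Sum>d\<in>{1..P}. mangoldt d * (g d - g (Suc d))) = x * (\<Sum>k<P. mangoldt_series_term k) + (\<Sum>d\<in>{1..P}. mangoldt d * w d)"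
  proof -
    have "(\<Sum>d\<in>{1..P}. mangoldt d * (g d - g (Suc d))) = (\<Sum>d\<in>{1..P}. x * (mangoldt d / (real d * (real d + 1))) + mangoldt d * w d)"
      by (intro sum.cong refl) (simp add: gd algebra_simps)
    also have "\<dots> = x * (\<Sum>d\<in>{1..P}. mangoldt d / (real d * (real d + 1))) + (\<Sum>d\<in>{1..P}. mangoldt d * w d)"
      by (simp add: sum.distrib sum_distrib_left)
    also have "(\<Sum>d\<in>{1..P}. mangoldt d / (real d * (real d + 1))) = (\<Sum>k<P. mangoldt_series_term k)"
      using sum.atLeast1_atMost_eq[of "\<lambda>d. mangoldt d / (real d * (real d + 1))" P]
      by (simp add: mangoldt_series_term_def Let_def)
    finally show ?thesis .
  qed
  have W: "\<bar>\<Sum>d\<in>{1..P}. mangoldt d * w d\<bar> \<le> 2 * \<Gamma> * y ^ 92 + 110000 * \<Gamma> ^ 8 * y ^ 92"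
  proof -
    have "{1..P} = {1..K} \<union> {K<..P}" using KP K y92 by auto
    hence "(\<Sum>d\<in>{1..P}. mangoldt d * w d) = (\<Sum>d\<in>{1..K}. mangoldt d * w d) + (\<Sum>d\<in>{K<..P}. mangoldt d * w d)"
      by (simp only:) (rule sum.union_disjoint, auto)
    moreover have "\<bar>\<Sum>d\<in>{1..K}. mangoldt d * w d\<bar> \<le> 2 * \<Gamma> * y ^ 92"
    proof -
      have "\<bar>\<Sum>d\<in>{1..K}. mangoldt d * w d\<bar> \<le> (\<Sum>d\<in>{1..K}. \<Gamma> * 1)"
      proof (rule order_trans[OF sum_abs], rule sum_mono)
        fix d assume d: "d \<in> {1..K}"
        have "\<bar>w d\<bar> \<le> 1" unfolding w_def sawtooth_def
          using frac_ge_0[of "x / real d"] frac_lt_1[of "x / real d"] frac_ge_0[of "x / (real d + 1)"] frac_lt_1[of "x / (real d + 1)"]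
          by linarith
        thus "\<bar>mangoldt d * w d\<bar> \<le> \<Gamma> * 1"
          unfolding abs_mult using lam[of d] d KP PN mangoldt_nonneg[of d] \<Gamma> by (intro mult_mono) auto
      qed
      also have "\<dots> = real K * \<Gamma>" by simp
      also have "\<dots> \<le> (2 * y ^ 92) * \<Gamma>" using K \<Gamma> by (intro mult_right_mono) auto
      finally show ?thesis by (simp add: mult_ac)
    qed
    \<comment> \<open>As P \<le> 2^L, L doublings of K reach beyond P.\<close>
    moreover have "\<bar>\<Sum>d\<in>{K<..P}. mangoldt d * w d\<bar> \<le> real L * (110000 * \<Gamma> ^ 7 * y ^ 92)"
    proof (rule sum_doubling_bound[where N = P])
      fix D D' assume D: "K \<le> D" "D \<le> D'" "D' \<le> 2 * D" "D' \<le> P"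
      have "real K \<le> real D" "real D \<le> real P" using D by auto
      thus "\<bar>\<Sum>d\<in>{D<..D'}. mangoldt d * w d\<bar> \<le> 110000 * \<Gamma> ^ 7 * y ^ 92"
        unfolding w_def using K P D by (intro sawtooth_sum_bound[OF y x G]) auto
    next
      have "real P \<le> 1 * 2 ^ L"
      proof -
        have "real P \<le> x" using P P103 by linarith
        also have "\<dots> \<le> 100 * x ^ 3" using power_increasing[of 1 3 x] x1 by simp
        finally show ?thesis using G4(2) by linarith
      qed
      also have "\<dots> \<le> real K * 2 ^ L" using K y92 by (intro mult_right_mono) auto
      finally have "real P \<le> real (K * 2 ^ L)" by simp
      thus "P \<le> K * 2 ^ L" by (simp only: of_nat_le_iff)
    qed (use KP in auto)
    moreover have "real L * (110000 * \<Gamma> ^ 7 * y ^ 92) \<le> 110000 * \<Gamma> ^ 8 * y ^ 92"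
    proof -
      have "real L * (110000 * \<Gamma> ^ 7 * y ^ 92) \<le> \<Gamma> * (110000 * \<Gamma> ^ 7 * y ^ 92)"
        using G4(1) \<Gamma> y0 by (intro mult_right_mono) auto
      thus ?thesis by (simp add: eval_nat_numeral mult_ac)
    qed
    ultimately show ?thesis by linarith
  qed
  have T: "\<bar>x * (\<Sum>k<P. mangoldt_series_term k) - (\<Sum>k. mangoldt_series_term k) * x\<bar> \<le> 2 * \<Gamma> * y ^ 92"
  proof -
    define t where "t = (\<Sum>k. mangoldt_series_term k) - (\<Sum>k<P. mangoldt_series_term k)"
    have t: "0 \<le> t" "t \<le> tail_majorant (Suc P)" unfolding t_def by (rule mangoldt_series_tail)+
    have "tail_majorant (Suc P) \<le> (\<Gamma> + \<Gamma>) / y ^ 103"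
      unfolding tail_majorant_def
    proof (intro frac_le add_mono)
      have "real (Suc P) \<le> 2 * x" using P P103 x1 by simp
      hence "ln (real (Suc P)) \<le> ln (2 * x)" by simp
      thus "ln (real (Suc P)) \<le> \<Gamma>" using G3 by linarith
    qed (use P \<Gamma> y0 in auto)
    hence "x * t \<le> x * ((\<Gamma> + \<Gamma>) / y ^ 103)" using t x1 by (intro mult_left_mono) auto
    also have "\<dots> = 2 * \<Gamma> * (x / y ^ 103)" by simp
    also have "x / y ^ 103 = y ^ 92" unfolding xy by (rule nonzero_mult_div_cancel_right) (use y0 in simp)
    finally have "x * t \<le> 2 * \<Gamma> * y ^ 92" .
    moreover have "x * t \<ge> 0" using t x1 by simp
    moreover have "x * (\<Sum>k<P. mangoldt_series_term k) - (\<Sum>k. mangoldt_series_term k) * x = - (x * t)"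
      by (simp add: t_def algebra_simps)
    ultimately show ?thesis by linarith
  qed
  have "\<bar>S_Lambda x - (\<Sum>k. mangoldt_series_term k) * x\<bar> \<le> 5 * (\<Gamma> * y ^ 92) + 110000 * (\<Gamma> ^ 8 * y ^ 92)"
    using S S1 S2 W T by linarith
  also have "\<Gamma> * y ^ 92 \<le> \<Gamma> ^ 8 * y ^ 92" using power_increasing[of 1 8 \<Gamma>] \<Gamma> y0 by (intro mult_right_mono) auto
  finally show ?thesis by simp
qed

text \<open>The difference \<open>harm n - ln n\<close> decreases from its value 1 at n = 1.\<close>

lemma harm_le_ln: "n > 0 \<Longrightarrow> harm n \<le> ln (real n) + 1"
proof -
  assume "n > 0"
  then obtain m where m: "n = Suc m" by (cases n) auto
  have "harm (Suc m) - ln (real (Suc m)) \<le> harm (Suc 0) - ln (real (Suc 0))"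
    using decseqD[OF decseq_harm_diff_ln, of 0 m] by simp
  thus ?thesis by (simp add: m harm_def)
qed

lemma gamma_params_exists:
  fixes \<eta> :: real
  assumes \<eta>: "\<eta> > 0"
  obtains C where "C \<ge> 1" "\<forall>\<^sub>F x in at_top. \<exists>L. gamma_params x (C * x powr \<eta>) L"
proof -
  \<comment> \<open>Half the exponent, because divisors have to be counted for integers up to 4
    x^2.\<close>
  obtain C0 where C0: "C0 \<ge> 1" "\<And>n::nat. n > 0 \<Longrightarrow> real (card {d. d dvd n}) \<le> C0 * real n powr (\<eta> / 2)"
    using divisor_bound[of "\<eta> / 2"] \<eta> by auto
  define C where "C = C0 * 4 powr (\<eta> / 2)"
  have "1 * 1 \<le> C0 * 4 powr (\<eta> / 2)" using C0(1) \<eta> by (intro mult_mono) (auto intro: ge_one_powr_ge_zero)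
  hence C: "C \<ge> 1" by (simp add: C_def)
  have "\<forall>\<^sub>F x in at_top. \<exists>L. gamma_params x (C * x powr \<eta>) L"
  proof -
    have e1: "\<forall>\<^sub>F x in at_top. ln (4 * x) + 1 \<le> x powr \<eta>" using \<eta> by real_asymp
    have e2: "\<forall>\<^sub>F x in at_top. ln (100 * x ^ 3) / ln 2 + 2 \<le> x powr \<eta>" using \<eta> by real_asymp
    show ?thesis using e1 e2 eventually_ge_at_top[of 1]
    proof eventually_elim
      case (elim x)
      have x: "x \<ge> 1" by fact
      have xC: "x powr \<eta> \<le> C * x powr \<eta>" using mult_right_mono[OF C, of "x powr \<eta>"] by simp
      define L where "L = nat \<lceil>ln (100 * x ^ 3) / ln 2\<rceil>"
      have "1 \<le> x ^ 3" using x by (intro one_le_power)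
      hence x3: "100 * x ^ 3 \<ge> 1" by linarith
      have "gamma_params x (C * x powr \<eta>) L"
      proof
        fix k :: nat assume k: "0 < k" "real k \<le> 4 * x\<^sup>2"
        have "real (card {d. d dvd k}) \<le> C0 * real k powr (\<eta> / 2)" by (rule C0(2)[OF k(1)])
        also have "\<dots> \<le> C0 * (4 * x\<^sup>2) powr (\<eta> / 2)" using k \<eta> C0(1) by (intro mult_left_mono powr_mono2) auto
        also have "(4 * x\<^sup>2) powr (\<eta> / 2) = 4 powr (\<eta> / 2) * x powr \<eta>"
          using x by (simp add: powr_mult powr_powr flip: powr_numeral)
        finally show "real (card {d. d dvd k}) \<le> C * x powr \<eta>" by (simp add: C_def mult_ac)
      next
        fix n :: nat assume n: "real n \<le> 4 * x"
        show "harm n \<le> C * x powr \<eta>"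
        proof (cases "n = 0")
          case True
          thus ?thesis using C by (simp add: harm_def)
        next
          case False
          hence "harm n \<le> ln (real n) + 1" by (intro harm_le_ln) auto
          also have "ln (real n) \<le> ln (4 * x)" using False n x by simp
          finally show ?thesis using elim(1) xC by linarith
        qed
      next
        have "ln (2 * x) \<le> ln (4 * x)" using x by simp
        thus "ln (2 * x) \<le> C * x powr \<eta>" using elim(1) xC by linarith
      next
        have "ln (100 * x ^ 3) / ln 2 \<ge> 0" using x3 by simp
        hence "real L \<le> ln (100 * x ^ 3) / ln 2 + 1" unfolding L_def by linarith
        thus "real L + 1 \<le> C * x powr \<eta>" using elim(2) xC by linarith
      next
        have "ln (100 * x ^ 3) / ln 2 \<le> real L" unfolding L_def by linarith
        hence "ln (100 * x ^ 3) \<le> real L * ln 2" by (simp add: field_simps)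
        also have "\<dots> = ln (2 ^ L)" by (simp add: ln_realpow)
        finally show "100 * x ^ 3 \<le> 2 ^ L" using x by (subst (asm) ln_le_cancel_iff) auto
      qed
      thus ?case by blast
    qed
  qed
  thus ?thesis using that C by blast
qed

theorem theorem1p1:
  shows "summable mangoldt_series_term \<and>
    (\<forall>\<epsilon>::real. \<epsilon> > 0 \<longrightarrow>
      (\<lambda>x::real. S_Lambda x - (\<Sum>k. mangoldt_series_term k) * x)
        \<in> O[at_top](\<lambda>x. x powr (7/15 + 1/195 + \<epsilon>)))"
proof (intro conjI allI impI summable_mangoldt_series)
  fix \<epsilon> :: real assume \<epsilon>: "\<epsilon> > 0"
  \<comment> \<open>\<open>S_Lambda_bound\<close> contains the eighth power of \<Gamma>, hence
    \<epsilon>/8.\<close>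
  obtain C where C: "C \<ge> 1" and ev: "\<forall>\<^sub>F x in at_top. \<exists>L. gamma_params x (C * x powr (\<epsilon> / 8)) L"
    using gamma_params_exists[of "\<epsilon> / 8"] \<epsilon> by auto
  show "(\<lambda>x::real. S_Lambda x - (\<Sum>k. mangoldt_series_term k) * x) \<in> O[at_top](\<lambda>x. x powr (7/15 + 1/195 + \<epsilon>))"
  proof (rule bigoI[of _ "110005 * C ^ 8"])
    show "\<forall>\<^sub>F x in at_top. norm (S_Lambda x - (\<Sum>k. mangoldt_series_term k) * x) \<le> 110005 * C ^ 8 * norm (x powr (7/15 + 1/195 + \<epsilon>))"
      \<comment> \<open>From this x on, y = x^(1/195) is at least 128.\<close>
      using ev eventually_ge_at_top[of "128 ^ 195"]
    proof eventually_elim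
      case (elim x)
      then obtain L where L: "gamma_params x (C * x powr (\<epsilon> / 8)) L" by blast
      have x0: "x > 0" by (rule less_le_trans[OF _ elim(2)]) simp
      define y where "y = x powr (1 / 195)"
      have yp: "y ^ k = x powr (real k / 195)" for k using x0 by (simp add: y_def powr_powr flip: powr_realpow)
      have xy: "x = y ^ 195" using x0 by (simp add: yp)
      have y: "y \<ge> 128"
      proof (rule ccontr)
        assume "\<not> y \<ge> 128"
        hence "y ^ 195 < 128 ^ 195" using x0 by (intro power_strict_mono) (auto simp: y_def)
        thus False using elim(2) xy by simp
      qed
      have "\<bar>S_Lambda x - (\<Sum>k. mangoldt_series_term k) * x\<bar> \<le> 110005 * (C * x powr (\<epsilon> / 8)) ^ 8 * y ^ 92"
        by (rule S_Lambda_bound[OF y xy L])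
      also have "\<dots> = 110005 * C ^ 8 * (x powr \<epsilon> * x powr (92 / 195))"
        using x0 by (simp add: yp power_mult_distrib powr_powr flip: powr_realpow)
      also have "x powr \<epsilon> * x powr (92 / 195) = x powr (7/15 + 1/195 + \<epsilon>)"
        by (simp add: add.commute flip: powr_add)
      finally show ?case by simp
    qed
  qed
qed

end
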